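(* Let $B$ be a standard Brownian motion on $[0,1]$ with $B(0)=0$, let $h=\max_{0\le s\le1}B(s)$, let $\theta$ be the smallest $s$ with $B(s)=h$, and let $c=B(1)$; assume $0<\theta<1$ and $h>\max(0,c)$. With $M_1,M_2,Vr$ as defined in the context, the conditional moments of $B(t)$ given $(c,\theta,h)$ are as follows. For $0\le t\le\theta$, $$E[B(t)\mid c,\theta,h]=h-\sqrt{\theta}\,M_1\Big(1-\frac t\theta,\frac{h}{\sqrt\theta}\Big)$$ $$=h-\sqrt{\theta}\Big[\frac{t}{h\sqrt\theta}+\frac{h(\theta-t)}{\theta^{3/2}}\Big]\mathrm{erf}\Big(\frac{h\sqrt{\theta-t}}{\sqrt{2t\theta}}\Big)-\frac{\sqrt{2t(\theta-t)}}{\sqrt{\pi\theta}}\exp\Big(-\frac{(\theta-t)h^2}{2t\theta}\Big).$$ For $\theta\le t\le 1$, $$E[B(t)\mid c,\theta,h]=h-\sqrt{1-\theta}\,M_1\Big(\frac{t-\theta}{1-\theta},\frac{h-c}{\sqrt{1-\theta}}\Big).$$ For $0\le t\le\theta$, with $s=1-\frac{t}{\theta}$, $$E[B^2(t)\mid c,\theta,h]=h^2-2h\sqrt\theta\,M_1\Big(s,\frac{h}{\sqrt\theta}\Big)+\theta\,M_2\Big(s,\frac h{\sqrt\theta}\Big).$$ The conditional variance satisfies $$\mathrm{Var}[B(t)\mid c,\theta,h]=\theta\,Vr\Big(1-\frac t\theta,\frac{h}{\sqrt\theta}\Big)\quad\text{for } 0\le t\le\theta,$$ $$\mathrm{Var}[B(t)\mid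 c,\theta,h]=(1-\theta)\,Vr\Big(\frac{t-\theta}{1-\theta},\frac{h-c}{\sqrt{1-\theta}}\Big)\quad\text{for }\theta\le t\le1.$$
   Context: For $0\le s\le 1$ and $y>0$ define $$M_1(s,y)=\frac{1}{y}\big[1-s+s y^2\big]\,\mathrm{erf}\Big(\frac{y\sqrt s}{\sqrt{2(1-s)}}\Big)+\sqrt{\frac{2s(1-s)}{\pi}}\,\exp\Big(-\frac{s y^2}{2(1-s)}\Big),$$ $$M_2(s,y)=3s(1-s)+y^2s^2,\qquad Vr(s,y)=M_2(s,y)-M_1(s,y)^2,$$ where expressions singular at an endpoint are read as their limits (so $M_1(1,y)=y$; likewise the explicit formula at $t=0$). These are the first two moments and the variance at time $s$ of the standard Brownian meander on $[0,1]$ conditioned to have final value $y$. Here $\mathrm{erf}(z)=\frac{2}{\sqrt\pi}\int_0^ze^{-u^2}du$. The letters $c,\theta,h$ denote both the random variables $B(1)$, first argmax and maximum of $B$ on $[0,1]$, and their values. Conditional expectations and variances are with respect to the regular conditional distribution given $(B(1),\text{first argmax},\max)=(c,\theta,h)$, the formulas giving a version (valid for Lebesgue-almost every $(c,\theta,h)$). *)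

theory Defs
  imports "HOL-Probability.Probability" "HOL-Real_Asymp.Real_Asymp"
begin

section \<open>The functions \<open>erf\<close>, \<open>M1\<close>, \<open>M2\<close>, \<open>Vr\<close>\<close>

definition erf :: "real \<Rightarrow> real" where
  "erf z = 2 / sqrt pi * (LBINT u=0..z. exp (- u\<^sup>2))"

text \<open>
  The formula for \<open>M1\<close> divides by \<open>1 - s\<close>, so at \<open>s = 1\<close> it is replaced by its limit
  (see \<open>M1_tendsto_1\<close>).
\<close>
definition M1 :: "real \<Rightarrow> real \<Rightarrow> real" where
  "M1 s y =
     (if s = 1 then y
      else 1 / y * (1 - s + s * y\<^sup>2) * erf (y * sqrt s / sqrt (2 * (1 - s)))
           + sqrt (2 * s * (1 - s) / pi) * exp (- (s * y\<^sup>2) / (2 * (1 - s))))"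

definition M2 :: "real \<Rightarrow> real \<Rightarrow> real" where
  "M2 s y = 3 * s * (1 - s) + y\<^sup>2 * s\<^sup>2"

definition Vr :: "real \<Rightarrow> real \<Rightarrow> real" where
  "Vr s y = M2 s y - (M1 s y)\<^sup>2"

text \<open>
  The explicit conditional mean before the argmax. The formula divides by \<open>t\<close>, so at \<open>t = 0\<close>
  it is replaced by its limit (see \<open>pre_max_mean_tendsto_0\<close>).
\<close>
definition pre_max_mean :: "real \<Rightarrow> real \<Rightarrow> real \<Rightarrow> real" where
  "pre_max_mean \<theta> h t =
     (if t = 0 then 0
      else h - sqrt \<theta> * (t / (h * sqrt \<theta>) + h * (\<theta> - t) / \<theta> powr (3/2))
                 * erf (h * sqrt (\<theta> - t) / sqrt (2 * t * \<theta>))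
             - sqrt (2 * t * (\<theta> - t)) / sqrt (pi * \<theta>) * exp (- ((\<theta> - t) * h\<^sup>2) / (2 * t * \<theta>)))"

lemma tendsto_erf_at_top: "(erf \<longlongrightarrow> 1) at_top"
proof -
  let ?g = "\<lambda>u::real. indicator {0..} u *\<^sub>R exp (- u\<^sup>2) :: real"
  have g: "integrable lborel ?g" "integral\<^sup>L lborel ?g = sqrt pi / 2"
    using gaussian_moment_0 by (auto simp: has_bochner_integral_iff)
  have "((\<lambda>z. \<integral>u. indicator {.. z} u *\<^sub>R ?g u \<partial>lborel) \<longlongrightarrow> sqrt pi / 2) at_top"
    using tendsto_integral_at_top[OF _ g(1)] unfolding g(2) by simp
  then have lim: "((\<lambda>z. 2 / sqrt pi * (\<integral>u. indicator {.. z} u *\<^sub>R ?g u \<partial>lborel))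
      \<longlongrightarrow> 2 / sqrt pi * (sqrt pi / 2)) at_top"
    by (intro tendsto_intros)
  have eq: "erf z = 2 / sqrt pi * (\<integral>u. indicator {.. z} u *\<^sub>R ?g u \<partial>lborel)" if "z \<ge> 0" for z
  proof -
    have "(LBINT u=0..z. exp (- u\<^sup>2)) = (LBINT u:{0..z}. exp (- u\<^sup>2))"
      using that by (simp add: interval_integral_Icc zero_ereal_def)
    also have "\<dots> = (\<integral>u. indicator {.. z} u *\<^sub>R ?g u \<partial>lborel)"
      unfolding set_lebesgue_integral_def
      by (intro Bochner_Integration.integral_cong) (auto simp: indicator_def)
    finally show ?thesis
      by (simp add: erf_def)
  qed
  have "(erf \<longlongrightarrow> 2 / sqrt pi * (sqrt pi / 2)) at_top"
    by (rule Lim_transform_eventually[OF lim])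
       (use eq in \<open>auto intro!: eventually_mono[OF eventually_ge_at_top[of 0]]\<close>)
  then show ?thesis by simp
qed

lemma M1_tendsto_1:
  assumes "y > 0"
  shows "((\<lambda>s. M1 s y) \<longlongrightarrow> M1 1 y) (at_left 1)"
proof -
  have arg: "filterlim (\<lambda>s. y * sqrt s / sqrt (2 * (1 - s))) at_top (at_left 1)"
    using assms by real_asymp
  have e: "((\<lambda>s. sqrt (2 * s * (1 - s) / pi) * exp (- (s * y\<^sup>2) / (2 * (1 - s)))) \<longlongrightarrow> 0) (at_left 1)"
    using assms by real_asymp
  have c: "((\<lambda>s. 1 / y * (1 - s + s * y\<^sup>2)) \<longlongrightarrow> 1 / y * (1 - 1 + 1 * y\<^sup>2)) (at_left 1)"
    by (intro tendsto_intros)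
  have "((\<lambda>s. 1 / y * (1 - s + s * y\<^sup>2) * erf (y * sqrt s / sqrt (2 * (1 - s)))
      + sqrt (2 * s * (1 - s) / pi) * exp (- (s * y\<^sup>2) / (2 * (1 - s))))
      \<longlongrightarrow> 1 / y * (1 - 1 + 1 * y\<^sup>2) * 1 + 0) (at_left 1)"
    by (intro tendsto_add tendsto_mult[OF c] e filterlim_compose[OF tendsto_erf_at_top arg])
  moreover have "\<forall>\<^sub>F s in at_left 1. s \<noteq> (1::real)"
    by (simp add: eventually_at_filter)
  ultimately have "((\<lambda>s. M1 s y) \<longlongrightarrow> 1 / y * (1 - 1 + 1 * y\<^sup>2) * 1 + 0) (at_left 1)"
    by (elim Lim_transform_eventually) (elim eventually_mono, simp add: M1_def)
  then show ?thesis
    using assms by (simp add: M1_def power2_eq_square)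
qed

lemma pre_max_mean_tendsto_0:
  assumes "\<theta> > 0" "h > 0"
  shows "(pre_max_mean \<theta> h \<longlongrightarrow> pre_max_mean \<theta> h 0) (at_right 0)"
proof -
  have arg: "filterlim (\<lambda>t. h * sqrt (\<theta> - t) / sqrt (2 * t * \<theta>)) at_top (at_right 0)"
    using assms by real_asymp
  have e: "((\<lambda>t. sqrt (2 * t * (\<theta> - t)) / sqrt (pi * \<theta>) * exp (- ((\<theta> - t) * h\<^sup>2) / (2 * t * \<theta>)))
      \<longlongrightarrow> 0) (at_right 0)"
    using assms by real_asymp
  have c: "((\<lambda>t. sqrt \<theta> * (t / (h * sqrt \<theta>) + h * (\<theta> - t) / \<theta> powr (3/2)))
      \<longlongrightarrow> sqrt \<theta> * (0 / (h * sqrt \<theta>) + h * (\<theta> - 0) / \<theta> powr (3/2))) (at_right 0)"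
    using assms by (intro tendsto_intros) auto
  have pw: "\<theta> powr (3/2) = \<theta> * sqrt \<theta>"
    using assms powr_add[of \<theta> 1 "1/2"] by (simp add: powr_half_sqrt)
  have "((\<lambda>t. h - sqrt \<theta> * (t / (h * sqrt \<theta>) + h * (\<theta> - t) / \<theta> powr (3/2))
                 * erf (h * sqrt (\<theta> - t) / sqrt (2 * t * \<theta>))
             - sqrt (2 * t * (\<theta> - t)) / sqrt (pi * \<theta>) * exp (- ((\<theta> - t) * h\<^sup>2) / (2 * t * \<theta>)))
      \<longlongrightarrow> h - sqrt \<theta> * (0 / (h * sqrt \<theta>) + h * (\<theta> - 0) / \<theta> powr (3/2)) * 1 - 0) (at_right 0)"
    by (intro tendsto_diff tendsto_const tendsto_mult[OF c] e
          filterlim_compose[OF tendsto_erf_at_top arg])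
  moreover have "\<forall>\<^sub>F t in at_right 0. t \<noteq> (0::real)"
    by (simp add: eventually_at_filter)
  ultimately have "(pre_max_mean \<theta> h
      \<longlongrightarrow> h - sqrt \<theta> * (0 / (h * sqrt \<theta>) + h * (\<theta> - 0) / \<theta> powr (3/2)) * 1 - 0) (at_right 0)"
    by (elim Lim_transform_eventually) (elim eventually_mono, simp add: pre_max_mean_def)
  then show ?thesis
    using assms by (simp add: pre_max_mean_def pw)
qed


section \<open>Brownian motion on the unit interval\<close>

definition std_brownian_motion :: "'a measure \<Rightarrow> (real \<Rightarrow> 'a \<Rightarrow> real) \<Rightarrow> bool" where
  "std_brownian_motion M B \<longleftrightarrow>
     prob_space M \<and>
     (\<forall>t\<in>{0..1}. B t \<in> borel_measurable M) \<and>
     (\<forall>\<omega>\<in>space M. B 0 \<omega> = 0 \<and> continuous_on {0..1} (\<lambda>t. B t \<omega>)) \<and>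
     (\<forall>s t. 0 \<le> s \<longrightarrow> s < t \<longrightarrow> t \<le> 1 \<longrightarrow>
        distributed M lborel (\<lambda>\<omega>. B t \<omega> - B s \<omega>) (\<lambda>x. ennreal (normal_density 0 (sqrt (t - s)) x))) \<and>
     (\<forall>n (\<tau> :: nat \<Rightarrow> real). mono_on {..n} \<tau> \<longrightarrow> \<tau> ` {..n} \<subseteq> {0..1} \<longrightarrow>
        prob_space.indep_vars M (\<lambda>_. borel) (\<lambda>i \<omega>. B (\<tau> (Suc i)) \<omega> - B (\<tau> i) \<omega>) {..<n})"

definition path_max :: "(real \<Rightarrow> real) \<Rightarrow> real" where
  "path_max f = (SUP s\<in>{0..1}. f s)"

definition first_argmax :: "(real \<Rightarrow> real) \<Rightarrow> real" where
  "first_argmax f = (LEAST s. s \<in> {0..1} \<and> f s = path_max f)"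

text \<open>
  The space \<open>C[0,1]\<close> with the cylinder \<open>\<sigma>\<close>-algebra (which is its Borel \<open>\<sigma>\<close>-algebra). Its points
  are the functions that are continuous on \<open>{0..1}\<close> and \<open>undefined\<close> elsewhere.
\<close>
definition path_space :: "(real \<Rightarrow> real) measure" where
  "path_space = restrict_space (PiM {0..1} (\<lambda>_. borel)) {f. continuous_on {0..1} f}"

definition sample_path :: "(real \<Rightarrow> 'a \<Rightarrow> real) \<Rightarrow> 'a \<Rightarrow> real \<Rightarrow> real" where
  "sample_path B \<omega> = (\<lambda>t\<in>{0..1}. B t \<omega>)"

definition end_argmax_max :: "(real \<Rightarrow> 'a \<Rightarrow> real) \<Rightarrow> 'a \<Rightarrow> real \<times> real \<times> real" where
  "end_argmax_max B \<omega> = (B 1 \<omega>, first_argmax (\<lambda>s. B s \<omega>), path_max (\<lambda>s. B s \<omega>))"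


section \<open>Regular conditional distributions\<close>

text \<open>
  \<open>\<kappa>\<close> is a regular conditional distribution of the \<open>S\<close>-valued random variable \<open>Y\<close> given the
  \<open>N\<close>-valued random variable \<open>X\<close>: a Markov kernel from \<open>N\<close> to \<open>S\<close> that disintegrates the joint law.
\<close>
definition regular_cond_distr ::
  "'a measure \<Rightarrow> 'b measure \<Rightarrow> ('a \<Rightarrow> 'b) \<Rightarrow> 'c measure \<Rightarrow> ('a \<Rightarrow> 'c) \<Rightarrow> ('b \<Rightarrow> 'c measure) \<Rightarrow> bool" where
  "regular_cond_distr M N X S Y \<kappa> \<longleftrightarrow>
     X \<in> measurable M N \<and> Y \<in> measurable M S \<and> \<kappa> \<in> measurable N (prob_algebra S) \<and>
     (\<forall>A\<in>sets N. \<forall>C\<in>sets S.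
        emeasure M {\<omega> \<in> space M. X \<omega> \<in> A \<and> Y \<omega> \<in> C} =
        (\<integral>\<^sup>+x\<in>A. emeasure (\<kappa> x) C \<partial>distr M N X))"

end

theory Submission
  imports Defs
begin

text \<open>
  The reflection principle gives the joint law of the maximum and the final value of Brownian motion
  over an interval. Splitting \<open>[0,1]\<close> at a time \<open>u\<close> and comparing the maxima over the two independent
  parts yields the law of (first argmax \<open>\<theta>\<close>, maximum \<open>h\<close>, final value \<open>c\<close>): its density is
  \<open>2 q\<^sub>\<theta>(h) q\<^sub>1\<^sub>-\<^sub>\<theta>(h - c)\<close>, where \<open>q\<^sub>s(x)\<close> is the density of the first passage through \<open>x\<close> at time \<open>s\<close>.
  Splitting at \<open>t\<close> instead, the law of \<open>(B(t), c, \<theta>, h)\<close> on \<open>{t < \<theta>}\<close> is the law of the peak over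
  \<open>[t,1]\<close> combined with the law of maximum and final value over \<open>[0,t]\<close>, and symmetrically on \<open>{\<theta> < t}\<close>.
  Hence the conditional density of \<open>z = h - B(t)\<close> is proportional to \<open>k(b, z) q(z)\<close> with \<open>k\<close> the
  transition density of Brownian motion killed at \<open>0\<close>; the Gaussian integrals of \<open>z k q\<close> and
  \<open>z\<^sup>2 k q\<close> are \<open>M1\<close> and \<open>M2\<close>. This identifies the moments under \<open>\<kappa>\<close> for almost every
  \<open>(c, \<theta>, h)\<close> at all rational \<open>t\<close>; dominated convergence, with the square of the supremum of \<open>\<bar>B\<bar>\<close>
  as dominating function, extends this to all \<open>t\<close>.
\<close>

section \<open>Gaussian and first-passage integrals\<close>

text \<open>The gap h - B(t) is studied instead of B(t) because it is nonnegative: the identities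
  leading to the conditional moments are then identities between nonnegative integrals, where Fubini
  holds unconditionally. The density of the argmax is not found by differentiation but verified
  through distribution functions: the event \<theta> \<le> u compares the maxima over [0,u] and
  [u,1], which leads to an integral over the position at time u, whereas the candidate density is
  integrated over \<theta> < u; both integrals have the closed form \<open>pass_kill\<close>. The
  definition of Brownian motion gives independence only for increments along finite grids, so
  independence is first carried over to the sigma-algebras generated by the increments of adjacent
  intervals, in which running maxima and argmaxes are measurable. Applied at deterministic grid
  times, this also replaces the strong Markov property in the reflection principle. The moment
  identity for a single t holds outside a null set of (c, \<theta>, h) that depends on t, and
  uncountably many null sets cannot be united; this is why rational times come first.\<close>

definition gauss :: "real \<Rightarrow> real \<Rightarrow> real" where
  "gauss s x = exp (- x\<^sup>2 / (2 * s)) / sqrt (2 * pi * s)"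

text \<open>The density at time \<open>s\<close> of the first passage through the level \<open>x\<close>.\<close>
definition passage :: "real \<Rightarrow> real \<Rightarrow> real" where
  "passage s x = x / s * gauss s x"

text \<open>The transition density of Brownian motion killed at \<open>0\<close>.\<close>
definition killed :: "real \<Rightarrow> real \<Rightarrow> real \<Rightarrow> real" where
  "killed s x z = gauss s (x - z) - gauss s (x + z)"

lemma gauss_eq_normal_density: "s > 0 \<Longrightarrow> gauss s x = normal_density 0 (sqrt s) x"
  by (simp add: gauss_def normal_density_def)

lemma measurable_gauss [measurable (raw)]:
  assumes [measurable]: "f \<in> borel_measurable N" "g \<in> borel_measurable N"
  shows "(\<lambda>w. gauss (f w) (g w)) \<in> borel_measurable N"
  unfolding gauss_def by measurable

lemma gauss_nonneg [simp]: "s \<ge> 0 \<Longrightarrow> gauss s x \<ge> 0"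
  by (simp add: gauss_def)

lemma gauss_minus [simp]: "gauss s (- x) = gauss s x"
  by (simp add: gauss_def)

lemma gauss_diff_commute: "gauss s (x - y) = gauss s (y - x)"
  by (simp add: gauss_def power2_commute)

lemma DERIV_gauss [derivative_intros]:
  assumes "s > 0" "(f has_real_derivative f') (at x)"
  shows "((\<lambda>x. gauss s (f x)) has_real_derivative - (f x / s * gauss s (f x)) * f') (at x)"
proof -
  have "((\<lambda>x. exp (- (f x)\<^sup>2 / (2 * s))) has_real_derivative - (f x / s * exp (- (f x)\<^sup>2 / (2 * s))) * f') (at x)"
    using assms(1) by (auto intro!: derivative_eq_intros assms(2) simp: field_simps)
  from DERIV_cdivide[OF this, of "sqrt (2 * pi * s)"] show ?thesis
    unfolding gauss_def by (simp add: field_simps)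
qed

lemma gauss_mono_abs: "s > 0 \<Longrightarrow> \<bar>x\<bar> \<le> \<bar>y\<bar> \<Longrightarrow> gauss s y \<le> gauss s x"
  unfolding gauss_def
  by (auto intro!: divide_right_mono simp: divide_simps power2_le_iff_abs_le abs_le_square_iff)

lemma killed_nonneg: "s > 0 \<Longrightarrow> x \<ge> 0 \<Longrightarrow> z \<ge> 0 \<Longrightarrow> killed s x z \<ge> 0"
  unfolding killed_def using gauss_mono_abs[of s "x - z" "x + z"] by simp

lemma passage_nonneg: "s > 0 \<Longrightarrow> x \<ge> 0 \<Longrightarrow> passage s x \<ge> 0"
  by (simp add: passage_def)

lemma passage_pos: "s > 0 \<Longrightarrow> x > 0 \<Longrightarrow> passage s x > 0"
  by (simp add: passage_def gauss_def)

lemma measurable_passage [measurable (raw)]: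
  assumes [measurable]: "f \<in> borel_measurable N" "g \<in> borel_measurable N"
  shows "(\<lambda>w. passage (f w) (g w)) \<in> borel_measurable N"
  unfolding passage_def by measurable

lemma measurable_killed [measurable (raw)]:
  assumes [measurable]: "f \<in> borel_measurable N" "g \<in> borel_measurable N" "k \<in> borel_measurable N"
  shows "(\<lambda>w. killed (f w) (g w) (k w)) \<in> borel_measurable N"
  unfolding killed_def by measurable

text \<open>Completing the square: a step from 0 to z in time s followed by one from z to b in time
  r is a step from 0 to b weighted with the law of the Brownian bridge at time s, which has mean s b
  / (r + s) and variance r s / (r + s).\<close>

lemma gauss_mult_gauss:
  assumes "s > 0" "r > 0"
  shows "gauss s z * gauss r (b - z) = gauss (r + s) b * gauss (r * s / (r + s)) (z - s * b / (r + s))"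
proof -
  have e: "- z\<^sup>2 / (2 * s) + - (b - z)\<^sup>2 / (2 * r)
      = - b\<^sup>2 / (2 * (r + s)) + - (z - s * b / (r + s))\<^sup>2 / (2 * (r * s / (r + s)))"
  proof -
    have rs: "r + s > 0" using assms by simp
    define T where "T = r + s"
    have r: "r = T - s" and T: "T > 0" using rs by (auto simp: T_def)
    have ne: "T - s \<noteq> 0" "s \<noteq> 0" "T \<noteq> 0" using assms T by (auto simp: r)
    have "(- z\<^sup>2 / (2 * s) + - (b - z)\<^sup>2 / (2 * (T - s))) * (2 * s * (T - s) * T)
      = (- b\<^sup>2 / (2 * T) + - (z - s * b / T)\<^sup>2 / (2 * ((T - s) * s / T))) * (2 * s * (T - s) * T)"
      using ne by (simp add: divide_simps power2_eq_square) (simp add: algebra_simps)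
    thus ?thesis using ne unfolding T_def[symmetric] unfolding r by simp
  qed
  have s: "sqrt (2 * pi * s) * sqrt (2 * pi * r) = sqrt (2 * pi * (r + s)) * sqrt (2 * pi * (r * s / (r + s)))"
    using assms by (simp add: real_sqrt_mult[symmetric])
  show ?thesis
    unfolding gauss_def times_divide_times_eq exp_add[symmetric] e s ..
qed

section \<open>The error function and truncated Gaussian moments\<close>

lemma DERIV_erf [derivative_intros]:
  assumes "(f has_real_derivative f') (at x)"
  shows "((\<lambda>x. erf (f x)) has_real_derivative 2 / sqrt pi * exp (- (f x)\<^sup>2) * f') (at x)"
proof -
  have base: "(erf has_real_derivative 2 / sqrt pi * exp (- z\<^sup>2)) (at z)" for z
  proof -
    \<comment> \<open>The interval has 0 and z in its interior, so the derivative within it is the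
      full derivative at z.\<close>
    define a where "a = - \<bar>z\<bar> - 1" define b where "b = \<bar>z\<bar> + 1"
    have "((\<lambda>z. LBINT u=0..z. exp (- u\<^sup>2)) has_vector_derivative exp (- z\<^sup>2)) (at z within {a..b})"
      using interval_integral_FTC2[of a 0 b "\<lambda>u. exp (- u\<^sup>2)" z]
      by (simp add: a_def b_def zero_ereal_def continuous_intros)
    then have "((\<lambda>z. LBINT u=0..z. exp (- u\<^sup>2)) has_vector_derivative exp (- z\<^sup>2)) (at z)"
      by (subst (asm) at_within_interior) (auto simp: a_def b_def)
    then have "((\<lambda>z. LBINT u=0..z. exp (- u\<^sup>2)) has_real_derivative exp (- z\<^sup>2)) (at z)"
      by (simp add: has_real_derivative_iff_has_vector_derivative)
    from DERIV_cmult[OF this, of "2 / sqrt pi"] show ?thesis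
      unfolding erf_def by simp
  qed
  show ?thesis
    using DERIV_chain2[OF base assms] .
qed

lemma erf_0 [simp]: "erf 0 = 0"
  by (simp add: erf_def zero_ereal_def[symmetric])

lemma erf_minus [simp]: "erf (- z) = - erf z"
proof -
  have "\<forall>x. ((\<lambda>z. erf z + erf (- z)) has_real_derivative 0) (at x)"
    by (auto intro!: derivative_eq_intros)
  from DERIV_isconst_all[OF this, of z 0] show ?thesis by simp
qed

lemma isCont_erf: "isCont erf z"
  using DERIV_isCont[OF DERIV_erf[OF DERIV_ident]] by simp

lemma continuous_on_erf [continuous_intros]:
  "continuous_on A f \<Longrightarrow> continuous_on A (\<lambda>x. erf (f x))"
  by (rule continuous_on_compose2[of UNIV erf]) (auto simp: continuous_on_eq_continuous_at isCont_erf)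

lemma tendsto_erf_at_bot: "(erf \<longlongrightarrow> - 1) at_bot"
proof -
  have "((\<lambda>z. - erf (- z)) \<longlongrightarrow> - 1) at_bot"
    by (intro tendsto_minus filterlim_compose[OF tendsto_erf_at_top] filterlim_uminus_at_top_at_bot)
  then show ?thesis by simp
qed

text \<open>Writing the normal distribution function through \<open>erf\<close> makes the closed
  forms come out in the shape used by \<open>M1\<close>.\<close>

definition gauss_cdf :: "real \<Rightarrow> real \<Rightarrow> real" where
  "gauss_cdf v x = (1 + erf (x / sqrt (2 * v))) / 2"

lemma DERIV_gauss_cdf [derivative_intros]:
  assumes "v > 0" "(f has_real_derivative f') (at x)"
  shows "((\<lambda>x. gauss_cdf v (f x)) has_real_derivative gauss v (f x) * f') (at x)"
proof -
  have "((\<lambda>x. f x / sqrt (2 * v)) has_real_derivative f' / sqrt (2 * v)) (at x)"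
    by (rule DERIV_cdivide assms)+
  from DERIV_erf[OF this] have "((\<lambda>x. erf (f x / sqrt (2 * v))) has_real_derivative 2 * (gauss v (f x) * f')) (at x)"
    using assms(1) by (simp add: gauss_def power_divide real_sqrt_mult field_simps)
  from DERIV_cdivide[OF DERIV_add[OF DERIV_const[of 1] this], of 2] show ?thesis
    unfolding gauss_cdf_def by simp
qed

lemma tendsto_gauss_cdf_at_top: "v > 0 \<Longrightarrow> ((\<lambda>z. gauss_cdf v (z - \<mu>)) \<longlongrightarrow> 1) at_top"
proof -
  assume v: "v > 0"
  have "filterlim (\<lambda>z. (z - \<mu>) / sqrt (2 * v)) at_top at_top"
    using v by real_asymp
  from filterlim_compose[OF tendsto_erf_at_top this]
  have "((\<lambda>z. (1 + erf ((z - \<mu>) / sqrt (2 * v))) / 2) \<longlongrightarrow> (1 + 1) / 2) at_top"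
    by (intro tendsto_intros) auto
  then show ?thesis unfolding gauss_cdf_def by simp
qed

text \<open>Antiderivatives of \<open>w\<^sup>k\<close> times a Gaussian density with mean \<open>\<mu>\<close> and variance \<open>v\<close>.\<close>
definition gmom1 :: "real \<Rightarrow> real \<Rightarrow> real \<Rightarrow> real" where
  "gmom1 v \<mu> z = \<mu> * gauss_cdf v (z - \<mu>) - v * gauss v (z - \<mu>)"

definition gmom2 :: "real \<Rightarrow> real \<Rightarrow> real \<Rightarrow> real" where
  "gmom2 v \<mu> z = (\<mu>\<^sup>2 + v) * gauss_cdf v (z - \<mu>) - v * (z + \<mu>) * gauss v (z - \<mu>)"

definition gmom3 :: "real \<Rightarrow> real \<Rightarrow> real \<Rightarrow> real" where
  "gmom3 v \<mu> z = (\<mu> ^ 3 + 3 * \<mu> * v) * gauss_cdf v (z - \<mu>)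
     - v * (z\<^sup>2 + \<mu> * z + \<mu>\<^sup>2 + 2 * v) * gauss v (z - \<mu>)"

lemma DERIV_gmom:
  assumes v: "v > 0"
  shows "(gmom1 v \<mu> has_real_derivative z * gauss v (z - \<mu>)) (at z)"
    and "(gmom2 v \<mu> has_real_derivative z\<^sup>2 * gauss v (z - \<mu>)) (at z)"
    and "(gmom3 v \<mu> has_real_derivative z ^ 3 * gauss v (z - \<mu>)) (at z)"
proof -
  show "(gmom1 v \<mu> has_real_derivative z * gauss v (z - \<mu>)) (at z)"
    unfolding gmom1_def
    by (rule derivative_eq_intros refl v)+ (use v in \<open>simp add: field_simps\<close>)
  show "(gmom2 v \<mu> has_real_derivative z\<^sup>2 * gauss v (z - \<mu>)) (at z)"
    unfolding gmom2_def
    by (rule derivative_eq_intros refl v)+ (use v in \<open>simp add: field_simps power2_eq_square\<close>)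
  show "(gmom3 v \<mu> has_real_derivative z ^ 3 * gauss v (z - \<mu>)) (at z)"
    unfolding gmom3_def
    by (rule derivative_eq_intros refl v)+
       (use v in \<open>simp add: field_simps power2_eq_square power3_eq_cube\<close>)
qed

text \<open>The Gaussian boundary terms vanish at infinity; what remains are the raw moments of the
  normal law with mean \<mu> and variance v.\<close>

lemma tendsto_gmom:
  assumes v: "v > 0"
  shows "(gmom1 v \<mu> \<longlongrightarrow> \<mu>) at_top"
    and "(gmom2 v \<mu> \<longlongrightarrow> \<mu>\<^sup>2 + v) at_top"
    and "(gmom3 v \<mu> \<longlongrightarrow> \<mu> ^ 3 + 3 * \<mu> * v) at_top"
proof -
  note c = tendsto_gauss_cdf_at_top[OF v, of \<mu>]
  have "((\<lambda>z. v * gauss v (z - \<mu>)) \<longlongrightarrow> 0) at_top"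
    unfolding gauss_def using v by real_asymp
  from tendsto_diff[OF tendsto_mult_left[OF c, of \<mu>] this]
  show "(gmom1 v \<mu> \<longlongrightarrow> \<mu>) at_top" unfolding gmom1_def by simp
  have "((\<lambda>z. v * (z + \<mu>) * gauss v (z - \<mu>)) \<longlongrightarrow> 0) at_top"
    unfolding gauss_def using v by real_asymp
  from tendsto_diff[OF tendsto_mult_left[OF c, of "\<mu>\<^sup>2 + v"] this]
  show "(gmom2 v \<mu> \<longlongrightarrow> \<mu>\<^sup>2 + v) at_top" unfolding gmom2_def by simp
  have "((\<lambda>z. v * (z\<^sup>2 + \<mu> * z + \<mu>\<^sup>2 + 2 * v) * gauss v (z - \<mu>)) \<longlongrightarrow> 0) at_top"
    unfolding gauss_def using v by real_asymp
  from tendsto_diff[OF tendsto_mult_left[OF c, of "\<mu> ^ 3 + 3 * \<mu> * v"] this]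
  show "(gmom3 v \<mu> \<longlongrightarrow> \<mu> ^ 3 + 3 * \<mu> * v) at_top" unfolding gmom3_def by simp
qed

section \<open>Moments of the meander as Gaussian integrals\<close>

lemma killed_mult_passage:
  fixes r s b :: real
  assumes "r > 0" "s > 0"
  defines "\<mu> \<equiv> s * b / (r + s)" and "v \<equiv> r * s / (r + s)"
  shows "killed r b z * passage s z = gauss (r + s) b / s * (z * gauss v (z - \<mu>) - z * gauss v (z - (- \<mu>)))"
proof -
  have 1: "gauss s z * gauss r (b - z) = gauss (r + s) b * gauss v (z - \<mu>)"
    using gauss_mult_gauss[OF assms(2,1), of z b] by (simp add: \<mu>_def v_def)
  \<comment> \<open>The image term of \<open>killed\<close> belongs to the reflected endpoint - b;
    hence the mean changes sign, while variance and weight stay the same because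
    \<open>gauss\<close> is even.\<close>
  have 2: "gauss s z * gauss r (b + z) = gauss (r + s) b * gauss v (z - (- \<mu>))"
    using gauss_mult_gauss[OF assms(2,1), of z "- b"] gauss_minus[of r "b + z"] gauss_minus[of "r + s" b]
    by (simp add: \<mu>_def v_def)
  have "killed r b z * passage s z = z / s * (gauss s z * gauss r (b - z) - gauss s z * gauss r (b + z))"
    by (simp add: killed_def passage_def algebra_simps)
  then show ?thesis
    unfolding 1 2 by (simp add: algebra_simps)
qed

text \<open>Divided by \<open>passage T b\<close>, the weight
  \<open>killed r b z * passage s z\<close> is the density at time s of the meander of length T = r
  + s conditioned to end at b; Brownian scaling accounts for the arguments s / T and b / sqrt T. The
  factor z inside \<open>passage\<close> raises the power by one, so the moment of order j uses the
  Gaussian moment of order j + 1.\<close>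

lemma nn_integral_killed_passage:
  assumes r: "r > 0" and s: "s > 0" and b: "b > 0"
  defines "T \<equiv> r + s"
  shows "(\<integral>\<^sup>+z\<in>{0..}. ennreal (z * (killed r b z * passage s z)) \<partial>lborel)
           = ennreal (passage T b * (sqrt T * M1 (s / T) (b / sqrt T)))"
    and "(\<integral>\<^sup>+z\<in>{0..}. ennreal (z\<^sup>2 * (killed r b z * passage s z)) \<partial>lborel)
           = ennreal (passage T b * (T * M2 (s / T) (b / sqrt T)))"
proof -
  define \<mu> where "\<mu> = s * b / T"
  define v where "v = r * s / T"
  define G where "G = gauss T b"
  have T: "T > 0" using r s by (simp add: T_def)
  have v: "v > 0" using r s T by (simp add: v_def)
  have rT: "r = T - s" and sT: "s < T" using r by (auto simp: T_def)
  note kp = killed_mult_passage[OF r s, of b, folded T_def, folded \<mu>_def v_def G_def]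
  have nn: "0 \<le> killed r b z * passage s z" if "0 \<le> z" for z
    using that killed_nonneg[OF r, of b z] passage_nonneg[OF s, of z] b by simp
  let ?F2 = "\<lambda>z. G / s * (gmom2 v \<mu> z - gmom2 v (- \<mu>) z)"
  let ?F3 = "\<lambda>z. G / s * (gmom3 v \<mu> z - gmom3 v (- \<mu>) z)"
  have "(\<integral>\<^sup>+z\<in>{0..}. ennreal (z * (killed r b z * passage s z)) \<partial>lborel)
      = ennreal (G / s * ((\<mu>\<^sup>2 + v) - ((- \<mu>)\<^sup>2 + v)) - ?F2 0)"
  proof (rule nn_integral_FTC_atLeast)
    fix z :: real
    have "(?F2 has_real_derivative G / s * (z\<^sup>2 * gauss v (z - \<mu>) - z\<^sup>2 * gauss v (z - (- \<mu>)))) (at z)"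
      by (intro DERIV_cmult DERIV_diff DERIV_gmom v)
    then show "(?F2 has_real_derivative z * (killed r b z * passage s z)) (at z)"
      unfolding kp by (simp add: algebra_simps power2_eq_square)
    show "(?F2 \<longlongrightarrow> G / s * ((\<mu>\<^sup>2 + v) - ((- \<mu>)\<^sup>2 + v))) at_top"
      by (intro tendsto_intros tendsto_gmom v)
  qed (use nn in auto)
  \<comment> \<open>The second moments for \<mu> and - \<mu> agree, so the contribution at infinity
    cancels. The lower endpoint gives the difference of the distribution function at \<mu> and -
    \<mu>, which is the erf term, while the Gaussian terms add up.\<close>
  also have "G / s * ((\<mu>\<^sup>2 + v) - ((- \<mu>)\<^sup>2 + v)) - ?F2 0
      = G / s * ((\<mu>\<^sup>2 + v) * erf (\<mu> / sqrt (2 * v)) + 2 * v * \<mu> * gauss v \<mu>)"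
  proof -
    have "?F2 0 = G / s * (- ((\<mu>\<^sup>2 + v) * erf (\<mu> / sqrt (2 * v)) + 2 * v * \<mu> * gauss v \<mu>))"
      by (rule arg_cong[where f = "\<lambda>x. G / s * x"]) (simp add: gmom2_def gauss_cdf_def field_simps)
    then show ?thesis by (simp only: mult_minus_right) simp
  qed
  also have "\<dots> = passage T b * (sqrt T * M1 (s / T) (b / sqrt T))"
  proof -
    have sT1: "s / T \<noteq> 1" using sT T by simp
    have rs: "1 - s / T = r / T" using T by (simp add: rT field_simps)
    have e1: "(b / sqrt T) * sqrt (s / T) / sqrt (2 * (1 - s / T)) = \<mu> / sqrt (2 * v)"
    proof (rule power2_eq_imp_eq)
      have "((b / sqrt T) * sqrt (s / T) / sqrt (2 * (r / T)))\<^sup>2 = b\<^sup>2 / T * (s / T) / (2 * (r / T))"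
        using T s r by (simp add: power_mult_distrib power_divide)
      also have "\<dots> = \<mu>\<^sup>2 / (2 * v)"
        using T s r by (simp add: \<mu>_def v_def power2_eq_square)
      also have "\<dots> = (\<mu> / sqrt (2 * v))\<^sup>2"
        using v by (simp add: power_divide)
      finally show "((b / sqrt T) * sqrt (s / T) / sqrt (2 * (1 - s / T)))\<^sup>2 = (\<mu> / sqrt (2 * v))\<^sup>2"
        unfolding rs .
      show "0 \<le> b / sqrt T * sqrt (s / T) / sqrt (2 * (1 - s / T))"
        using T s r b unfolding rs by simp
      show "0 \<le> \<mu> / sqrt (2 * v)"
        using T s b v by (simp add: \<mu>_def)
    qed
    have e2: "(s / T * (b / sqrt T)\<^sup>2) / (2 * (1 - s / T)) = \<mu>\<^sup>2 / (2 * v)"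
      unfolding rs using T s r by (simp add: \<mu>_def v_def power_divide power2_eq_square)
    have e3: "sqrt (2 * (s / T) * (1 - s / T) / pi) = 2 * v / (sqrt T * sqrt (2 * pi * v))"
    proof (rule power2_eq_imp_eq)
      have "(2 * v / (sqrt T * sqrt (2 * pi * v)))\<^sup>2 = (2 * v)\<^sup>2 / (T * (2 * pi * v))"
        using T v by (simp add: power_mult_distrib power_divide)
      also have "\<dots> = 2 * (s / T) * (r / T) / pi"
        using T v s r by (simp add: v_def power2_eq_square mult_ac)
      also have "\<dots> = (sqrt (2 * (s / T) * (r / T) / pi))\<^sup>2"
        using T s r by simp
      finally show "(sqrt (2 * (s / T) * (1 - s / T) / pi))\<^sup>2 = (2 * v / (sqrt T * sqrt (2 * pi * v)))\<^sup>2"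
        unfolding rs by simp
    qed (use T s r v in \<open>auto simp: rs\<close>)
    have e4: "1 / (b / sqrt T) * (1 - s / T + s / T * (b / sqrt T)\<^sup>2) = sqrt T / (s * b) * (\<mu>\<^sup>2 + v)"
    proof -
      have "1 - s / T + s / T * (b / sqrt T)\<^sup>2 = (\<mu>\<^sup>2 + v) / s"
        unfolding rs using T s by (simp add: \<mu>_def v_def power_divide power2_eq_square add_divide_distrib)
      then show ?thesis by simp
    qed
    have "M1 (s / T) (b / sqrt T) = sqrt T / (s * b) * (\<mu>\<^sup>2 + v) * erf (\<mu> / sqrt (2 * v))
        + 2 * v / (sqrt T * sqrt (2 * pi * v)) * exp (- (\<mu>\<^sup>2 / (2 * v)))"
      unfolding M1_def e1 e3 e4 minus_divide_left[symmetric] e2 by (simp only: sT1 if_False)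
    then have "passage T b * (sqrt T * M1 (s / T) (b / sqrt T)) = b / T * G * sqrt T * (sqrt T / (s * b) * (\<mu>\<^sup>2 + v) * erf (\<mu> / sqrt (2 * v))
        + 2 * v / sqrt T * gauss v \<mu>)"
      by (simp add: passage_def G_def gauss_def)
    also have "\<dots> = (b / T * (sqrt T * sqrt T) / (s * b)) * G * (\<mu>\<^sup>2 + v) * erf (\<mu> / sqrt (2 * v))
        + b / T * G * 2 * v * gauss v \<mu>"
    proof -
      have "b / T * G * x * (x / (s * b) * A * e + 2 * v / x * g)
          = (b / T * (x * x) / (s * b)) * G * A * e + b / T * G * 2 * v * g" if "x \<noteq> 0" for x A e g
        using that by (simp add: distrib_left divide_inverse mult_ac)
      then show ?thesis using T by simp
    qed
    also have "\<dots> = G / s * ((\<mu>\<^sup>2 + v) * erf (\<mu> / sqrt (2 * v)) + 2 * v * \<mu> * gauss v \<mu>)"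
      using T s b by (simp add: \<mu>_def field_simps)
    finally show ?thesis by simp
  qed
  finally show "(\<integral>\<^sup>+z\<in>{0..}. ennreal (z * (killed r b z * passage s z)) \<partial>lborel)
           = ennreal (passage T b * (sqrt T * M1 (s / T) (b / sqrt T)))" .
  have "(\<integral>\<^sup>+z\<in>{0..}. ennreal (z\<^sup>2 * (killed r b z * passage s z)) \<partial>lborel)
      = ennreal (G / s * ((\<mu> ^ 3 + 3 * \<mu> * v) - ((- \<mu>) ^ 3 + 3 * (- \<mu>) * v)) - ?F3 0)"
  proof (rule nn_integral_FTC_atLeast)
    fix z :: real
    have "(?F3 has_real_derivative G / s * (z ^ 3 * gauss v (z - \<mu>) - z ^ 3 * gauss v (z - (- \<mu>)))) (at z)"
      by (intro DERIV_cmult DERIV_diff DERIV_gmom v)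
    then show "(?F3 has_real_derivative z\<^sup>2 * (killed r b z * passage s z)) (at z)"
      unfolding kp by (simp add: algebra_simps power2_eq_square power3_eq_cube)
    show "(?F3 \<longlongrightarrow> G / s * ((\<mu> ^ 3 + 3 * \<mu> * v) - ((- \<mu>) ^ 3 + 3 * (- \<mu>) * v))) at_top"
      by (intro tendsto_mult tendsto_const tendsto_diff tendsto_gmom v)
  qed (use nn in auto)
  \<comment> \<open>Here the moment is odd in \<mu>: at infinity the two terms double, and at 0 the
    Gaussian terms cancel while the two values of the distribution function sum to 1. This is why
    \<open>M2\<close>, unlike \<open>M1\<close>, contains no erf.\<close>
  also have "G / s * ((\<mu> ^ 3 + 3 * \<mu> * v) - ((- \<mu>) ^ 3 + 3 * (- \<mu>) * v)) - ?F3 0 = G / s * (\<mu> ^ 3 + 3 * \<mu> * v)"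
  proof -
    have "?F3 0 = G / s * (\<mu> ^ 3 + 3 * \<mu> * v)"
      by (rule arg_cong[where f = "\<lambda>x. G / s * x"]) (simp add: gmom3_def gauss_cdf_def field_simps)
    moreover have "(\<mu> ^ 3 + 3 * \<mu> * v) - ((- \<mu>) ^ 3 + 3 * (- \<mu>) * v) = 2 * (\<mu> ^ 3 + 3 * \<mu> * v)"
      by simp
    ultimately show ?thesis by (simp only: mult.left_commute[of _ 2]) simp
  qed
  also have "\<dots> = passage T b * (T * M2 (s / T) (b / sqrt T))"
  proof -
    have "1 - s / T = r / T" using T by (simp add: rT field_simps)
    then have "T * M2 (s / T) (b / sqrt T) = 3 * r * s / T + b\<^sup>2 * s\<^sup>2 / T\<^sup>2"
      using T unfolding M2_def by (simp add: power_divide power2_eq_square add_divide_distrib distrib_left)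
    moreover have "(\<mu> ^ 3 + 3 * \<mu> * v) / s = b / T * (3 * r * s / T + b\<^sup>2 * s\<^sup>2 / T\<^sup>2)"
      using T s by (simp add: \<mu>_def v_def power2_eq_square power3_eq_cube field_simps)
    moreover have "G / s * (\<mu> ^ 3 + 3 * \<mu> * v) = G * ((\<mu> ^ 3 + 3 * \<mu> * v) / s)"
      by simp
    ultimately show ?thesis unfolding passage_def G_def[symmetric] by (simp only: mult_ac)
  qed
  finally show "(\<integral>\<^sup>+z\<in>{0..}. ennreal (z\<^sup>2 * (killed r b z * passage s z)) \<partial>lborel)
           = ennreal (passage T b * (T * M2 (s / T) (b / sqrt T)))" .
qed

text \<open>The products of passage densities below divide by zero at the ends of the interval, so
  the antiderivative is available only through its one-sided limits there.\<close>

lemma nn_integral_FTC_open_interval: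
  fixes f F :: "real \<Rightarrow> real"
  assumes ab: "a < b"
    and f[measurable]: "f \<in> borel_measurable borel"
    and F: "\<And>x. a < x \<Longrightarrow> x < b \<Longrightarrow> (F has_real_derivative f x) (at x)"
    and c: "\<And>x. a < x \<Longrightarrow> x < b \<Longrightarrow> isCont f x"
    and nn: "\<And>x. a < x \<Longrightarrow> x < b \<Longrightarrow> 0 \<le> f x"
    and A: "(F \<longlongrightarrow> A) (at_right a)" and B: "(F \<longlongrightarrow> B) (at_left b)"
  shows "(\<integral>\<^sup>+x\<in>{a<..<b}. ennreal (f x) \<partial>lborel) = ennreal (B - A)"
proof -
  have lims: "((F \<circ> real_of_ereal) \<longlongrightarrow> A) (at_right (ereal a))" "((F \<circ> real_of_ereal) \<longlongrightarrow> B) (at_left (ereal b))"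
    using A B by (simp_all add: ereal_tendsto_simps)
  have i: "set_integrable lborel (einterval (ereal a) (ereal b)) f"
    by (rule interval_integral_FTC_nonneg(1)[OF _ _ _ _ lims]) (use ab F c nn in auto)
  have "(LBINT x=ereal a..ereal b. f x) = B - A"
    by (rule interval_integral_FTC_nonneg(2)[OF _ _ _ _ lims]) (use ab F c nn in auto)
  then have v: "(LBINT x:{a<..<b}. f x) = B - A"
    using ab by (simp add: interval_lebesgue_integral_def einterval_eq)
  have "(\<integral>\<^sup>+x\<in>{a<..<b}. ennreal (f x) \<partial>lborel) = (\<integral>\<^sup>+x. ennreal (indicator {a<..<b} x * f x) \<partial>lborel)"
    by (intro nn_integral_cong) (auto simp: indicator_def)
  also have "\<dots> = ennreal (LBINT x:{a<..<b}. f x)"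
    unfolding set_lebesgue_integral_def
    using i nn by (subst nn_integral_eq_integral) (auto simp: set_integrable_def einterval_eq indicator_def intro!: AE_I2)
  finally show ?thesis unfolding v .
qed

section \<open>Two decompositions of a first passage\<close>

text \<open>
  The closed form of both \<open>\<integral> passage u (a + z) * killed (T - u) z b dz\<close> over \<open>z > 0\<close> and
  \<open>\<integral> passage \<theta> a * passage (T - \<theta>) b d\<theta>\<close> over \<open>0 < \<theta> < u\<close>.
\<close>
definition pass_kill :: "real \<Rightarrow> real \<Rightarrow> real \<Rightarrow> real \<Rightarrow> real" where
  "pass_kill a b T u =
     (a + b) / T * gauss T (a + b) * ((1 - erf ((a * (T - u) - b * u) / sqrt (2 * T * (u * (T - u))))) / 2)
   - (a - b) / T * gauss T (a - b) * ((1 - erf ((a * (T - u) + b * u) / sqrt (2 * T * (u * (T - u))))) / 2)"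

text \<open>For a Brownian motion started at b, \<open>pass_kill\<close> is the density of the first
  passage through - a at time T on the event that 0 is not hit before time T - u. Here it is
  decomposed by the position z at time T - u: the path is killed at 0 up to then, and afterwards
  descends by a + z in time u.\<close>

lemma nn_integral_passage_killed:
  assumes a: "a > 0" and b: "b > 0" and u: "0 < u" "u < T"
  shows "(\<integral>\<^sup>+z\<in>{0..}. ennreal (passage u (a + z) * killed (T - u) z b) \<partial>lborel) = ennreal (pass_kill a b T u)"
proof -
  define s where "s = T - u"
  have s: "s > 0" and Tsu: "s + u = T" and T: "T > 0" using u by (auto simp: s_def)
  define v where "v = s * u / T"
  have v: "v > 0" using s u T by (simp add: v_def)
  define \<mu> where "\<mu> c = u * (a + c) / T" for c
  note gg = gauss_mult_gauss[OF u(1) s, unfolded Tsu, folded v_def]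
  have pk: "passage u (a + z) * killed s z b
    = gauss T (a + b) / u * ((a + z) * gauss v (a + z - \<mu> b)) - gauss T (a - b) / u * ((a + z) * gauss v (a + z - \<mu> (- b)))" for z
  proof -
    have "passage u (a + z) * killed s z b
      = (a + z) / u * (gauss u (a + z) * gauss s (a + b - (a + z)) - gauss u (a + z) * gauss s (a - b - (a + z)))"
    proof -
      have "killed s z b = gauss s (a + b - (a + z)) - gauss s (a - b - (a + z))"
        using gauss_minus[of s "z - b"] gauss_minus[of s "z + b"] by (simp add: killed_def add.commute)
      then show ?thesis by (simp only: passage_def right_diff_distrib mult.assoc)
    qed
    also have "\<dots> = (a + z) / u * (gauss T (a + b) * gauss v (a + z - \<mu> b) - gauss T (a - b) * gauss v (a + z - \<mu> (- b)))"
      unfolding gg \<mu>_def by simp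
    finally show ?thesis by (simp only: right_diff_distrib times_divide_eq_left times_divide_eq_right mult_ac)
  qed
  let ?F = "\<lambda>z. gauss T (a + b) / u * gmom1 v (\<mu> b) (a + z) - gauss T (a - b) / u * gmom1 v (\<mu> (- b)) (a + z)"
  have "(\<integral>\<^sup>+z\<in>{0..}. ennreal (passage u (a + z) * killed s z b) \<partial>lborel)
      = ennreal ((gauss T (a + b) / u * \<mu> b - gauss T (a - b) / u * \<mu> (- b)) - ?F 0)"
  proof (rule nn_integral_FTC_atLeast)
    fix z :: real
    have d: "((\<lambda>z. gmom1 v m (a + z)) has_real_derivative (a + z) * gauss v (a + z - m)) (at z)" for m
      using DERIV_shift[of "gmom1 v m" _ z a] DERIV_gmom(1)[OF v, of m "z + a"] by (simp add: add.commute)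
    show "(?F has_real_derivative passage u (a + z) * killed s z b) (at z)"
      unfolding pk by (intro DERIV_cmult DERIV_diff d)
    have l: "((\<lambda>z. gmom1 v m (a + z)) \<longlongrightarrow> m) at_top" for m
      by (rule filterlim_compose[OF tendsto_gmom(1)[OF v]]) real_asymp
    show "(?F \<longlongrightarrow> gauss T (a + b) / u * \<mu> b - gauss T (a - b) / u * \<mu> (- b)) at_top"
      by (intro tendsto_mult tendsto_const tendsto_diff l)
    show "0 \<le> passage u (a + z) * killed s z b" if "0 \<le> z"
      using that a b u s killed_nonneg[of s z b] passage_nonneg[of u "a + z"] by simp
  qed simp
  also have "(gauss T (a + b) / u * \<mu> b - gauss T (a - b) / u * \<mu> (- b)) - ?F 0 = pass_kill a b T u"
  proof -
    \<comment> \<open>At z = 0 both products factor back into the same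
      \<open>gauss u a * gauss s b\<close>. The Gaussian boundary terms therefore cancel and only
      the erf terms survive.\<close>
    have g1: "gauss T (a + b) * gauss v (a - \<mu> b) = gauss u a * gauss s b"
      using gg[of a "a + b"] by (simp add: \<mu>_def)
    have g2: "gauss T (a - b) * gauss v (a - \<mu> (- b)) = gauss u a * gauss s b"
      using gg[of a "a - b"] by (simp add: \<mu>_def)
    have ar: "(a - \<mu> c) / sqrt (2 * v) = (a * (T - u) - c * u) / sqrt (2 * T * (u * (T - u)))" for c
    proof -
      have "sqrt (2 * T * (u * (T - u))) = sqrt ((2 * v) * T\<^sup>2)"
        using T by (simp add: v_def s_def power2_eq_square field_simps)
      also have "\<dots> = sqrt (2 * v) * T" using T by (simp add: real_sqrt_mult)
      finally have "sqrt (2 * T * (u * (T - u))) = sqrt (2 * v) * T" .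
      then show ?thesis using T v by (simp add: \<mu>_def field_simps)
    qed
    have c: "1 - gauss_cdf v (a - \<mu> c) = (1 - erf ((a * (T - u) - c * u) / sqrt (2 * T * (u * (T - u))))) / 2" for c
      unfolding gauss_cdf_def ar by (simp add: field_simps)
    have "(gauss T (a + b) / u * \<mu> b - gauss T (a - b) / u * \<mu> (- b)) - ?F 0
      = gauss T (a + b) * (\<mu> b / u) * (1 - gauss_cdf v (a - \<mu> b)) - gauss T (a - b) * (\<mu> (- b) / u) * (1 - gauss_cdf v (a - \<mu> (- b)))
        + v / u * (gauss T (a + b) * gauss v (a - \<mu> b) - gauss T (a - b) * gauss v (a - \<mu> (- b)))"
      by (simp add: gmom1_def divide_inverse algebra_simps)
    also have "\<dots> = gauss T (a + b) * (\<mu> b / u) * (1 - gauss_cdf v (a - \<mu> b)) - gauss T (a - b) * (\<mu> (- b) / u) * (1 - gauss_cdf v (a - \<mu> (- b)))"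
      unfolding g1 g2 by simp
    also have "\<dots> = pass_kill a b T u"
      unfolding c pass_kill_def using u by (simp add: \<mu>_def mult_ac)
    finally show ?thesis .
  qed
  finally show ?thesis unfolding s_def .
qed

lemma DERIV_divide_sqrt:
  assumes "(N has_real_derivative N') (at x)" "(W has_real_derivative W') (at x)" "W x > 0"
  shows "((\<lambda>x. N x / sqrt (W x)) has_real_derivative (N' * W x - N x * W' / 2) / (W x * sqrt (W x))) (at x)"
proof -
  have "((\<lambda>x. N x / sqrt (W x)) has_real_derivative
      (N' * sqrt (W x) - N x * (W' * (inverse (sqrt (W x)) / 2))) / (sqrt (W x) * sqrt (W x))) (at x)"
    using assms by (auto intro!: derivative_eq_intros simp: mult_ac)
  also have "(N' * sqrt (W x) - N x * (W' * (inverse (sqrt (W x)) / 2))) / (sqrt (W x) * sqrt (W x))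
      = (N' * (sqrt (W x) * sqrt (W x)) - N x * W' / 2) / (W x * sqrt (W x))"
    using assms(3) by (simp add: field_simps)
  finally show ?thesis using assms(3) by simp
qed

text \<open>Differentiating either erf term yields the same exponential, because its exponent
  depends on the sign of b only through the square of b. The two polynomial prefactors then differ
  by 2 a b T, and the square roots combine into the normalisations of the two passage
  densities.\<close>

lemma DERIV_pass_kill:
  assumes u: "0 < u" "u < T"
  shows "(pass_kill a b T has_real_derivative passage u a * passage (T - u) b) (at u)"
proof -
  have T: "T > 0" and D: "u * (T - u) > 0" using u by auto
  define W where "W = 2 * T * (u * (T - u))"
  have W: "W > 0" using T D by (simp add: W_def)
  define E where "E = exp (- (a\<^sup>2 / (2 * u)) - b\<^sup>2 / (2 * (T - u))) / sqrt (2 * pi * T)"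
  have x: "((\<lambda>u. (a * (T - u) - c * u) / sqrt (2 * T * (u * (T - u)))) has_real_derivative
      - (T\<^sup>2 * (a * (T - u) + c * u)) / (W * sqrt W)) (at u)" for c
  proof -
    have "((\<lambda>u. (a * (T - u) - c * u) / sqrt (2 * T * (u * (T - u)))) has_real_derivative
      ((- a - c) * (2 * T * (u * (T - u))) - (a * (T - u) - c * u) * (2 * T * (T - 2 * u)) / 2)
       / (2 * T * (u * (T - u)) * sqrt (2 * T * (u * (T - u))))) (at u)"
      by (rule DERIV_divide_sqrt) (use W in \<open>auto intro!: derivative_eq_intros simp: W_def algebra_simps\<close>)
    also have "(- a - c) * (2 * T * (u * (T - u))) - (a * (T - u) - c * u) * (2 * T * (T - 2 * u)) / 2
      = - (T\<^sup>2 * (a * (T - u) + c * u))"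
      by (simp add: field_simps power2_eq_square)
    finally show ?thesis unfolding W_def by simp
  qed
  have E: "gauss T (a + c) * exp (- ((a * (T - u) - c * u) / sqrt W)\<^sup>2) = exp (- (a\<^sup>2 / (2 * u)) - c\<^sup>2 / (2 * (T - u))) / sqrt (2 * pi * T)" for c
  proof -
    have "- (a + c)\<^sup>2 / (2 * T) + - ((a * (T - u) - c * u) / sqrt W)\<^sup>2 = - (a\<^sup>2 / (2 * u)) - c\<^sup>2 / (2 * (T - u))"
    proof -
      have "((a * (T - u) - c * u) / sqrt W)\<^sup>2 = (a * (T - u) - c * u)\<^sup>2 / W"
        using W by (simp add: power_divide)
      moreover have "- (a + c)\<^sup>2 / (2 * T) + - ((a * (T - u) - c * u)\<^sup>2 / W) = - (a\<^sup>2 / (2 * u)) - c\<^sup>2 / (2 * (T - u))"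
        unfolding W_def using u T by (simp add: divide_simps) (simp add: algebra_simps power2_eq_square)
      ultimately show ?thesis by simp
    qed
    then show ?thesis unfolding gauss_def by (simp add: exp_add[symmetric])
  qed
  have d: "((\<lambda>u. (a + c) / T * gauss T (a + c) * ((1 - erf ((a * (T - u) - c * u) / sqrt (2 * T * (u * (T - u))))) / 2))
      has_real_derivative (a + c) * (a * (T - u) + c * u) * (T / (sqrt pi * W * sqrt W)) *
         (exp (- (a\<^sup>2 / (2 * u)) - c\<^sup>2 / (2 * (T - u))) / sqrt (2 * pi * T))) (at u)" for c
  proof -
    have "((\<lambda>u. (a + c) / T * gauss T (a + c) * ((1 - erf ((a * (T - u) - c * u) / sqrt (2 * T * (u * (T - u))))) / 2))
      has_real_derivative (a + c) / T * gauss T (a + c) * ((0 - 2 / sqrt pi * exp (- ((a * (T - u) - c * u) / sqrt (2 * T * (u * (T - u))))\<^sup>2)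
         * (- (T\<^sup>2 * (a * (T - u) + c * u)) / (W * sqrt W))) / 2)) (at u)"
      by (intro DERIV_cmult DERIV_cdivide DERIV_diff DERIV_const DERIV_erf x)
    also have "(a + c) / T * gauss T (a + c) * ((0 - 2 / sqrt pi * exp (- ((a * (T - u) - c * u) / sqrt (2 * T * (u * (T - u))))\<^sup>2)
         * (- (T\<^sup>2 * (a * (T - u) + c * u)) / (W * sqrt W))) / 2)
      = (a + c) * (a * (T - u) + c * u) * (T / (sqrt pi * W * sqrt W)) * (gauss T (a + c) * exp (- ((a * (T - u) - c * u) / sqrt W)\<^sup>2))"
      unfolding W_def[symmetric] using T by (simp add: power2_eq_square[of T] mult_ac)
    finally show ?thesis unfolding E .
  qed
  have "(pass_kill a b T has_real_derivative
      (a + b) * (a * (T - u) + b * u) * (T / (sqrt pi * W * sqrt W)) * E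
    - (a + (- b)) * (a * (T - u) + (- b) * u) * (T / (sqrt pi * W * sqrt W)) * E) (at u)"
    using DERIV_diff[OF d[of b] d[of "- b"]] unfolding pass_kill_def E_def by simp
  also have "(a + b) * (a * (T - u) + b * u) * (T / (sqrt pi * W * sqrt W)) * E
    - (a + (- b)) * (a * (T - u) + (- b) * u) * (T / (sqrt pi * W * sqrt W)) * E
    = ((a + b) * (a * (T - u) + b * u) - (a - b) * (a * (T - u) - b * u)) * (T / (sqrt pi * W * sqrt W)) * E"
    by (simp add: algebra_simps)
  also have "(a + b) * (a * (T - u) + b * u) - (a - b) * (a * (T - u) - b * u) = 2 * a * b * T"
    by (simp add: algebra_simps)
  also have "2 * a * b * T * (T / (sqrt pi * W * sqrt W)) * E = passage u a * passage (T - u) b"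
  proof -
    have "sqrt pi * sqrt W * sqrt (2 * pi * T) = sqrt (pi * W * (2 * pi * T))"
      by (simp add: real_sqrt_mult)
    also have "pi * W * (2 * pi * T) = T\<^sup>2 * ((2 * pi * u) * (2 * pi * (T - u)))"
      by (simp add: W_def power2_eq_square)
    also have "sqrt \<dots> = T * (sqrt (2 * pi * u) * sqrt (2 * pi * (T - u)))"
      using T unfolding real_sqrt_mult by simp
    finally have sq: "sqrt pi * sqrt W * sqrt (2 * pi * T) = T * (sqrt (2 * pi * u) * sqrt (2 * pi * (T - u)))" .
    have "2 * a * b * T * (T / (sqrt pi * W * sqrt W)) * E = 2 * a * b * T * T * exp (- (a\<^sup>2 / (2 * u)) - b\<^sup>2 / (2 * (T - u)))
       / (W * (sqrt pi * sqrt W * sqrt (2 * pi * T)))"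
      unfolding E_def by (simp add: mult_ac)
    also have "\<dots> = a * b * exp (- (a\<^sup>2 / (2 * u)) - b\<^sup>2 / (2 * (T - u))) / (u * (T - u) * (sqrt (2 * pi * u) * sqrt (2 * pi * (T - u))))"
      unfolding sq using T u by (simp add: W_def)
    also have "\<dots> = passage u a * passage (T - u) b"
    proof -
      have "exp (- (a\<^sup>2 / (2 * u)) - b\<^sup>2 / (2 * (T - u))) = exp (- a\<^sup>2 / (2 * u)) * exp (- b\<^sup>2 / (2 * (T - u)))"
        by (simp add: exp_add[symmetric])
      then show ?thesis by (simp add: passage_def gauss_def mult_ac)
    qed
    finally show ?thesis .
  qed
  finally show ?thesis .
qed

text \<open>The same first passage from b to - a, now decomposed at the time T - \<theta> at which 0
  is first hit. Letting u tend to T removes the restriction on that time and gives the additivity of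
  first passages over the levels a and b.\<close>

lemma nn_integral_passage_passage:
  assumes a: "a > 0" and b: "b > 0" and T: "T > 0"
  shows "0 < u \<Longrightarrow> u < T \<Longrightarrow>
      (\<integral>\<^sup>+\<theta>\<in>{0<..<u}. ennreal (passage \<theta> a * passage (T - \<theta>) b) \<partial>lborel) = ennreal (pass_kill a b T u)"
    and "(\<integral>\<^sup>+\<theta>\<in>{0<..<T}. ennreal (passage \<theta> a * passage (T - \<theta>) b) \<partial>lborel) = ennreal (passage T (a + b))"
proof -
  have erf0: "((\<lambda>u. erf ((a * (T - u) - c * u) / sqrt (2 * T * (u * (T - u))))) \<longlongrightarrow> 1) (at_right 0)" for c
    by (rule filterlim_compose[OF tendsto_erf_at_top]) (use a T in real_asymp)
  have "(pass_kill a b T \<longlongrightarrow> (a + b) / T * gauss T (a + b) * ((1 - 1) / 2) - (a - b) / T * gauss T (a - b) * ((1 - 1) / 2)) (at_right 0)"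
    unfolding pass_kill_def using erf0[of b] erf0[of "- b"]
    by (intro tendsto_diff tendsto_mult tendsto_divide tendsto_const) auto
  then have lim0: "(pass_kill a b T \<longlongrightarrow> 0) (at_right 0)" by simp
  \<comment> \<open>Near T the two erf arguments diverge with opposite signs. Hence the first term
    of \<open>pass_kill\<close> keeps its full weight and the second one disappears; near 0 both
    disappear.\<close>
  have "((\<lambda>u. erf ((a * (T - u) - b * u) / sqrt (2 * T * (u * (T - u))))) \<longlongrightarrow> - 1) (at_left T)"
    by (rule filterlim_compose[OF tendsto_erf_at_bot]) (use b T in real_asymp)
  moreover have "((\<lambda>u. erf ((a * (T - u) + b * u) / sqrt (2 * T * (u * (T - u))))) \<longlongrightarrow> 1) (at_left T)"
    by (rule filterlim_compose[OF tendsto_erf_at_top]) (use b T in real_asymp)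
  ultimately have "(pass_kill a b T \<longlongrightarrow> (a + b) / T * gauss T (a + b) * ((1 - (- 1)) / 2) - (a - b) / T * gauss T (a - b) * ((1 - 1) / 2)) (at_left T)"
    unfolding pass_kill_def
    by (intro tendsto_diff tendsto_mult tendsto_divide tendsto_const) auto
  then have limT: "(pass_kill a b T \<longlongrightarrow> passage T (a + b)) (at_left T)" by (simp add: passage_def)
  have ftc: "(\<integral>\<^sup>+\<theta>\<in>{0<..<w}. ennreal (passage \<theta> a * passage (T - \<theta>) b) \<partial>lborel) = ennreal (L - 0)"
    if "0 < w" "w \<le> T" "(pass_kill a b T \<longlongrightarrow> L) (at_left w)" for w L
  proof (rule nn_integral_FTC_open_interval[OF that(1) _ _ _ _ lim0 that(3)])
    fix x assume x: "0 < x" "x < w"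
    with that have xT: "x < T" by simp
    show "(pass_kill a b T has_real_derivative passage x a * passage (T - x) b) (at x)"
      by (rule DERIV_pass_kill) (use x xT in auto)
    show "isCont (\<lambda>\<theta>. passage \<theta> a * passage (T - \<theta>) b) x"
      unfolding passage_def gauss_def using x xT by (intro continuous_intros) auto
    show "0 \<le> passage x a * passage (T - x) b"
      using x xT a b by (simp add: passage_nonneg)
  qed simp
  show "(\<integral>\<^sup>+\<theta>\<in>{0<..<u}. ennreal (passage \<theta> a * passage (T - \<theta>) b) \<partial>lborel) = ennreal (pass_kill a b T u)" if "0 < u" "u < T"
    using ftc[of u "pass_kill a b T u"] that DERIV_isCont[OF DERIV_pass_kill[OF that, of a b]]
    by (simp add: isCont_def tendsto_within_subset)
  show "(\<integral>\<^sup>+\<theta>\<in>{0<..<T}. ennreal (passage \<theta> a * passage (T - \<theta>) b) \<partial>lborel) = ennreal (passage T (a + b))"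
    using ftc[OF T _ limT] by simp
qed

text \<open>The joint density of the maximum \<open>m\<close> and the final value \<open>y\<close> over an interval of length \<open>s\<close>.\<close>
definition max_end_density :: "real \<Rightarrow> real \<Rightarrow> real \<Rightarrow> real" where
  "max_end_density s m y = (if 0 < m \<and> y < m then 2 * passage s (2 * m - y) else 0)"

lemma measurable_max_end_density [measurable (raw)]:
  assumes [measurable]: "f \<in> borel_measurable N" "g \<in> borel_measurable N" "k \<in> borel_measurable N"
  shows "(\<lambda>w. max_end_density (f w) (g w) (k w)) \<in> borel_measurable N"
  unfolding max_end_density_def by measurable

text \<open>In m the density is the derivative of \<open>- gauss s (2 * m - y)\<close>. At the lower
  limit \<open>max 0 y\<close> this equals \<open>- gauss s y\<close> whichever of the two is the
  maximum, so the integral is the image formula for staying below a and ending at y.\<close>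

lemma nn_integral_max_end_density:
  assumes s: "s > 0"
  shows "(\<integral>\<^sup>+m. ennreal (max_end_density s m y) * indicator {..a} m \<partial>lborel)
    = ennreal (killed s a (a - y)) * indicator {0..} a * indicator {..a} y"
proof (cases "max 0 y < a")
  case True
  let ?F = "\<lambda>m. - gauss s (2 * m - y)"
  have d: "(?F has_real_derivative 2 * passage s (2 * x - y)) (at x)" for x
    using s by (auto intro!: derivative_eq_intros simp: passage_def)
  have "(\<integral>\<^sup>+m. ennreal (max_end_density s m y) * indicator {..a} m \<partial>lborel)
      = (\<integral>\<^sup>+m\<in>{max 0 y..a}. ennreal (2 * passage s (2 * m - y)) \<partial>lborel)"
  proof (intro nn_integral_cong_AE)
    show "AE m in lborel. ennreal (max_end_density s m y) * indicator {..a} m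
        = ennreal (2 * passage s (2 * m - y)) * indicator {max 0 y..a} m"
      using AE_lborel_singleton[of "max 0 y"]
      by eventually_elim (auto simp: max_end_density_def indicator_def)
  qed
  also have "\<dots> = ennreal (?F a - ?F (max 0 y))"
  proof (rule nn_integral_FTC_Icc)
    show "(?F has_real_derivative 2 * passage s (2 * x - y)) (at x)" for x
      by (rule d)
    show "0 \<le> 2 * passage s (2 * x - y)" if "x \<in> {max 0 y..a}" for x
      using that by (intro mult_nonneg_nonneg passage_nonneg s) auto
  qed (use True in auto)
  also have "?F a - ?F (max 0 y) = killed s a (a - y)"
    by (auto simp: killed_def max_def)
  finally show ?thesis using True by simp
next
  case False
  \<comment> \<open>In the boundary case a = max 0 y the indicators do not vanish, but
    \<open>killed\<close> does, as one of its two positions is 0 or they are opposite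
    images.\<close>
  then have k: "killed s a (a - y) = 0 \<or> a < 0 \<or> a < y"
    using gauss_minus[of s y] by (auto simp: killed_def max_def split: if_splits)
  have "ennreal (max_end_density s m y) * indicator {..a} m = 0" for m
    using False by (auto simp: max_end_density_def indicator_def)
  then have "(\<integral>\<^sup>+m. ennreal (max_end_density s m y) * indicator {..a} m \<partial>lborel) = 0"
    by (simp only: nn_integral_const mult_zero_left)
  moreover have "ennreal (killed s a (a - y)) * indicator {0..} a * indicator {..a} y = 0"
    using k by (auto simp: indicator_def)
  ultimately show ?thesis by simp
qed

section \<open>Brownian increments and running maxima\<close>

text \<open>A continuous function is controlled on [p, q] by its values on this countable grid. This
  serves both the measurability of running maxima and the discrete approximation in the reflection
  principle.\<close>

lemma closure_dyadic_grid:
  fixes p q :: real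
  assumes "p \<le> q"
  shows "{p..q} \<subseteq> closure {p + (q - p) * (real k / 2 ^ n) | k n. k \<le> 2 ^ n}"
proof
  fix x assume x: "x \<in> {p..q}"
  show "x \<in> closure {p + (q - p) * (real k / 2 ^ n) | k n. k \<le> 2 ^ n}"
  proof (cases "p = q")
    case True
    with x have "x = p + (q - p) * (real 0 / 2 ^ 0)" by simp
    then show ?thesis by (intro closure_subset[THEN subsetD]) blast
  next
    case False
    with assms have pq: "p < q" by simp
    define y where "y = (x - p) / (q - p)"
    have y: "0 \<le> y" "y \<le> 1" and xy: "x = p + (q - p) * y"
      using x pq by (auto simp: y_def field_simps)
    \<comment> \<open>Rounding y down to level n leaves an error of at most 2^(-n).\<close>
    define k where "k n = nat \<lfloor>y * 2 ^ n\<rfloor>" for n :: nat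
    have kn: "real (k n) = of_int \<lfloor>y * 2 ^ n\<rfloor>" for n
      using y by (simp add: k_def)
    have "k n \<le> 2 ^ n" for n
    proof -
      have "real (k n) \<le> y * 2 ^ n" unfolding kn by simp
      also have "\<dots> \<le> 1 * 2 ^ n" using y by (intro mult_right_mono) auto
      finally show ?thesis by (simp flip: of_nat_le_iff)
    qed
    moreover have "(\<lambda>n. real (k n) / 2 ^ n) \<longlonglongrightarrow> y"
    proof (rule tendsto_sandwich)
      show "\<forall>\<^sub>F n in sequentially. y - (1 / 2) ^ n \<le> real (k n) / 2 ^ n"
      proof (rule always_eventually, rule allI)
        fix n
        have "y * 2 ^ n \<le> real (k n) + 1" unfolding kn by linarith
        then have "y \<le> (real (k n) + 1) / 2 ^ n"
          by (simp add: pos_le_divide_eq)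
        then show "y - (1 / 2) ^ n \<le> real (k n) / 2 ^ n"
          by (simp add: power_one_over add_divide_distrib)
      qed
      show "\<forall>\<^sub>F n in sequentially. real (k n) / 2 ^ n \<le> y"
      proof (rule always_eventually, rule allI)
        fix n
        have "real (k n) \<le> y * 2 ^ n" unfolding kn by simp
        then show "real (k n) / 2 ^ n \<le> y" by (simp add: field_simps)
      qed
      have "(\<lambda>n. y - (1 / 2) ^ n) \<longlonglongrightarrow> y - 0"
        by (intro tendsto_intros LIMSEQ_power_zero) auto
      then show "(\<lambda>n. y - (1 / 2) ^ n) \<longlonglongrightarrow> y" by simp
    qed auto
    then have "(\<lambda>n. p + (q - p) * (real (k n) / 2 ^ n)) \<longlonglongrightarrow> x"
      unfolding xy by (intro tendsto_intros)
    ultimately show ?thesis unfolding closure_sequential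
      by (intro exI[of _ "\<lambda>n. p + (q - p) * (real (k n) / 2 ^ n)"]) auto
  qed
qed

section \<open>Running maxima and first argmaxes on an interval\<close>

definition run_max :: "(real \<Rightarrow> real) \<Rightarrow> real \<Rightarrow> real \<Rightarrow> real" where
  "run_max f l r = (SUP s\<in>{l..r}. f s)"

definition run_argmax :: "(real \<Rightarrow> real) \<Rightarrow> real \<Rightarrow> real \<Rightarrow> real" where
  "run_argmax f l r = (LEAST s. s \<in> {l..r} \<and> f s = run_max f l r)"

text \<open>General intervals are needed because [0,1] gets cut at interior times; this and the next
  equation lead back to the functionals of the theorem.\<close>

lemma path_max_eq_run_max: "path_max f = run_max f 0 1"
  by (simp add: path_max_def run_max_def)

lemma first_argmax_eq_run_argmax: "first_argmax f = run_argmax f 0 1"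
  by (simp add: first_argmax_def run_argmax_def path_max_eq_run_max)

context
  fixes f :: "real \<Rightarrow> real" and l r :: real
  assumes f: "continuous_on {l..r} f" and lr: "l \<le> r"
begin

lemma run_max_attained: "\<exists>s\<in>{l..r}. f s = run_max f l r \<and> (\<forall>t\<in>{l..r}. f t \<le> f s)"
proof -
  obtain s where s: "s \<in> {l..r}" "\<forall>t\<in>{l..r}. f t \<le> f s"
    using continuous_attains_sup[of "{l..r}" f] f lr by auto
  then have "run_max f l r = f s"
    unfolding run_max_def by (intro cSup_eq_maximum) auto
  with s show ?thesis by auto
qed

lemma run_max_upper: "s \<in> {l..r} \<Longrightarrow> f s \<le> run_max f l r"
  using run_max_attained by auto

lemma run_max_le_iff: "run_max f l r \<le> a \<longleftrightarrow> (\<forall>s\<in>{l..r}. f s \<le> a)"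
  using run_max_attained by force

text \<open>\<open>LEAST\<close> over the reals is meaningful only if the least element exists. The
  maximisers form a nonempty closed subset of a compact interval, so it does.\<close>

lemma run_argmax:
  shows run_argmax_mem: "run_argmax f l r \<in> {l..r}"
    and at_run_argmax: "f (run_argmax f l r) = run_max f l r"
    and run_argmax_le: "s \<in> {l..r} \<Longrightarrow> f s = run_max f l r \<Longrightarrow> run_argmax f l r \<le> s"
proof -
  let ?S = "{l..r} \<inter> f -` {run_max f l r}"
  have "closed ?S"
    by (intro continuous_closed_preimage f) auto
  then have "compact ({l..r} \<inter> ?S)" by (intro compact_Int_closed) auto
  then have S: "compact ?S" by (simp add: Int_assoc[symmetric])
  have "?S \<noteq> {}" using run_max_attained by auto
  then obtain s0 where s0: "s0 \<in> ?S" "\<forall>t\<in>?S. s0 \<le> t"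
    using compact_attains_inf[OF S] by blast
  have "run_argmax f l r = s0"
    unfolding run_argmax_def using s0 by (intro Least_equality) auto
  with s0 show "run_argmax f l r \<in> {l..r}" "f (run_argmax f l r) = run_max f l r"
    "s \<in> {l..r} \<Longrightarrow> f s = run_max f l r \<Longrightarrow> run_argmax f l r \<le> s" by auto
qed

end

text \<open>Ties go to the left part because the first maximiser is taken; hence the comparison of
  maxima is not strict. The second claim turns the law of the argmax into a comparison of maxima
  over two independent pieces.\<close>

lemma run_split:
  assumes f: "continuous_on {l..r} f" and u: "l \<le> u" "u \<le> r"
  shows run_max_split: "run_max f l r = max (run_max f l u) (run_max f u r)"
    and run_argmax_le_iff: "run_argmax f l r \<le> u \<longleftrightarrow> run_max f u r \<le> run_max f l u"
    and run_argmax_split: "run_argmax f l r = (if run_max f u r \<le> run_max f l u then run_argmax f l u else run_argmax f u r)"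
proof -
  have f1: "continuous_on {l..u} f" and f2: "continuous_on {u..r} f"
    using f u by (auto elim: continuous_on_subset)
  note lr = order_trans[OF u]
  note A = run_argmax_mem[OF f lr] at_run_argmax[OF f lr] run_argmax_le[OF f lr] run_max_upper[OF f lr]
  note A1 = run_argmax_mem[OF f1 u(1)] at_run_argmax[OF f1 u(1)] run_argmax_le[OF f1 u(1)] run_max_upper[OF f1 u(1)]
  note A2 = run_argmax_mem[OF f2 u(2)] at_run_argmax[OF f2 u(2)] run_argmax_le[OF f2 u(2)] run_max_upper[OF f2 u(2)]
  show m: "run_max f l r = max (run_max f l u) (run_max f u r)"
  proof (rule antisym)
    show "run_max f l r \<le> max (run_max f l u) (run_max f u r)"
      unfolding run_max_le_iff[OF f lr] using A1(4) A2(4) by (metis atLeastAtMost_iff le_max_iff_disj linear)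
    show "max (run_max f l u) (run_max f u r) \<le> run_max f l r"
      using A1(1,2) A2(1,2) A(4)[of "run_argmax f l u"] A(4)[of "run_argmax f u r"] u by auto
  qed
  show *: "run_argmax f l r \<le> u \<longleftrightarrow> run_max f u r \<le> run_max f l u"
  proof
    assume "run_argmax f l r \<le> u"
    then show "run_max f u r \<le> run_max f l u"
      using A(1,2) A1(4)[of "run_argmax f l r"] m by auto
  next
    assume "run_max f u r \<le> run_max f l u"
    then have "f (run_argmax f l u) = run_max f l r" using m A1(2) by simp
    then show "run_argmax f l r \<le> u" using A(3)[of "run_argmax f l u"] A1(1) u by simp
  qed
  show "run_argmax f l r = (if run_max f u r \<le> run_max f l u then run_argmax f l u else run_argmax f u r)"
  proof (cases "run_max f u r \<le> run_max f l u")
    case True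
    then have m': "run_max f l r = run_max f l u" using m by simp
    have "run_argmax f l r \<le> run_argmax f l u"
      using A(3)[of "run_argmax f l u"] A1(1,2) m' u by simp
    moreover have "run_argmax f l u \<le> run_argmax f l r"
      using A1(3)[of "run_argmax f l r"] A(1,2) m' True * by simp
    ultimately show ?thesis using True by simp
  next
    case False
    then have m': "run_max f l r = run_max f u r" using m by simp
    have "run_argmax f l r \<le> run_argmax f u r"
      using A(3)[of "run_argmax f u r"] A2(1,2) m' u by simp
    moreover have "run_argmax f u r \<le> run_argmax f l r"
      using A2(3)[of "run_argmax f l r"] A(1,2) m' False * by simp
    ultimately show ?thesis using False by simp
  qed
qed

section \<open>Independence of path segments over adjacent intervals\<close>

locale brownian = prob_space M for M :: "'a measure" +
  fixes B :: "real \<Rightarrow> 'a \<Rightarrow> real"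
  assumes bm: "std_brownian_motion M B"
begin

lemma measurable_B [measurable]: "t \<in> {0..1} \<Longrightarrow> B t \<in> borel_measurable M"
  using bm by (simp add: std_brownian_motion_def)

lemma B_0: "\<omega> \<in> space M \<Longrightarrow> B 0 \<omega> = 0"
  using bm by (simp add: std_brownian_motion_def)

lemma continuous_B: "\<omega> \<in> space M \<Longrightarrow> 0 \<le> l \<Longrightarrow> r \<le> 1 \<Longrightarrow> continuous_on {l..r} (\<lambda>t. B t \<omega>)"
  using bm unfolding std_brownian_motion_def
  by (auto elim!: continuous_on_subset)

lemma distributed_increment:
  "0 \<le> s \<Longrightarrow> s < t \<Longrightarrow> t \<le> 1 \<Longrightarrow>
    distributed M lborel (\<lambda>\<omega>. B t \<omega> - B s \<omega>) (\<lambda>x. ennreal (gauss (t - s) x))"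
  using bm by (simp add: std_brownian_motion_def gauss_eq_normal_density)

lemma indep_increments:
  "mono_on {..n} \<tau> \<Longrightarrow> \<tau> ` {..n} \<subseteq> {0..1} \<Longrightarrow>
    indep_vars (\<lambda>_. borel) (\<lambda>i \<omega>. B (\<tau> (Suc i)) \<omega> - B (\<tau> i) \<omega>) {..<n}" for n :: nat
  using bm by (simp add: std_brownian_motion_def)

text \<open>Only increments measured from the left end \<open>l\<close> enter, since values of B
  themselves would also involve the path before \<open>l\<close> and destroy independence. Finite
  index sets make the class closed under intersection.\<close>

definition cylinders :: "real \<Rightarrow> real \<Rightarrow> 'a set set" where
  "cylinders l u = {{\<omega>\<in>space M. \<forall>s\<in>J. B s \<omega> - B l \<omega> \<in> A s} |J A.
      finite J \<and> J \<subseteq> {l..u} \<and> (\<forall>s. A s \<in> sets borel)}"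

definition incr_algebra :: "real \<Rightarrow> real \<Rightarrow> 'a measure" where
  "incr_algebra l u = sigma (space M) (cylinders l u)"

lemma cylindersI:
  "finite J \<Longrightarrow> J \<subseteq> {l..u} \<Longrightarrow> (\<And>s. A s \<in> sets borel) \<Longrightarrow>
    {\<omega>\<in>space M. \<forall>s\<in>J. B s \<omega> - B l \<omega> \<in> A s} \<in> cylinders l u"
  unfolding cylinders_def by blast

lemma cylinders_subset_events:
  assumes "0 \<le> l" "u \<le> 1"
  shows "cylinders l u \<subseteq> events"
proof
  fix E assume "E \<in> cylinders l u"
  then obtain J A where J: "finite J" "J \<subseteq> {l..u}" and A[measurable]: "\<And>s. A s \<in> sets borel"
    and E: "E = {\<omega>\<in>space M. \<forall>s\<in>J. B s \<omega> - B l \<omega> \<in> A s}" unfolding cylinders_def by blast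
  show "E \<in> events"
  proof (cases "J = {}")
    case False
    then have l: "l \<in> {0..1}" using assms J by auto
    have [measurable]: "B s \<in> borel_measurable M" if "s \<in> J" for s
      using that assms J by (intro measurable_B) auto
    show ?thesis
      unfolding E using l J(1) by (intro sets.sets_Collect_finite_All) auto
  qed (simp add: E)
qed

lemma Int_stable_cylinders: "Int_stable (cylinders l u)"
proof (rule Int_stableI)
  fix E F assume EF: "E \<in> cylinders l u" "F \<in> cylinders l u"
  from EF(1) obtain J A where J: "finite J" "J \<subseteq> {l..u}" "\<And>s. A s \<in> sets borel"
    and E: "E = {\<omega>\<in>space M. \<forall>s\<in>J. B s \<omega> - B l \<omega> \<in> A s}"
    unfolding cylinders_def by blast
  from EF(2) obtain K A' where K: "finite K" "K \<subseteq> {l..u}" "\<And>s. A' s \<in> sets borel"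
    and F: "F = {\<omega>\<in>space M. \<forall>s\<in>K. B s \<omega> - B l \<omega> \<in> A' s}"
    unfolding cylinders_def by blast
  have "E \<inter> F = {\<omega>\<in>space M. \<forall>s\<in>J \<union> K. B s \<omega> - B l \<omega> \<in> (if s \<in> J then A s else UNIV) \<inter> (if s \<in> K then A' s else UNIV)}"
    unfolding E F by auto
  also have "\<dots> \<in> cylinders l u"
    using J K by (intro cylindersI) auto
  finally show "E \<inter> F \<in> cylinders l u" .
qed

text \<open>All time points of both events are merged into one finite grid. Each event then depends
  on a block of grid increments, the blocks lie on different sides of u, and disjoint blocks of
  independent increments are independent.\<close>

lemma indep_cylinders:
  assumes lur: "0 \<le> l" "l \<le> u" "u \<le> r" "r \<le> 1"
  shows "indep_set (cylinders l u) (cylinders u r)"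
  unfolding indep_sets2_eq
proof (intro conjI ballI)
  show "cylinders l u \<subseteq> events" "cylinders u r \<subseteq> events"
    using cylinders_subset_events lur by auto
  fix E F assume EF: "E \<in> cylinders l u" "F \<in> cylinders u r"
  from EF(1) obtain J A where J: "finite J" "J \<subseteq> {l..u}" and A[measurable]: "\<And>s. A s \<in> sets borel"
    and E: "E = {\<omega>\<in>space M. \<forall>s\<in>J. B s \<omega> - B l \<omega> \<in> A s}"
    unfolding cylinders_def by blast
  from EF(2) obtain K A' where K: "finite K" "K \<subseteq> {u..r}" and A'[measurable]: "\<And>s. A' s \<in> sets borel"
    and F: "F = {\<omega>\<in>space M. \<forall>s\<in>K. B s \<omega> - B u \<omega> \<in> A' s}"
    unfolding cylinders_def by blast
  \<comment> \<open>The ends l and u are inserted so that every increment from l or from u is a sum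
    of whole grid increments.\<close>
  define S where "S = insert l (insert u (J \<union> K))"
  define xs where "xs = sorted_list_of_set S"
  define n where "n = length xs - 1"
  define \<tau> where "\<tau> i = xs ! min i n" for i
  have finS: "finite S" using J K by (simp add: S_def)
  have xs: "sorted xs" "distinct xs" "set xs = S" using finS by (auto simp: xs_def)
  have "xs \<noteq> []" using xs(3) by (auto simp: S_def)
  then have len: "length xs = Suc n" by (simp add: n_def)
  have smono: "\<tau> i < \<tau> j" if "i < j" "j \<le> n" for i j
    using that xs len sorted_wrt_nth_less[of "(<)" xs i j] by (simp add: \<tau>_def strict_sorted_iff)
  have mono: "\<tau> i \<le> \<tau> j" if "i \<le> j" "j \<le> n" for i j
    using that smono[of i j] by (cases "i = j") auto
  have \<tau>S: "\<tau> i \<in> S" if "i \<le> n" for i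
    using that len xs(3) nth_mem[of i xs] by (simp add: \<tau>_def)
  have S\<tau>: "\<exists>i\<le>n. \<tau> i = s" if "s \<in> S" for s
    using that len unfolding xs(3)[symmetric] in_set_conv_nth \<tau>_def by (auto simp: less_Suc_eq_le min_def)
  have S01: "S \<subseteq> {0..1}" using J K lur by (auto simp: S_def)
  define X where "X i \<omega> = B (\<tau> (Suc i)) \<omega> - B (\<tau> i) \<omega>" for i \<omega>
  have ind: "indep_vars (\<lambda>_. borel) X {..<n}"
    unfolding X_def
  proof (rule indep_increments)
    show "mono_on {..n} \<tau>" using mono by (auto simp: mono_on_def)
    show "\<tau> ` {..n} \<subseteq> {0..1}" using \<tau>S S01 by auto
  qed
  \<comment> \<open>The indices of the grid increments that lie inside [p, s]; they telescope to the
    increment over [p, s].\<close>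
  define R where "R p s = {i. i < n \<and> p \<le> \<tau> i \<and> \<tau> (Suc i) \<le> s}" for p s
  have sum_X: "B s \<omega> - B p \<omega> = (\<Sum>i\<in>R p s. X i \<omega>)" if "p \<in> S" "s \<in> S" "p \<le> s" for p s \<omega>
  proof -
    obtain i j where ij: "i \<le> n" "\<tau> i = p" "j \<le> n" "\<tau> j = s" using S\<tau> \<open>p \<in> S\<close> \<open>s \<in> S\<close> by metis
    have "R p s = {i..<j}"
    proof (intro set_eqI iffI)
      fix k assume "k \<in> R p s"
      then have k: "k < n" "\<tau> i \<le> \<tau> k" "\<tau> (Suc k) \<le> \<tau> j" by (auto simp: R_def ij)
      have "i \<le> k" using smono[of k i] k ij(1) by (meson leD leI)
      moreover have "Suc k \<le> j" using smono[of j "Suc k"] k by (meson leD leI Suc_leI)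
      ultimately show "k \<in> {i..<j}" by auto
    next
      fix k assume "k \<in> {i..<j}"
      then show "k \<in> R p s" using mono[of i k] mono[of "Suc k" j] ij by (auto simp: R_def)
    qed
    moreover have "i \<le> j" using smono[of j i] ij \<open>p \<le> s\<close> by (meson leD leI)
    ultimately show ?thesis
      using sum_Suc_diff'[of i j "\<lambda>i. B (\<tau> i) \<omega>"] ij by (simp add: X_def)
  qed
  have R[simp]: "R l u \<inter> R u r = {}" "R l u \<subseteq> {..<n}" "R u r \<subseteq> {..<n}"
  proof -
    \<comment> \<open>A common index would give a grid step that begins at or after u and ends at or
      before u, which the strict monotonicity of the grid excludes.\<close>
    have "False" if "k \<in> R l u" "k \<in> R u r" for k
      using that smono[of k "Suc k"] by (auto simp: R_def)
    then show "R l u \<inter> R u r = {}" by auto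
  qed (auto simp: R_def)
  have Rsub: "R l s \<subseteq> R l u" if "s \<in> J" for s
    using that J by (auto simp: R_def)
  have Rsub': "R u s \<subseteq> R u r" if "s \<in> K" for s
    using that K by (auto simp: R_def)
  note iv = indep_var_restrict[OF ind R]
  define C1 where "C1 = {f \<in> space (PiM (R l u) (\<lambda>_. borel :: real measure)). \<forall>s\<in>J. (\<Sum>i\<in>R l s. f i) \<in> A s}"
  define C2 where "C2 = {f \<in> space (PiM (R u r) (\<lambda>_. borel :: real measure)). \<forall>s\<in>K. (\<Sum>i\<in>R u s. f i) \<in> A' s}"
  have C1: "C1 \<in> sets (PiM (R l u) (\<lambda>_. borel))"
    unfolding C1_def
  proof (intro sets.sets_Collect_finite_All J(1))
    fix s assume "s \<in> J"
    have "(\<lambda>f. \<Sum>i\<in>R l s. f i) \<in> borel_measurable (PiM (R l u) (\<lambda>_. borel :: real measure))"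
      using Rsub[OF \<open>s \<in> J\<close>] by (intro borel_measurable_sum measurable_component_singleton) auto
    then show "{f \<in> space (PiM (R l u) (\<lambda>_. borel)). (\<Sum>i\<in>R l s. f i) \<in> A s} \<in> sets (PiM (R l u) (\<lambda>_. borel))"
      by measurable
  qed
  have C2: "C2 \<in> sets (PiM (R u r) (\<lambda>_. borel))"
    unfolding C2_def
  proof (intro sets.sets_Collect_finite_All K(1))
    fix s assume "s \<in> K"
    have "(\<lambda>f. \<Sum>i\<in>R u s. f i) \<in> borel_measurable (PiM (R u r) (\<lambda>_. borel :: real measure))"
      using Rsub'[OF \<open>s \<in> K\<close>] by (intro borel_measurable_sum measurable_component_singleton) auto
    then show "{f \<in> space (PiM (R u r) (\<lambda>_. borel)). (\<Sum>i\<in>R u s. f i) \<in> A' s} \<in> sets (PiM (R u r) (\<lambda>_. borel))"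
      by measurable
  qed
  have E': "E = (\<lambda>\<omega>. restrict (\<lambda>i. X i \<omega>) (R l u)) -` C1 \<inter> space M"
  proof -
    have "(\<Sum>i\<in>R l s. restrict (\<lambda>i. X i \<omega>) (R l u) i) = B s \<omega> - B l \<omega>" if "s \<in> J" for s \<omega>
    proof -
      have "(\<Sum>i\<in>R l s. restrict (\<lambda>i. X i \<omega>) (R l u) i) = (\<Sum>i\<in>R l s. X i \<omega>)"
        using Rsub[OF that] by (intro sum.cong) auto
      also have "\<dots> = B s \<omega> - B l \<omega>" using sum_X[of l s \<omega>] that J by (auto simp: S_def)
      finally show ?thesis .
    qed
    then show ?thesis by (auto simp: E C1_def space_PiM)
  qed
  have F': "F = (\<lambda>\<omega>. restrict (\<lambda>i. X i \<omega>) (R u r)) -` C2 \<inter> space M"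
  proof -
    have "(\<Sum>i\<in>R u s. restrict (\<lambda>i. X i \<omega>) (R u r) i) = B s \<omega> - B u \<omega>" if "s \<in> K" for s \<omega>
    proof -
      have "(\<Sum>i\<in>R u s. restrict (\<lambda>i. X i \<omega>) (R u r) i) = (\<Sum>i\<in>R u s. X i \<omega>)"
        using Rsub'[OF that] by (intro sum.cong) auto
      also have "\<dots> = B s \<omega> - B u \<omega>" using sum_X[of u s \<omega>] that K by (auto simp: S_def)
      finally show ?thesis .
    qed
    then show ?thesis by (auto simp: F C2_def space_PiM)
  qed
  have "E \<inter> F = (\<lambda>\<omega>. (restrict (\<lambda>i. X i \<omega>) (R l u), restrict (\<lambda>i. X i \<omega>) (R u r))) -` (C1 \<times> C2) \<inter> space M"
    unfolding E' F' by auto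
  then show "prob (E \<inter> F) = prob E * prob F"
    unfolding E' F' using indep_varD[OF iv C1 C2] by simp
qed

lemma space_incr_algebra [simp]: "space (incr_algebra l u) = space M"
  by (simp add: incr_algebra_def space_measure_of_conv)

lemma sets_incr_algebra: "sets (incr_algebra l u) = sigma_sets (space M) (cylinders l u)"
  unfolding incr_algebra_def by (rule sets_measure_of) (auto simp: cylinders_def)

lemma sets_incr_algebra_subset: "0 \<le> l \<Longrightarrow> u \<le> 1 \<Longrightarrow> sets (incr_algebra l u) \<subseteq> events"
  unfolding sets_incr_algebra by (intro sets.sigma_sets_subset cylinders_subset_events)

lemma measurable_incr_algebra_imp:
  "f \<in> measurable (incr_algebra l u) N \<Longrightarrow> 0 \<le> l \<Longrightarrow> u \<le> 1 \<Longrightarrow> f \<in> measurable M N"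
  using sets_incr_algebra_subset[of l u] unfolding measurable_def by auto

lemma measurable_increment_from_start:
  assumes "s \<in> {l..u}"
  shows "(\<lambda>\<omega>. B s \<omega> - B l \<omega>) \<in> borel_measurable (incr_algebra l u)"
proof (rule measurableI)
  fix A :: "real set" assume A: "A \<in> sets borel"
  have "(\<lambda>\<omega>. B s \<omega> - B l \<omega>) -` A \<inter> space (incr_algebra l u) = {\<omega>\<in>space M. \<forall>t\<in>{s}. B t \<omega> - B l \<omega> \<in> A}"
    by auto
  also have "\<dots> \<in> cylinders l u" using assms A by (intro cylindersI) auto
  finally show "(\<lambda>\<omega>. B s \<omega> - B l \<omega>) -` A \<inter> space (incr_algebra l u) \<in> sets (incr_algebra l u)"
    unfolding sets_incr_algebra by (rule sigma_sets.Basic)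
qed simp

text \<open>Both cylinder classes are closed under intersection, so their independence extends to
  the generated sigma-algebras; the joint law then agrees with the product measure on
  rectangles.\<close>

lemma distr_pair_incr_algebra:
  assumes lur: "0 \<le> l" "l \<le> u" "u \<le> r" "r \<le> 1"
    and X: "X \<in> measurable (incr_algebra l u) N" and Y: "Y \<in> measurable (incr_algebra u r) N'"
  shows "distr M (N \<Otimes>\<^sub>M N') (\<lambda>\<omega>. (X \<omega>, Y \<omega>)) = distr M N X \<Otimes>\<^sub>M distr M N' Y"
proof (rule pair_measure_eqI[symmetric])
  have [measurable]: "X \<in> measurable M N" "Y \<in> measurable M N'"
    using measurable_incr_algebra_imp[OF X] measurable_incr_algebra_imp[OF Y] lur by auto
  interpret X: prob_space "distr M N X" by (rule prob_space_distr) measurable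
  interpret Y: prob_space "distr M N' Y" by (rule prob_space_distr) measurable
  show "sigma_finite_measure (distr M N X)" "sigma_finite_measure (distr M N' Y)"
    by unfold_locales
  show "sets (distr M N X \<Otimes>\<^sub>M distr M N' Y) = sets (distr M (N \<Otimes>\<^sub>M N') (\<lambda>\<omega>. (X \<omega>, Y \<omega>)))"
    by (simp cong: sets_pair_measure_cong)
  fix A C assume A: "A \<in> sets (distr M N X)" and C: "C \<in> sets (distr M N' Y)"
  have "X -` A \<inter> space M \<in> sigma_sets (space M) (cylinders l u)"
    using measurable_sets[OF X] A unfolding sets_incr_algebra[symmetric] by simp
  moreover have "Y -` C \<inter> space M \<in> sigma_sets (space M) (cylinders u r)"
    using measurable_sets[OF Y] C unfolding sets_incr_algebra[symmetric] by simp
  ultimately have "prob ((X -` A \<inter> space M) \<inter> (Y -` C \<inter> space M)) = prob (X -` A \<inter> space M) * prob (Y -` C \<inter> space M)"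
    using indep_set_sigma_sets[OF indep_cylinders[OF lur] Int_stable_cylinders Int_stable_cylinders]
    unfolding indep_sets2_eq by blast
  moreover have "(X -` A \<inter> space M) \<inter> (Y -` C \<inter> space M) = (\<lambda>\<omega>. (X \<omega>, Y \<omega>)) -` (A \<times> C) \<inter> space M"
    by auto
  ultimately show "emeasure (distr M N X) A * emeasure (distr M N' Y) C
      = emeasure (distr M (N \<Otimes>\<^sub>M N') (\<lambda>\<omega>. (X \<omega>, Y \<omega>))) (A \<times> C)"
    using A C by (simp add: emeasure_distr emeasure_eq_measure ennreal_mult')
qed

text \<open>By continuity the maximum is bounded by a level if and only if countably many grid
  values are. Subtracting \<open>B l\<close> leaves increments from l only, and the free subinterval
  [p, q] is what the treatment of the argmax requires.\<close>

lemma measurable_run_max: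
  assumes "0 \<le> l" "l \<le> p" "p \<le> q" "q \<le> u" "u \<le> 1"
  shows "(\<lambda>\<omega>. run_max (\<lambda>s. B s \<omega>) p q - B l \<omega>) \<in> borel_measurable (incr_algebra l u)"
proof (rule borel_measurable_iff_le[THEN iffD2], rule allI)
  fix a :: real
  define D where "D = {p + (q - p) * (real k / 2 ^ n) | k n. k \<le> (2::nat) ^ n}"
  have D: "D \<subseteq> {p..q}"
  proof
    fix x assume "x \<in> D"
    then obtain k n where x: "x = p + (q - p) * (real k / 2 ^ n)" "k \<le> 2 ^ n" by (auto simp: D_def)
    have "real k / 2 ^ n \<le> 1" using x(2) by (simp flip: of_nat_le_iff)
    then have "(q - p) * (real k / 2 ^ n) \<le> (q - p) * 1" using assms by (intro mult_left_mono) auto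
    then show "x \<in> {p..q}" using x assms by simp
  qed
  have "D = (\<lambda>(k, n). p + (q - p) * (real k / 2 ^ n)) ` (SIGMA k:UNIV. {n. k \<le> 2 ^ n})"
    by (auto simp: D_def)
  then have cD: "countable D" by simp
  have clD: "closure D = {p..q}"
    using closure_dyadic_grid[OF assms(3)] D closure_minimal[of D "{p..q}"] by (auto simp: D_def)
  have "{\<omega> \<in> space (incr_algebra l u). run_max (\<lambda>s. B s \<omega>) p q - B l \<omega> \<le> a}
      = {\<omega> \<in> space (incr_algebra l u). \<forall>s\<in>D. B s \<omega> - B l \<omega> \<le> a}"
  proof (intro Collect_cong conj_cong refl)
    fix \<omega> assume "\<omega> \<in> space (incr_algebra l u)"
    then have c: "continuous_on {p..q} (\<lambda>s. B s \<omega>)"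
      using assms by (intro continuous_B) auto
    have "run_max (\<lambda>s. B s \<omega>) p q - B l \<omega> \<le> a \<longleftrightarrow> (\<forall>s\<in>{p..q}. B s \<omega> \<le> a + B l \<omega>)"
      using run_max_le_iff[OF c assms(3), of "a + B l \<omega>"] by (simp add: algebra_simps)
    also have "\<dots> \<longleftrightarrow> (\<forall>s\<in>D. B s \<omega> \<le> a + B l \<omega>)"
      using continuous_le_on_closure[of D "\<lambda>s. B s \<omega>" _ "a + B l \<omega>"] c D unfolding clD by blast
    finally show "run_max (\<lambda>s. B s \<omega>) p q - B l \<omega> \<le> a \<longleftrightarrow> (\<forall>s\<in>D. B s \<omega> - B l \<omega> \<le> a)"
      by (simp add: algebra_simps)
  qed
  also have "\<dots> \<in> sets (incr_algebra l u)"
  proof (intro sets.sets_Collect_countable_All' cD)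
    fix s assume "s \<in> D"
    then have [measurable]: "(\<lambda>\<omega>. B s \<omega> - B l \<omega>) \<in> borel_measurable (incr_algebra l u)"
      using D assms by (intro measurable_increment_from_start) auto
    show "{\<omega> \<in> space (incr_algebra l u). B s \<omega> - B l \<omega> \<le> a} \<in> sets (incr_algebra l u)"
      by measurable
  qed
  finally show "{\<omega> \<in> space (incr_algebra l u). run_max (\<lambda>s. B s \<omega>) p q - B l \<omega> \<le> a} \<in> sets (incr_algebra l u)" .
qed

text \<open>For v inside the interval, the argmax is at most v exactly when the maximum over [v, u]
  does not exceed the one over [l, v]; for other v the event is trivial.\<close>

lemma measurable_run_argmax:
  assumes "0 \<le> l" "l \<le> u" "u \<le> 1"
  shows "(\<lambda>\<omega>. run_argmax (\<lambda>s. B s \<omega>) l u) \<in> borel_measurable (incr_algebra l u)"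
proof (rule borel_measurable_iff_le[THEN iffD2], rule allI)
  fix v :: real
  have mem: "run_argmax (\<lambda>s. B s \<omega>) l u \<in> {l..u}" if "\<omega> \<in> space M" for \<omega>
    using that assms by (intro run_argmax_mem continuous_B) auto
  consider "v < l" | "u \<le> v" | "l \<le> v" "v \<le> u" by linarith
  then show "{\<omega> \<in> space (incr_algebra l u). run_argmax (\<lambda>s. B s \<omega>) l u \<le> v} \<in> sets (incr_algebra l u)"
  proof cases
    case 1
    then have eq: "{\<omega> \<in> space (incr_algebra l u). run_argmax (\<lambda>s. B s \<omega>) l u \<le> v} = {}"
      using mem by force
    show ?thesis by (simp only: eq sets.empty_sets)
  next
    case 2
    then have eq: "{\<omega> \<in> space (incr_algebra l u). run_argmax (\<lambda>s. B s \<omega>) l u \<le> v} = space (incr_algebra l u)"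
      using mem by force
    show ?thesis by (simp only: eq sets.top)
  next
    case 3
    have [measurable]: "(\<lambda>\<omega>. run_max (\<lambda>s. B s \<omega>) v u - B l \<omega>) \<in> borel_measurable (incr_algebra l u)"
        "(\<lambda>\<omega>. run_max (\<lambda>s. B s \<omega>) l v - B l \<omega>) \<in> borel_measurable (incr_algebra l u)"
      using assms 3 by (auto intro!: measurable_run_max)
    have "{\<omega> \<in> space (incr_algebra l u). run_argmax (\<lambda>s. B s \<omega>) l u \<le> v}
      = {\<omega> \<in> space (incr_algebra l u). run_max (\<lambda>s. B s \<omega>) v u - B l \<omega> \<le> run_max (\<lambda>s. B s \<omega>) l v - B l \<omega>}"
      using 3 assms by (intro Collect_cong conj_cong refl, subst run_argmax_le_iff) (auto intro!: continuous_B)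
    also have "\<dots> \<in> sets (incr_algebra l u)" by measurable
    finally show ?thesis .
  qed
qed

end

section \<open>The reflection principle\<close>

text \<open>The multivariate distribution function determines the law, because lower orthants are
  closed under intersection and generate the Borel sets. It is applied to pairs (maximum, final
  value) and to triples that include the argmax.\<close>

lemma measure_eqI_atMost:
  fixes M N :: "'a :: ordered_euclidean_space measure"
  assumes sets: "sets M = sets borel" "sets N = sets borel"
    and fin: "finite_measure M"
    and eq: "\<And>a. emeasure M {..a} = emeasure N {..a}"
  shows "M = N"
proof (rule measure_eqI_generator_eq[where E = "range atMost" and \<Omega> = UNIV and A = "\<lambda>i. {..real i *\<^sub>R One}"])
  show "Int_stable (range atMost :: 'a set set)"
  proof (rule Int_stableI_image)
    fix a b :: 'a
    have "{..a} \<inter> {..b} = {..inf a b}" by auto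
    then show "\<exists>c\<in>UNIV. {..a} \<inter> {..b} = {..c}" by blast
  qed
  have s: "sets borel = sigma_sets UNIV (range atMost :: 'a set set)"
    unfolding borel_eq_atMost by (rule sets_measure_of) auto
  show "sets M = sigma_sets UNIV (range atMost)" "sets N = sigma_sets UNIV (range atMost)"
    using sets s by auto
  show "(\<Union>i. {..real i *\<^sub>R One :: 'a}) = UNIV"
  proof (intro set_eqI iffI UNIV_I)
    fix x :: 'a
    obtain n :: nat where n: "norm x \<le> real n" using real_arch_simple by blast
    have "x \<le> real n *\<^sub>R One"
      unfolding eucl_le[where 'a='a] using n Basis_le_norm[of _ x]
      by (force simp: inner_sum_left_Basis abs_le_iff)
    then show "x \<in> (\<Union>i. {..real i *\<^sub>R One})" by auto
  qed
  show "emeasure M {..real i *\<^sub>R One :: 'a} \<noteq> \<infinity>" for i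
    using finite_measure.emeasure_finite[OF fin] by simp
qed (use eq in auto)

lemma run_max_ge_self:
  fixes f :: "real \<Rightarrow> real"
  assumes "continuous_on {l..r} f" "l \<le> r"
  shows "f l \<le> run_max f l r" "f r \<le> run_max f l r"
  using run_max_upper[OF assms] assms(2) by auto

context brownian
begin

text \<open>Increments have no atoms; this disposes of boundary events where strict and weak
  inequalities differ.\<close>

lemma increment_ne:
  assumes "0 \<le> l" "l < r" "r \<le> 1"
  shows "AE \<omega> in M. B r \<omega> - B l \<omega> \<noteq> c"
proof -
  have "AE x in lborel. x \<noteq> c"
    by (rule AE_lborel_singleton)
  then have "AE x in density lborel (\<lambda>x. ennreal (gauss (r - l) x)). x \<noteq> c"
    by (subst AE_density) auto
  then have "AE x in distr M lborel (\<lambda>\<omega>. B r \<omega> - B l \<omega>). x \<noteq> c"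
    by (simp only: distributed_distr_eq_density[OF distributed_increment[OF assms]])
  then show ?thesis
    using assms by (subst (asm) AE_distr_iff) auto
qed

lemma distr_increment_symmetric:
  assumes "0 \<le> l" "l \<le> r" "r \<le> 1"
  shows "distr M borel (\<lambda>\<omega>. - (B r \<omega> - B l \<omega>)) = distr M borel (\<lambda>\<omega>. B r \<omega> - B l \<omega>)"
proof (cases "l < r")
  case True
  have d: "distributed M lborel (\<lambda>\<omega>. B r \<omega> - B l \<omega>) (\<lambda>x. ennreal (normal_density 0 (sqrt (r - l)) x))"
    using distributed_increment[of l r] True assms by (simp add: gauss_eq_normal_density)
  have "distributed M lborel (\<lambda>\<omega>. 0 + (- 1) * (B r \<omega> - B l \<omega>)) (\<lambda>x. ennreal (normal_density (0 + (- 1) * 0) (\<bar>- 1\<bar> * sqrt (r - l)) x))"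
    by (rule normal_density_affine[OF d]) (use True in auto)
  then have "distributed M lborel (\<lambda>\<omega>. - (B r \<omega> - B l \<omega>)) (\<lambda>x. ennreal (normal_density 0 (sqrt (r - l)) x))"
    by simp
  then have "distr M lborel (\<lambda>\<omega>. - (B r \<omega> - B l \<omega>)) = distr M lborel (\<lambda>\<omega>. B r \<omega> - B l \<omega>)"
    using distributed_distr_eq_density d by metis
  moreover have "distr M lborel f = distr M borel f" for f :: "'a \<Rightarrow> real"
    by (rule distr_cong) auto
  ultimately show ?thesis by simp
next
  case False
  with assms show ?thesis by simp
qed

text \<open>The increment after u is symmetric and independent of the increments before u, so
  changing its sign preserves the joint law.\<close>

lemma prob_reflect_after:
  assumes lur: "0 \<le> l" "l \<le> u" "u \<le> r" "r \<le> 1"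
    and X: "X \<in> measurable (incr_algebra l u) N" and A[measurable]: "A \<in> sets (N \<Otimes>\<^sub>M borel)"
  shows "prob {\<omega>\<in>space M. (X \<omega>, B r \<omega> - B u \<omega>) \<in> A} = prob {\<omega>\<in>space M. (X \<omega>, - (B r \<omega> - B u \<omega>)) \<in> A}"
proof -
  have D: "(\<lambda>\<omega>. B r \<omega> - B u \<omega>) \<in> borel_measurable (incr_algebra u r)"
    using lur by (intro measurable_increment_from_start) auto
  then have D': "(\<lambda>\<omega>. - (B r \<omega> - B u \<omega>)) \<in> borel_measurable (incr_algebra u r)"
    by measurable
  have [measurable]: "X \<in> measurable M N" "(\<lambda>\<omega>. B r \<omega> - B u \<omega>) \<in> borel_measurable M"
    using measurable_incr_algebra_imp[OF X] measurable_incr_algebra_imp[OF D] lur by auto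
  have "distr M (N \<Otimes>\<^sub>M borel) (\<lambda>\<omega>. (X \<omega>, B r \<omega> - B u \<omega>)) = distr M (N \<Otimes>\<^sub>M borel) (\<lambda>\<omega>. (X \<omega>, - (B r \<omega> - B u \<omega>)))"
    unfolding distr_pair_incr_algebra[OF lur X D] distr_pair_incr_algebra[OF lur X D']
    using distr_increment_symmetric[of u r] lur by simp
  then have "measure (distr M (N \<Otimes>\<^sub>M borel) (\<lambda>\<omega>. (X \<omega>, B r \<omega> - B u \<omega>))) A
     = measure (distr M (N \<Otimes>\<^sub>M borel) (\<lambda>\<omega>. (X \<omega>, - (B r \<omega> - B u \<omega>)))) A" by simp
  then show ?thesis
    by (simp add: measure_distr vimage_def Int_def conj_commute del: minus_diff_eq)
qed

text \<open>
  The reflection principle. It holds exactly for the walk on a dyadic grid when it is reflected at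
  its value at the first grid time above \<open>a\<close>, and the overshoot vanishes as the grid is refined.
\<close>
lemma reflection:
  assumes lr: "0 \<le> l" "l < r" "r \<le> 1" and a: "0 \<le> a"
  shows "prob {\<omega>\<in>space M. B r \<omega> - B l \<omega> \<le> x \<and> a < run_max (\<lambda>s. B s \<omega>) l r - B l \<omega>}
       = prob {\<omega>\<in>space M. 2 * a - (B r \<omega> - B l \<omega>) \<le> x \<and> a < run_max (\<lambda>s. B s \<omega>) l r - B l \<omega>}"
proof -
  define t where "t n k = l + (r - l) * (real k / 2 ^ n)" for n k :: nat
  define S where "S n k \<omega> = B (t n k) \<omega> - B l \<omega>" for n k \<omega>
  define W where "W \<omega> = B r \<omega> - B l \<omega>" for \<omega>
  \<comment> \<open>The first grid index above level a; it is meaningful only on the event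
    \<open>E n\<close>, which accompanies it below.\<close>
  define T where "T n \<omega> = (LEAST k. a < S n k \<omega>)" for n \<omega>
  define E where "E n \<omega> \<longleftrightarrow> (\<exists>k\<le>2 ^ n. a < S n k \<omega>)" for n \<omega>
  define m where "m \<omega> = run_max (\<lambda>s. B s \<omega>) l r - B l \<omega>" for \<omega>
  have t_mono: "t n j \<le> t n k" if "j \<le> k" for n j k
    unfolding t_def using that lr by (intro add_left_mono mult_left_mono divide_right_mono) auto
  have t0: "t n 0 = l" and t1: "t n (2 ^ n) = r" for n by (auto simp: t_def)
  have t_mem: "t n k \<in> {l..r}" if "k \<le> 2 ^ n" for n k
    using t_mono[of 0 k n] t_mono[of k "2 ^ n" n] that by (simp add: t0 t1)
  have [measurable]: "S n k \<in> borel_measurable M" if "k \<le> 2 ^ n" for n k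
    unfolding S_def using t_mem[OF that] lr by (intro borel_measurable_diff measurable_B) auto
  have [measurable]: "W \<in> borel_measurable M"
    unfolding W_def using lr by (intro borel_measurable_diff measurable_B) auto
  have [measurable]: "m \<in> borel_measurable M"
    unfolding m_def using lr measurable_incr_algebra_imp[OF measurable_run_max[of l l r r]] by auto
  \<comment> \<open>First passage at grid index j, expressed by finitely many comparisons up to j.
    It is therefore an event of the increments before \<open>t n j\<close>, to which the reflection
    of the later increment applies.\<close>
  define F where "F n j \<omega> \<longleftrightarrow> a < S n j \<omega> \<and> (\<forall>k\<in>{..<j}. S n k \<omega> \<le> a)" for n j \<omega>
  have F_T: "F n j \<omega> \<longleftrightarrow> T n \<omega> = j \<and> a < S n j \<omega>" for n j \<omega>
  proof
    assume "F n j \<omega>"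
    then have F: "a < S n j \<omega>" "\<And>k. k < j \<Longrightarrow> S n k \<omega> \<le> a" by (auto simp: F_def)
    have "(LEAST k. a < S n k \<omega>) = j"
    proof (rule Least_equality)
      show "a < S n j \<omega>" by (rule F(1))
      show "j \<le> k" if "a < S n k \<omega>" for k
        using F(2)[of k] that by (cases "k < j") auto
    qed
    with F(1) show "T n \<omega> = j \<and> a < S n j \<omega>" by (simp add: T_def)
  next
    assume "T n \<omega> = j \<and> a < S n j \<omega>"
    then show "F n j \<omega>"
      unfolding F_def T_def using not_less_Least[of _ "\<lambda>k. a < S n k \<omega>"] by (metis lessThan_iff linorder_not_le)
  qed
  have E_F: "E n \<omega> \<longleftrightarrow> (\<exists>j\<le>2 ^ n. F n j \<omega>)" for n \<omega>
  proof
    assume "E n \<omega>"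
    then obtain k where k: "k \<le> 2 ^ n" "a < S n k \<omega>" by (auto simp: E_def)
    have "a < S n (T n \<omega>) \<omega>"
      unfolding T_def using k(2) by (rule LeastI)
    moreover have "T n \<omega> \<le> k"
      unfolding T_def using k(2) by (rule Least_le)
    ultimately show "\<exists>j\<le>2 ^ n. F n j \<omega>"
      unfolding F_T using k(1) by auto
  qed (auto simp: E_def F_def)
  have E_T: "E n \<omega> \<longleftrightarrow> F n (T n \<omega>) \<omega> \<and> T n \<omega> \<le> 2 ^ n" for n \<omega>
    unfolding E_F using F_T by auto
  have pred_F: "Measurable.pred N (F n j)" if "\<And>k. k \<le> j \<Longrightarrow> S n k \<in> borel_measurable N" for n j and N :: "'a measure"
    unfolding F_def
  proof (intro pred_intros_logic pred_intros_finite finite_lessThan)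
    show "Measurable.pred N (\<lambda>\<omega>. a < S n j \<omega>)"
      using that[of j] by simp
    show "Measurable.pred N (\<lambda>\<omega>. S n k \<omega> \<le> a)" if "k \<in> {..<j}" for k
      using \<open>\<And>k. k \<le> j \<Longrightarrow> S n k \<in> borel_measurable N\<close>[of k] that by simp
  qed
  have [measurable]: "Measurable.pred M (F n j)" if "j \<le> 2 ^ n" for n j
    using that by (intro pred_F) simp
  \<comment> \<open>On the grid the reflection is exact about the level
    \<open>S n (T n \<omega>) \<omega>\<close> actually reached; the level a itself appears only in
    the limit.\<close>
  let ?L = "\<lambda>n. {\<omega>\<in>space M. E n \<omega> \<and> W \<omega> \<le> x}" and ?R = "\<lambda>n. {\<omega>\<in>space M. E n \<omega> \<and> 2 * S n (T n \<omega>) \<omega> - W \<omega> \<le> x}"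
  have discrete: "prob (?L n) = prob (?R n) \<and> ?L n \<in> events \<and> ?R n \<in> events" for n
  proof -
    let ?Lj = "\<lambda>j. {\<omega>\<in>space M. F n j \<omega> \<and> W \<omega> \<le> x}"
    let ?Rj = "\<lambda>j. {\<omega>\<in>space M. F n j \<omega> \<and> 2 * S n j \<omega> - W \<omega> \<le> x}"
    have L: "?L n = (\<Union>j\<in>{..2 ^ n}. ?Lj j)" unfolding E_F by auto
    have R: "?R n = (\<Union>j\<in>{..2 ^ n}. ?Rj j)" unfolding E_F using F_T by auto
    have ev: "?Lj j \<in> events" "?Rj j \<in> events" if "j \<in> {..2 ^ n}" for j
    proof -
      have [measurable]: "Measurable.pred M (F n j)" "S n j \<in> borel_measurable M" using that by auto
      show "?Lj j \<in> events" "?Rj j \<in> events" by measurable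
    qed
    have disj: "disjoint_family_on ?Lj {..2 ^ n}" "disjoint_family_on ?Rj {..2 ^ n}"
      unfolding disjoint_family_on_def using F_T by auto
    have eq: "prob (?Lj j) = prob (?Rj j)" if "j \<in> {..2 ^ n}" for j
    proof -
      let ?u = "t n j"
      have u: "l \<le> ?u" "?u \<le> r" using t_mem[of j n] that by auto
      \<comment> \<open>The event is carried along as a 0/1 coordinate, so that it forms one random
        vector of the past together with the value at the passage.\<close>
      let ?X = "\<lambda>\<omega>. (if F n j \<omega> then 1 else 0 :: real, S n j \<omega>)"
      have [measurable]: "S n k \<in> borel_measurable (incr_algebra l ?u)" if "k \<le> j" for k
        unfolding S_def using t_mono[OF that, of n] t_mono[of 0 k n]
        by (intro measurable_increment_from_start) (auto simp: t0)
      have [measurable]: "Measurable.pred (incr_algebra l ?u) (F n j)"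
        by (rule pred_F) simp
      have X: "?X \<in> measurable (incr_algebra l ?u) (borel \<Otimes>\<^sub>M borel)"
        by measurable
      let ?A = "{w \<in> space ((borel \<Otimes>\<^sub>M borel) \<Otimes>\<^sub>M borel). fst (fst w) = (1::real) \<and> snd (fst w) + snd w \<le> x}"
      have A: "?A \<in> sets ((borel \<Otimes>\<^sub>M borel) \<Otimes>\<^sub>M borel)"
        by measurable
      have "?Lj j = {\<omega>\<in>space M. (?X \<omega>, B r \<omega> - B ?u \<omega>) \<in> ?A}"
        by (auto simp: W_def S_def space_pair_measure)
      moreover have "?Rj j = {\<omega>\<in>space M. (?X \<omega>, - (B r \<omega> - B ?u \<omega>)) \<in> ?A}"
        by (auto simp: W_def S_def space_pair_measure)
      ultimately show ?thesis
        using prob_reflect_after[OF lr(1) u lr(3) X A] by simp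
    qed
    have "prob (?L n) = (\<Sum>j\<in>{..2 ^ n}. prob (?Lj j))"
      unfolding L using ev disj by (intro finite_measure_finite_Union) auto
    also have "\<dots> = (\<Sum>j\<in>{..2 ^ n}. prob (?Rj j))"
      using eq by (intro sum.cong) auto
    also have "\<dots> = prob (?R n)"
      unfolding R using ev disj by (intro finite_measure_finite_Union[symmetric]) auto
    finally have "prob (?L n) = prob (?R n)" .
    moreover have "?L n \<in> events" unfolding L using ev by (intro sets.finite_UN) auto
    moreover have "?R n \<in> events" unfolding R using ev by (intro sets.finite_UN) auto
    ultimately show ?thesis by simp
  qed
  have cont: "continuous_on {l..r} (\<lambda>s. B s \<omega>)" if "\<omega> \<in> space M" for \<omega>
    using that lr by (intro continuous_B) auto
  have lr': "l \<le> r" using lr by simp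
  have E_m: "E n \<omega> \<Longrightarrow> a < m \<omega>" if "\<omega> \<in> space M" for n \<omega>
    using run_max_upper[OF cont[OF that] lr'] t_mem unfolding E_def S_def m_def by force
  have E_Suc: "E n \<omega> \<Longrightarrow> E (Suc n) \<omega>" for n \<omega>
  proof -
    assume "E n \<omega>"
    then obtain k where k: "k \<le> 2 ^ n" "a < S n k \<omega>" by (auto simp: E_def)
    have "t (Suc n) (2 * k) = t n k" by (simp add: t_def)
    then show "E (Suc n) \<omega>" using k unfolding E_def S_def by (intro exI[of _ "2 * k"]) auto
  qed
  have E_mono: "E n' \<omega>" if "E n \<omega>" "n \<le> n'" for n n' \<omega>
    using that(2,1) by (induction n' rule: dec_induct) (auto intro: E_Suc)
  have E_ev: "\<exists>n. E n \<omega>" if w: "\<omega> \<in> space M" "a < m \<omega>" for \<omega>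
  proof (rule ccontr)
    assume nE: "\<nexists>n. E n \<omega>"
    let ?D = "{l + (r - l) * (real k / 2 ^ n) | k n. k \<le> 2 ^ n}"
    have "?D \<subseteq> {l..r}" using t_mem unfolding t_def by auto
    then have cl: "closure ?D = {l..r}"
      using closure_dyadic_grid[OF lr'] closure_minimal[of ?D "{l..r}"] by auto
    have le: "B s \<omega> \<le> a + B l \<omega>" if "s \<in> ?D" for s
      using that nE unfolding E_def S_def t_def by force
    have "B s \<omega> \<le> a + B l \<omega>" if "s \<in> {l..r}" for s
      using continuous_le_on_closure[of ?D "\<lambda>s. B s \<omega>" s "a + B l \<omega>"] cont[OF w(1)] le that unfolding cl by blast
    then have "run_max (\<lambda>s. B s \<omega>) l r \<le> a + B l \<omega>"
      unfolding run_max_le_iff[OF cont[OF w(1)] lr'] by auto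
    with w(2) show False by (simp add: m_def)
  qed
  \<comment> \<open>The overshoot is at most the oscillation of the path over one grid cell, which
    tends to 0 by uniform continuity.\<close>
  have S_lim: "(\<lambda>n. S n (T n \<omega>) \<omega>) \<longlonglongrightarrow> a" if w: "\<omega> \<in> space M" "a < m \<omega>" for \<omega>
  proof (rule LIMSEQ_I)
    fix e :: real assume e: "e > 0"
    have "uniformly_continuous_on {l..r} (\<lambda>s. B s \<omega>)"
      by (rule compact_uniformly_continuous[OF cont[OF w(1)]]) simp
    then obtain d where d: "d > 0" "\<And>s s'. s \<in> {l..r} \<Longrightarrow> s' \<in> {l..r} \<Longrightarrow> dist s' s < d \<Longrightarrow> dist (B s' \<omega>) (B s \<omega>) < e"
      unfolding uniformly_continuous_on_def using e by metis
    obtain n0 where n0: "E n0 \<omega>" using E_ev[OF w] by auto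
    have "(\<lambda>n. (r - l) * (1 / 2 ^ n)) \<longlonglongrightarrow> 0" by real_asymp
    then obtain n1 where n1: "\<And>n. n \<ge> n1 \<Longrightarrow> (r - l) * (1 / 2 ^ n) < d"
      using order_tendstoD(2)[of "\<lambda>n. (r - l) * (1 / 2 ^ n)" 0 sequentially d] d(1) unfolding eventually_sequentially by blast
    show "\<exists>no. \<forall>n\<ge>no. norm (S n (T n \<omega>) \<omega> - a) < e"
    proof (intro exI allI impI)
      fix n assume n: "n \<ge> max n0 n1"
      then have En: "E n \<omega>" using E_mono[OF n0] by simp
      then have F: "F n (T n \<omega>) \<omega>" "T n \<omega> \<le> 2 ^ n" using E_T by auto
      \<comment> \<open>The grid walk starts at 0 \<le> a, so the passage index has a predecessor at
        which the walk is still at most a.\<close>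
      have "S n 0 \<omega> \<le> a" using a by (simp add: S_def t0)
      with F(1) have "T n \<omega> \<noteq> 0" by (auto simp: F_def intro: ccontr)
      then obtain k where k: "T n \<omega> = Suc k" by (cases "T n \<omega>") auto
      have Sk: "S n k \<omega> \<le> a" "a < S n (Suc k) \<omega>" using F(1) unfolding k F_def by auto
      have "t n (Suc k) - t n k = (r - l) * (1 / 2 ^ n)" by (simp add: t_def field_simps)
      then have "dist (t n (Suc k)) (t n k) < d"
        using n1[of n] n t_mono[of k "Suc k" n] by (simp add: dist_real_def)
      then have "dist (B (t n (Suc k)) \<omega>) (B (t n k) \<omega>) < e"
        using F(2) k by (intro d(2) t_mem) auto
      then have "S n (Suc k) \<omega> - S n k \<omega> < e" by (simp add: S_def dist_real_def)
      then show "norm (S n (T n \<omega>) \<omega> - a) < e" using Sk by (simp add: k)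
    qed
  qed
  let ?L' = "{\<omega>\<in>space M. W \<omega> \<le> x \<and> a < m \<omega>}" and ?R' = "{\<omega>\<in>space M. 2 * a - W \<omega> \<le> x \<and> a < m \<omega>}"
  have limL: "(\<lambda>n. prob (?L n)) \<longlonglongrightarrow> prob ?L'"
  proof -
    have "(\<lambda>n. \<integral>\<omega>. indicator (?L n) \<omega> \<partial>M) \<longlonglongrightarrow> (\<integral>\<omega>. (indicator ?L' \<omega> :: real) \<partial>M)"
    proof (rule integral_dominated_convergence[where w = "\<lambda>_. 1"])
      show "AE \<omega> in M. (\<lambda>n. indicator (?L n) \<omega> :: real) \<longlonglongrightarrow> indicator ?L' \<omega>"
      proof (rule AE_I2)
        fix \<omega> assume w: "\<omega> \<in> space M"
        have "\<forall>\<^sub>F n in sequentially. (indicator (?L n) \<omega> :: real) = indicator ?L' \<omega>"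
        proof (cases "a < m \<omega>")
          case True
          then obtain n0 where "E n0 \<omega>" using E_ev[OF w] by auto
          then have "E n \<omega>" if "n \<ge> n0" for n using E_mono that by blast
          then show ?thesis unfolding eventually_sequentially using True w
            by (intro exI[of _ n0]) (auto simp: indicator_def)
        next
          case False
          then show ?thesis using E_m[OF w] by (intro always_eventually allI) (auto simp: indicator_def)
        qed
        then show "(\<lambda>n. indicator (?L n) \<omega> :: real) \<longlonglongrightarrow> indicator ?L' \<omega>"
          by (rule tendsto_eventually)
      qed
      show "(\<lambda>\<omega>. indicator (?L n) \<omega> :: real) \<in> borel_measurable M" for n
        using discrete[of n] by (intro borel_measurable_indicator) auto
      show "(\<lambda>\<omega>. indicator ?L' \<omega> :: real) \<in> borel_measurable M"
        by (intro borel_measurable_indicator) measurable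
      show "AE \<omega> in M. norm (indicator (?L n) \<omega> :: real) \<le> 1" for n
        by (intro AE_I2) (simp add: indicator_def)
    qed simp
    then show ?thesis using discrete by simp
  qed
  have limR: "(\<lambda>n. prob (?R n)) \<longlonglongrightarrow> prob ?R'"
  proof -
    have "(\<lambda>n. \<integral>\<omega>. indicator (?R n) \<omega> \<partial>M) \<longlonglongrightarrow> (\<integral>\<omega>. (indicator ?R' \<omega> :: real) \<partial>M)"
    proof (rule integral_dominated_convergence[where w = "\<lambda>_. 1"])
      \<comment> \<open>The reflected value only converges to 2 a - W, so the indicators can fail to
        converge exactly on this null event.\<close>
      have "AE \<omega> in M. W \<omega> \<noteq> 2 * a - x"
        unfolding W_def using lr by (intro increment_ne)
      then show "AE \<omega> in M. (\<lambda>n. indicator (?R n) \<omega> :: real) \<longlonglongrightarrow> indicator ?R' \<omega>"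
      proof (rule AE_mp, intro AE_I2 impI)
        fix \<omega> assume w: "\<omega> \<in> space M" and ne: "W \<omega> \<noteq> 2 * a - x"
        have "\<forall>\<^sub>F n in sequentially. (indicator (?R n) \<omega> :: real) = indicator ?R' \<omega>"
        proof (cases "a < m \<omega>")
          case True
          then obtain n0 where "E n0 \<omega>" using E_ev[OF w] by auto
          then have E': "\<forall>\<^sub>F n in sequentially. E n \<omega>" unfolding eventually_sequentially using E_mono by blast
          have lim: "(\<lambda>n. 2 * S n (T n \<omega>) \<omega> - W \<omega>) \<longlonglongrightarrow> 2 * a - W \<omega>"
            by (intro tendsto_intros S_lim w True)
          show ?thesis
          proof (cases "2 * a - W \<omega> < x")
            case l: True
            show ?thesis using order_tendstoD(2)[OF lim l] E'
              by eventually_elim (use w True l in \<open>auto simp: indicator_def\<close>)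
          next
            case False
            then have l: "x < 2 * a - W \<omega>" using ne by simp
            show ?thesis using order_tendstoD(1)[OF lim l] E'
              by eventually_elim (use w True l in \<open>auto simp: indicator_def\<close>)
          qed
        next
          case False
          then show ?thesis using E_m[OF w] by (intro always_eventually allI) (auto simp: indicator_def)
        qed
        then show "(\<lambda>n. indicator (?R n) \<omega> :: real) \<longlonglongrightarrow> indicator ?R' \<omega>"
          by (rule tendsto_eventually)
      qed
      show "(\<lambda>\<omega>. indicator (?R n) \<omega> :: real) \<in> borel_measurable M" for n
        using discrete[of n] by (intro borel_measurable_indicator) auto
      show "(\<lambda>\<omega>. indicator ?R' \<omega> :: real) \<in> borel_measurable M"
        by (intro borel_measurable_indicator) measurable
      show "AE \<omega> in M. norm (indicator (?R n) \<omega> :: real) \<le> 1" for n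
        by (intro AE_I2) (simp add: indicator_def)
    qed simp
    then show ?thesis using discrete by simp
  qed
  have "prob ?L' = prob ?R'"
    using LIMSEQ_unique[OF limL] limR discrete by simp
  then show ?thesis by (simp add: W_def m_def)
qed

end

section \<open>Joint law of maximum, its location and the final value\<close>

text \<open>The joint density of first argmax, maximum and final value over an interval of length \<open>T\<close>.\<close>
definition peak_density :: "real \<Rightarrow> real \<Rightarrow> real \<Rightarrow> real \<Rightarrow> real" where
  "peak_density T \<theta> h c =
     (if 0 < \<theta> \<and> \<theta> < T \<and> 0 < h \<and> c < h then 2 * (passage \<theta> h * passage (T - \<theta>) (h - c)) else 0)"

lemma measurable_peak_density [measurable (raw)]:
  assumes [measurable]: "f \<in> borel_measurable N" "g \<in> borel_measurable N" "h \<in> borel_measurable N" "k \<in> borel_measurable N"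
  shows "(\<lambda>w. peak_density (f w) (g w) (h w) (k w)) \<in> borel_measurable N"
  unfolding peak_density_def by measurable

text \<open>Rising to h and descending to c amounts to two successive first passages of levels h and
  h - c; their total level 2 h - c is the one in \<open>max_end_density\<close>.\<close>

lemma nn_integral_peak_density_total:
  assumes T: "T > 0"
  shows "(\<integral>\<^sup>+\<theta>. ennreal (peak_density T \<theta> h c) \<partial>lborel) = ennreal (max_end_density T h c)"
proof (cases "0 < h \<and> c < h")
  case True
  have "(\<integral>\<^sup>+\<theta>. ennreal (peak_density T \<theta> h c) \<partial>lborel)
      = (\<integral>\<^sup>+\<theta>. 2 * (ennreal (passage \<theta> h * passage (T - \<theta>) (h - c)) * indicator {0<..<T} \<theta>) \<partial>lborel)"
    using True by (intro nn_integral_cong) (auto simp: peak_density_def indicator_def ennreal_mult')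
  also have "\<dots> = 2 * (\<integral>\<^sup>+\<theta>\<in>{0<..<T}. ennreal (passage \<theta> h * passage (T - \<theta>) (h - c)) \<partial>lborel)"
    by (rule nn_integral_cmult) simp
  also have "\<dots> = ennreal (max_end_density T h c)"
    using True T by (subst nn_integral_passage_passage(2)) (auto simp: max_end_density_def ennreal_mult')
  finally show ?thesis .
next
  case False
  then have "peak_density T \<theta> h c = 0" for \<theta> by (auto simp: peak_density_def)
  then show ?thesis using False by (auto simp: max_end_density_def)
qed

text \<open>The left side describes paths that have maximum h over [0, u], are at y at time u and
  stay below h until T, where they are at c. Both sides are twice \<open>pass_kill\<close> with a =
  h and b = h - c, after substituting z = h - y.\<close>

lemma nn_integral_peak_density_partial:
  assumes u: "0 < u" "u < T" and c: "c \<le> h"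
  shows "(\<integral>\<^sup>+y. ennreal (max_end_density u h y) * (ennreal (killed (T - u) (h - y) (h - c)) * indicator {..h} y) \<partial>lborel)
    = (\<integral>\<^sup>+\<theta>. ennreal (peak_density T \<theta> h c) * indicator {..u} \<theta> \<partial>lborel)"
proof -
  consider "h \<le> 0" | "c = h" | "0 < h" "c < h" using c by linarith
  then show ?thesis
  proof cases
    case 1
    then show ?thesis by (simp add: max_end_density_def peak_density_def)
  next
    case 2
    then show ?thesis by (simp add: peak_density_def killed_def)
  next
    case 3
    define b where "b = h - c"
    have b: "b > 0" using 3 by (simp add: b_def)
    have "(\<integral>\<^sup>+y. ennreal (max_end_density u h y) * (ennreal (killed (T - u) (h - y) (h - c)) * indicator {..h} y) \<partial>lborel)
      = (\<integral>\<^sup>+z. ennreal (max_end_density u h (h - z)) * (ennreal (killed (T - u) z b) * indicator {..h} (h - z)) \<partial>lborel)"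
      by (subst nn_integral_real_affine[where c = "- 1" and t = h]) (simp_all add: b_def)
    also have "\<dots> = (\<integral>\<^sup>+z. 2 * (ennreal (passage u (h + z) * killed (T - u) z b) * indicator {0..} z) \<partial>lborel)"
    proof (intro nn_integral_cong_AE)
      show "AE z in lborel. ennreal (max_end_density u h (h - z)) * (ennreal (killed (T - u) z b) * indicator {..h} (h - z))
        = 2 * (ennreal (passage u (h + z) * killed (T - u) z b) * indicator {0..} z)"
        using AE_lborel_singleton[of 0]
      proof eventually_elim
        fix z :: real assume z: "z \<noteq> 0"
        show "ennreal (max_end_density u h (h - z)) * (ennreal (killed (T - u) z b) * indicator {..h} (h - z))
          = 2 * (ennreal (passage u (h + z) * killed (T - u) z b) * indicator {0..} z)"
        proof (cases "z > 0")
          case True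
          then have "max_end_density u h (h - z) = 2 * passage u (h + z)"
            using 3 by (simp add: max_end_density_def algebra_simps)
          moreover have "0 \<le> passage u (h + z)" using 3 True u by (intro passage_nonneg) auto
          ultimately show ?thesis using True by (simp add: ennreal_mult' mult.assoc)
        qed (use z in \<open>auto simp: indicator_def\<close>)
      qed
    qed
    also have "\<dots> = 2 * ennreal (pass_kill h b T u)"
      by (subst nn_integral_cmult) (use nn_integral_passage_killed[OF 3(1) b u] in auto)
    also have "\<dots> = (\<integral>\<^sup>+\<theta>. 2 * (ennreal (passage \<theta> h * passage (T - \<theta>) b) * indicator {0<..<u} \<theta>) \<partial>lborel)"
      using nn_integral_passage_passage(1)[OF 3(1) b _ u] u by (subst nn_integral_cmult) auto
    also have "\<dots> = (\<integral>\<^sup>+\<theta>. ennreal (peak_density T \<theta> h c) * indicator {..u} \<theta> \<partial>lborel)"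
    proof (intro nn_integral_cong_AE)
      show "AE \<theta> in lborel. 2 * (ennreal (passage \<theta> h * passage (T - \<theta>) b) * indicator {0<..<u} \<theta>)
        = ennreal (peak_density T \<theta> h c) * indicator {..u} \<theta>"
        using AE_lborel_singleton[of u]
        by eventually_elim (use 3 u in \<open>auto simp: peak_density_def indicator_def ennreal_mult' b_def\<close>)
    qed
    finally show ?thesis .
  qed
qed

section \<open>Law of the maximum and the final value\<close>

context brownian
begin

lemma emeasure_increment:
  assumes "0 \<le> l" "l < r" "r \<le> 1" "A \<in> sets borel"
  shows "emeasure M {\<omega>\<in>space M. B r \<omega> - B l \<omega> \<in> A} = (\<integral>\<^sup>+x\<in>A. ennreal (gauss (r - l) x) \<partial>lborel)"
  using distributed_emeasure[OF distributed_increment[OF assms(1-3)], of A] assms(4)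
  by (simp add: vimage_def Int_def conj_commute)

text \<open>The event that the maximum is at most a is handled by complement: the law of W minus the
  part where the maximum exceeds a, which the reflection principle expresses by the law of W alone.
  The difference of the two Gaussian densities is \<open>killed\<close>.\<close>

lemma distr_max_end:
  assumes lr: "0 \<le> l" "l < r" "r \<le> 1"
  shows "distr M borel (\<lambda>\<omega>. (run_max (\<lambda>s. B s \<omega>) l r - B l \<omega>, B r \<omega> - B l \<omega>))
    = density lborel (\<lambda>(m, y). ennreal (max_end_density (r - l) m y))"
proof (rule measure_eqI_atMost)
  define W where "W \<omega> = B r \<omega> - B l \<omega>" for \<omega>
  define m where "m \<omega> = run_max (\<lambda>s. B s \<omega>) l r - B l \<omega>" for \<omega>
  define s where "s = r - l"
  have s: "s > 0" using lr by (simp add: s_def)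
  have [measurable]: "W \<in> borel_measurable M"
    unfolding W_def using lr by (intro borel_measurable_diff measurable_B) auto
  have [measurable]: "m \<in> borel_measurable M"
    unfolding m_def using lr measurable_incr_algebra_imp[OF measurable_run_max[of l l r r]] by auto
  have mW: "0 \<le> m \<omega>" "W \<omega> \<le> m \<omega>" if "\<omega> \<in> space M" for \<omega>
    using run_max_ge_self[OF continuous_B[OF that lr(1,3)]] lr by (auto simp: m_def W_def)
  show "finite_measure (distr M borel (\<lambda>\<omega>. (run_max (\<lambda>s. B s \<omega>) l r - B l \<omega>, B r \<omega> - B l \<omega>)))"
    unfolding W_def[symmetric] m_def[symmetric] by (intro finite_measure_distr) measurable
  fix ax :: "real \<times> real"
  obtain a x where ax: "ax = (a, x)" by (cases ax)
  \<comment> \<open>Since W never exceeds the maximum m, lowering x to min x a does not change the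
    event m \<le> a, W \<le> x.\<close>
  define x' where "x' = min x a"
  have rhs: "emeasure (density lborel (\<lambda>(m, y). ennreal (max_end_density s m y))) {..ax}
     = (\<integral>\<^sup>+y\<in>{..x'}. ennreal (killed s a (a - y)) \<partial>lborel) * indicator {0..} a"
  proof -
    have dm: "(\<lambda>(m, y). ennreal (max_end_density s m y)) \<in> borel_measurable borel"
      unfolding borel_prod[symmetric] by measurable
    have "emeasure (density lborel (\<lambda>(m, y). ennreal (max_end_density s m y))) {..ax}
      = (\<integral>\<^sup>+p. (case p of (m, y) \<Rightarrow> ennreal (max_end_density s m y)) * indicator {..ax} p \<partial>lborel)"
      using dm by (intro emeasure_density) simp_all
    also have "\<dots> = (\<integral>\<^sup>+p. (case p of (m, y) \<Rightarrow> ennreal (max_end_density s m y)) * indicator {..ax} p \<partial>(lborel \<Otimes>\<^sub>M lborel))"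
      by (simp only: lborel_prod)
    also have "\<dots> = (\<integral>\<^sup>+y. \<integral>\<^sup>+m. ennreal (max_end_density s m y) * indicator {..ax} (m, y) \<partial>lborel \<partial>lborel)"
      using dm by (subst lborel_pair.nn_integral_snd[symmetric]) (simp_all add: lborel_prod borel_measurable_times_ennreal)
    also have "\<dots> = (\<integral>\<^sup>+y. indicator {..x} y * (\<integral>\<^sup>+m. ennreal (max_end_density s m y) * indicator {..a} m \<partial>lborel) \<partial>lborel)"
      by (intro nn_integral_cong, subst nn_integral_cmult[symmetric])
         (auto intro!: nn_integral_cong simp: ax indicator_def less_eq_prod_def)
    also have "\<dots> = (\<integral>\<^sup>+y. ennreal (killed s a (a - y)) * indicator {..x'} y * indicator {0..} a \<partial>lborel)"
      unfolding nn_integral_max_end_density[OF s]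
      by (intro nn_integral_cong) (auto simp: indicator_def x'_def)
    also have "\<dots> = (\<integral>\<^sup>+y\<in>{..x'}. ennreal (killed s a (a - y)) \<partial>lborel) * indicator {0..} a"
      by (rule nn_integral_multc) measurable
    finally show ?thesis .
  qed
  have lhs: "emeasure (distr M borel (\<lambda>\<omega>. (m \<omega>, W \<omega>))) {..ax} = emeasure M {\<omega>\<in>space M. m \<omega> \<le> a \<and> W \<omega> \<le> x}"
    by (subst emeasure_distr) (auto intro!: arg_cong[where f = "emeasure M"] simp: ax less_eq_prod_def)
  show "emeasure (distr M borel (\<lambda>\<omega>. (run_max (\<lambda>s. B s \<omega>) l r - B l \<omega>, B r \<omega> - B l \<omega>))) {..ax}
    = emeasure (density lborel (\<lambda>(m, y). ennreal (max_end_density (r - l) m y))) {..ax}"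
    unfolding W_def[symmetric] m_def[symmetric] s_def[symmetric] lhs rhs
  proof (cases "0 \<le> a")
    case False
    then have "{\<omega>\<in>space M. m \<omega> \<le> a \<and> W \<omega> \<le> x} = {}" using mW by force
    then show "emeasure M {\<omega>\<in>space M. m \<omega> \<le> a \<and> W \<omega> \<le> x}
      = (\<integral>\<^sup>+y\<in>{..x'}. ennreal (killed s a (a - y)) \<partial>lborel) * indicator {0..} a"
      using False by (simp only: emeasure_empty) simp
  next
    case a: True
    let ?Q = "{\<omega>\<in>space M. m \<omega> \<le> a \<and> W \<omega> \<le> x}"
    let ?K = "\<integral>\<^sup>+y\<in>{..x'}. ennreal (killed s a (a - y)) \<partial>lborel"
    let ?G = "\<integral>\<^sup>+y\<in>{..x'}. ennreal (gauss s (2 * a - y)) \<partial>lborel"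
    have "AE \<omega> in M. W \<omega> \<noteq> a"
      unfolding W_def using lr by (intro increment_ne)
    \<comment> \<open>Because x' \<le> a, the reflected event forces W \<ge> a, and outside the null
      event W = a this already gives m > a.\<close>
    then have "AE \<omega> in M. (2 * a - W \<omega> \<le> x' \<and> a < m \<omega>) \<longleftrightarrow> W \<omega> \<in> {2 * a - x'..}"
    proof (rule AE_mp, intro AE_I2 impI)
      fix \<omega> assume "\<omega> \<in> space M" "W \<omega> \<noteq> a"
      then show "(2 * a - W \<omega> \<le> x' \<and> a < m \<omega>) \<longleftrightarrow> W \<omega> \<in> {2 * a - x'..}"
        using mW[of \<omega>] by (auto simp: x'_def)
    qed
    then have "emeasure M {\<omega>\<in>space M. 2 * a - W \<omega> \<le> x' \<and> a < m \<omega>} = emeasure M {\<omega>\<in>space M. W \<omega> \<in> {2 * a - x'..}}"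
      by (intro emeasure_eq_AE) auto
    also have "\<dots> = (\<integral>\<^sup>+w\<in>{2 * a - x'..}. ennreal (gauss s w) \<partial>lborel)"
      unfolding W_def s_def using lr by (intro emeasure_increment) auto
    also have "\<dots> = ?G"
      by (subst nn_integral_real_affine[where c = "- 1" and t = "2 * a"])
         (auto intro!: nn_integral_cong simp: indicator_def)
    finally have "emeasure M {\<omega>\<in>space M. 2 * a - W \<omega> \<le> x' \<and> a < m \<omega>} = ?G" .
    moreover have "emeasure M {\<omega>\<in>space M. W \<omega> \<le> x' \<and> a < m \<omega>} = emeasure M {\<omega>\<in>space M. 2 * a - W \<omega> \<le> x' \<and> a < m \<omega>}"
      unfolding emeasure_eq_measure W_def m_def using reflection[OF lr a, of x'] by simp
    ultimately have G: "emeasure M {\<omega>\<in>space M. W \<omega> \<le> x' \<and> a < m \<omega>} = ?G" by simp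
    have "emeasure M {\<omega>\<in>space M. W \<omega> \<in> {..x'}} = emeasure M ({\<omega>\<in>space M. W \<omega> \<le> x' \<and> a < m \<omega>} \<union> ?Q)"
      using mW by (intro arg_cong[where f = "emeasure M"]) (force simp: x'_def)
    also have "\<dots> = ?G + emeasure M ?Q"
      unfolding G[symmetric] by (rule plus_emeasure[symmetric]) auto
    finally have 1: "emeasure M {\<omega>\<in>space M. W \<omega> \<in> {..x'}} = ?G + emeasure M ?Q" .
    have "emeasure M {\<omega>\<in>space M. W \<omega> \<in> {..x'}} = (\<integral>\<^sup>+y\<in>{..x'}. ennreal (gauss s y) \<partial>lborel)"
      unfolding W_def s_def using lr by (intro emeasure_increment) auto
    also have "\<dots> = (\<integral>\<^sup>+y. ennreal (gauss s (2 * a - y)) * indicator {..x'} y + ennreal (killed s a (a - y)) * indicator {..x'} y \<partial>lborel)"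
    proof (intro nn_integral_cong)
      fix y
      have "ennreal (gauss s (2 * a - y)) + ennreal (killed s a (a - y)) = ennreal (gauss s y)" if "y \<le> x'"
      proof -
        have "0 \<le> killed s a (a - y)" using that a s by (intro killed_nonneg) (auto simp: x'_def)
        moreover have "gauss s (2 * a - y) + killed s a (a - y) = gauss s y" by (simp add: killed_def)
        ultimately show ?thesis using s by (simp flip: ennreal_plus)
      qed
      then show "ennreal (gauss s y) * indicator {..x'} y
        = ennreal (gauss s (2 * a - y)) * indicator {..x'} y + ennreal (killed s a (a - y)) * indicator {..x'} y"
        by (auto simp: indicator_def)
    qed
    also have "\<dots> = ?G + ?K"
      by (rule nn_integral_add) measurable
    finally have 2: "emeasure M {\<omega>\<in>space M. W \<omega> \<in> {..x'}} = ?G + ?K" .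
    \<comment> \<open>Finiteness permits cancelling the common part in
      \<open>ennreal\<close>.\<close>
    have "?G \<noteq> \<top>" unfolding G[symmetric] by simp
    then have "emeasure M ?Q = ?K" using 1 2 by (simp add: ennreal_add_left_cancel)
    then show "emeasure M ?Q = ?K * indicator {0..} a" using a by simp
  qed
qed simp_all

text \<open>Independence of adjacent segments in Fubini form. Every split below, at u for the law of
  the argmax and at t for the moments, goes through it.\<close>

lemma nn_integral_two_parts:
  fixes X :: "'a \<Rightarrow> 'b :: euclidean_space" and Y :: "'a \<Rightarrow> 'c :: euclidean_space"
  assumes lur: "0 \<le> l" "l \<le> u" "u \<le> r" "r \<le> 1"
    and X: "X \<in> borel_measurable (incr_algebra l u)" and Y: "Y \<in> borel_measurable (incr_algebra u r)"
    and [measurable]: "f \<in> borel_measurable borel" "g \<in> borel_measurable borel"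
    and f: "distr M borel X = density lborel f" and g: "distr M borel Y = density lborel g"
    and F[measurable]: "F \<in> borel_measurable (borel \<Otimes>\<^sub>M borel)"
  shows "(\<integral>\<^sup>+\<omega>. F (X \<omega>, Y \<omega>) \<partial>M) = (\<integral>\<^sup>+x. f x * (\<integral>\<^sup>+y. g y * F (x, y) \<partial>lborel) \<partial>lborel)"
proof -
  have [measurable]: "X \<in> borel_measurable M" "Y \<in> borel_measurable M"
    using measurable_incr_algebra_imp[OF X] measurable_incr_algebra_imp[OF Y] lur by auto
  have "prob_space (distr M borel Y)" by (rule prob_space_distr) measurable
  then interpret Y: prob_space "density lborel g" unfolding g .
  have "(\<integral>\<^sup>+\<omega>. F (X \<omega>, Y \<omega>) \<partial>M) = (\<integral>\<^sup>+z. F z \<partial>distr M (borel \<Otimes>\<^sub>M borel) (\<lambda>\<omega>. (X \<omega>, Y \<omega>)))"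
    by (rule nn_integral_distr[symmetric]) measurable
  also have "\<dots> = (\<integral>\<^sup>+z. F z \<partial>(density lborel f \<Otimes>\<^sub>M density lborel g))"
    unfolding distr_pair_incr_algebra[OF lur X Y] f g ..
  also have "\<dots> = (\<integral>\<^sup>+x. \<integral>\<^sup>+y. F (x, y) \<partial>density lborel g \<partial>density lborel f)"
    by (subst Y.nn_integral_fst[symmetric]) auto
  also have "\<dots> = (\<integral>\<^sup>+x. f x * (\<integral>\<^sup>+y. F (x, y) \<partial>density lborel g) \<partial>lborel)"
    by (subst nn_integral_density) (auto intro!: Y.borel_measurable_nn_integral)
  also have "\<dots> = (\<integral>\<^sup>+x. f x * (\<integral>\<^sup>+y. g y * F (x, y) \<partial>lborel) \<partial>lborel)"
    by (subst nn_integral_density) auto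
  finally show ?thesis .
qed

end

section \<open>Iterated Lebesgue integrals and translations\<close>

lemma nn_integral_lborel_pair:
  fixes f :: "'a :: euclidean_space \<times> 'b :: euclidean_space \<Rightarrow> ennreal"
  assumes f: "f \<in> borel_measurable (borel \<Otimes>\<^sub>M borel)"
  shows nn_integral_lborel_fst: "(\<integral>\<^sup>+p. f p \<partial>lborel) = (\<integral>\<^sup>+x. \<integral>\<^sup>+y. f (x, y) \<partial>lborel \<partial>lborel)"
    and nn_integral_lborel_snd: "(\<integral>\<^sup>+p. f p \<partial>lborel) = (\<integral>\<^sup>+y. \<integral>\<^sup>+x. f (x, y) \<partial>lborel \<partial>lborel)"
proof -
  have f': "f \<in> borel_measurable (lborel \<Otimes>\<^sub>M lborel)" using f by (simp add: lborel_prod borel_prod)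
  show "(\<integral>\<^sup>+p. f p \<partial>lborel) = (\<integral>\<^sup>+x. \<integral>\<^sup>+y. f (x, y) \<partial>lborel \<partial>lborel)"
    unfolding lborel_prod[symmetric] by (rule lborel.nn_integral_fst[symmetric, OF f'])
  show "(\<integral>\<^sup>+p. f p \<partial>lborel) = (\<integral>\<^sup>+y. \<integral>\<^sup>+x. f (x, y) \<partial>lborel \<partial>lborel)"
    unfolding lborel_prod[symmetric] by (rule lborel_pair.nn_integral_snd[symmetric, OF f'])
qed

lemma nn_integral_lborel_swap:
  fixes f :: "'a :: euclidean_space \<Rightarrow> 'b :: euclidean_space \<Rightarrow> ennreal"
  assumes f: "(\<lambda>(x, y). f x y) \<in> borel_measurable (borel \<Otimes>\<^sub>M borel)"
  shows "(\<integral>\<^sup>+x. \<integral>\<^sup>+y. f x y \<partial>lborel \<partial>lborel) = (\<integral>\<^sup>+y. \<integral>\<^sup>+x. f x y \<partial>lborel \<partial>lborel)"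
  using nn_integral_lborel_fst[OF f] nn_integral_lborel_snd[OF f] by simp

lemma nn_integral_lborel_shift:
  fixes f :: "'a :: euclidean_space \<Rightarrow> ennreal"
  assumes [measurable]: "f \<in> borel_measurable borel"
  shows "(\<integral>\<^sup>+x. f (t + x) \<partial>lborel) = (\<integral>\<^sup>+x. f x \<partial>lborel)"
proof -
  have "(\<integral>\<^sup>+x. f x \<partial>lborel) = (\<integral>\<^sup>+x. f x \<partial>distr lborel borel ((+) t))"
    by (simp add: lborel_distr_plus)
  also have "\<dots> = (\<integral>\<^sup>+x. f (t + x) \<partial>lborel)" by (rule nn_integral_distr) auto
  finally show ?thesis ..
qed

lemma max_end_density_part_measurable [measurable]:
  "(\<lambda>(m, y). ennreal (max_end_density s m y)) \<in> borel_measurable borel"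
  unfolding borel_prod[symmetric] by measurable

lemma peak_density_part_measurable [measurable]:
  "(\<lambda>(\<theta>, h, c). ennreal (peak_density T \<theta> h c)) \<in> borel_measurable borel"
  unfolding borel_prod[symmetric] by measurable

section \<open>Law of the argmax, the maximum and the final value\<close>

context brownian
begin

lemma measurable_max_end:
  assumes "0 \<le> l" "l < r" "r \<le> 1"
  shows "(\<lambda>\<omega>. (run_max (\<lambda>s. B s \<omega>) l r - B l \<omega>, B r \<omega> - B l \<omega>)) \<in> borel_measurable (incr_algebra l r)"
  using assms by (intro borel_measurable_Pair measurable_run_max measurable_increment_from_start) auto

lemma measurable_peak:
  assumes "0 \<le> l" "l < r" "r \<le> 1"
  shows "(\<lambda>\<omega>. (run_argmax (\<lambda>s. B s \<omega>) l r - l, run_max (\<lambda>s. B s \<omega>) l r - B l \<omega>, B r \<omega> - B l \<omega>))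
    \<in> borel_measurable (incr_algebra l r)"
proof -
  have [measurable]: "(\<lambda>\<omega>. run_argmax (\<lambda>s. B s \<omega>) l r) \<in> borel_measurable (incr_algebra l r)"
    using assms by (intro measurable_run_argmax) auto
  show ?thesis
    using assms by (intro borel_measurable_Pair measurable_max_end) measurable
qed

text \<open>An argmax at the left end would make the relative maximum 0, so this rules out an atom
  of the argmax there.\<close>

lemma AE_run_max_pos:
  assumes lr: "0 \<le> l" "l < r" "r \<le> 1"
  shows "AE \<omega> in M. 0 < run_max (\<lambda>s. B s \<omega>) l r - B l \<omega>"
proof -
  have [measurable]: "(\<lambda>\<omega>. (run_max (\<lambda>s. B s \<omega>) l r - B l \<omega>, B r \<omega> - B l \<omega>)) \<in> borel_measurable M"
    using measurable_incr_algebra_imp[OF measurable_max_end[OF lr]] lr by auto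
  have "AE p in density lborel (\<lambda>(m, y). ennreal (max_end_density (r - l) m y)). 0 < fst p"
    by (subst AE_density, measurable) (auto simp: max_end_density_def split: if_splits)
  then have "AE p in distr M borel (\<lambda>\<omega>. (run_max (\<lambda>s. B s \<omega>) l r - B l \<omega>, B r \<omega> - B l \<omega>)). 0 < fst p"
    by (simp only: distr_max_end[OF lr])
  then show ?thesis
    using borel_open[OF open_Collect_less[of "\<lambda>_ :: real \<times> real. 0 :: real" fst]]
    by (subst (asm) AE_distr_iff) (auto simp: continuous_intros)
qed

text \<open>Distribution functions are compared. Only 0 < u < T is substantial: the interval is cut
  at l + u, and the condition on the argmax becomes a comparison of the maxima of the two
  independent parts.\<close>

lemma distr_peak:
  assumes lr: "0 \<le> l" "l < r" "r \<le> 1"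
  shows "distr M borel (\<lambda>\<omega>. (run_argmax (\<lambda>s. B s \<omega>) l r - l, run_max (\<lambda>s. B s \<omega>) l r - B l \<omega>, B r \<omega> - B l \<omega>))
    = density lborel (\<lambda>(\<theta>, h, c). ennreal (peak_density (r - l) \<theta> h c))"
    (is "distr M borel ?X = density lborel ?f")
proof (rule measure_eqI_atMost)
  define T where "T = r - l"
  have T: "T > 0" using lr by (simp add: T_def)
  define W where "W \<omega> = B r \<omega> - B l \<omega>" for \<omega>
  define m where "m \<omega> = run_max (\<lambda>s. B s \<omega>) l r - B l \<omega>" for \<omega>
  define \<tau> where "\<tau> \<omega> = run_argmax (\<lambda>s. B s \<omega>) l r - l" for \<omega>
  have X[measurable]: "?X \<in> borel_measurable M"
    using measurable_incr_algebra_imp[OF measurable_peak[OF lr]] lr by auto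
  have mW[measurable]: "(\<lambda>\<omega>. (m \<omega>, W \<omega>)) \<in> borel_measurable M"
    unfolding m_def W_def using measurable_incr_algebra_imp[OF measurable_max_end[OF lr]] lr by auto
  show "finite_measure (distr M borel ?X)" by (intro finite_measure_distr X)
  fix uax :: "real \<times> real \<times> real"
  obtain u a x where uax: "uax = (u, a, x)" by (cases uax)
  let ?I = "\<lambda>h c. \<integral>\<^sup>+\<theta>. ennreal (peak_density T \<theta> h c) * indicator {..u} \<theta> \<partial>lborel"
  have rhs: "emeasure (density lborel ?f) {..uax} = (\<integral>\<^sup>+h. \<integral>\<^sup>+c. indicator {..a} h * indicator {..x} c * ?I h c \<partial>lborel \<partial>lborel)"
  proof -
    have "emeasure (density lborel ?f) {..uax} = (\<integral>\<^sup>+p. ?f p * indicator {..uax} p \<partial>lborel)"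
      by (rule emeasure_density) auto
    also have "\<dots> = (\<integral>\<^sup>+q. \<integral>\<^sup>+\<theta>. ?f (\<theta>, q) * indicator {..uax} (\<theta>, q) \<partial>lborel \<partial>lborel)"
      by (rule nn_integral_lborel_snd) (auto simp: borel_prod)
    also have "\<dots> = (\<integral>\<^sup>+h. \<integral>\<^sup>+c. \<integral>\<^sup>+\<theta>. ?f (\<theta>, h, c) * indicator {..uax} (\<theta>, h, c) \<partial>lborel \<partial>lborel \<partial>lborel)"
    proof (rule nn_integral_lborel_fst)
      have "(\<lambda>q. \<integral>\<^sup>+\<theta>. ennreal (peak_density (r - l) \<theta> (fst q) (snd q)) * indicator {..u} \<theta> *
          (indicator {..a} (fst q) * indicator {..x} (snd q)) \<partial>lborel) \<in> borel_measurable (borel \<Otimes>\<^sub>M borel)"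
        by measurable
      also have "(\<lambda>q. \<integral>\<^sup>+\<theta>. ennreal (peak_density (r - l) \<theta> (fst q) (snd q)) * indicator {..u} \<theta> *
          (indicator {..a} (fst q) * indicator {..x} (snd q)) \<partial>lborel)
        = (\<lambda>q. \<integral>\<^sup>+\<theta>. ?f (\<theta>, q) * indicator {..uax} (\<theta>, q) \<partial>lborel)"
        by (intro ext nn_integral_cong) (auto simp: uax indicator_def less_eq_prod_def)
      finally show "(\<lambda>q. \<integral>\<^sup>+\<theta>. ?f (\<theta>, q) * indicator {..uax} (\<theta>, q) \<partial>lborel) \<in> borel_measurable (borel \<Otimes>\<^sub>M borel)" .
    qed
    also have "\<dots> = (\<integral>\<^sup>+h. \<integral>\<^sup>+c. indicator {..a} h * indicator {..x} c * ?I h c \<partial>lborel \<partial>lborel)"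
      by (intro nn_integral_cong, subst nn_integral_cmult[symmetric])
         (auto intro!: nn_integral_cong simp: uax indicator_def less_eq_prod_def T_def)
    finally show ?thesis .
  qed
  let ?Q = "{\<omega>\<in>space M. \<tau> \<omega> \<le> u \<and> m \<omega> \<le> a \<and> W \<omega> \<le> x}"
  have lhs: "emeasure (distr M borel ?X) {..uax} = emeasure M ?Q"
    by (subst emeasure_distr)
       (auto intro!: arg_cong[where f = "emeasure M"] simp: uax less_eq_prod_def \<tau>_def m_def W_def)
  have cont: "continuous_on {l..r} (\<lambda>s. B s \<omega>)" if "\<omega> \<in> space M" for \<omega>
    using that lr by (intro continuous_B) auto
  have \<tau>: "0 \<le> \<tau> \<omega>" "\<tau> \<omega> \<le> T" "\<tau> \<omega> = 0 \<Longrightarrow> m \<omega> = 0" if "\<omega> \<in> space M" for \<omega>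
    using run_argmax_mem[OF cont[OF that]] at_run_argmax[OF cont[OF that]] lr
    by (auto simp: \<tau>_def T_def m_def)
  consider "u \<le> 0" | "T \<le> u" | "0 < u" "u < T" by linarith
  then show "emeasure (distr M borel ?X) {..uax} = emeasure (density lborel ?f) {..uax}"
    unfolding lhs rhs
  proof cases
    case 1
    have "?I h c = 0" for h c
    proof -
      have "?I h c = (\<integral>\<^sup>+(\<theta>::real). 0 \<partial>lborel)"
        using 1 by (intro nn_integral_cong) (auto simp: peak_density_def indicator_def)
      then show ?thesis by simp
    qed
    moreover have "AE \<omega> in M. \<not> (\<tau> \<omega> \<le> u \<and> m \<omega> \<le> a \<and> W \<omega> \<le> x)"
      using AE_run_max_pos[OF lr] AE_space
    proof eventually_elim
      case (elim \<omega>)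
      then show ?case using \<tau>[of \<omega>] 1 by (fastforce simp: m_def)
    qed
    then have "emeasure M ?Q = 0"
      by (rule emeasure_eq_0_AE)
    ultimately show "emeasure M ?Q
      = (\<integral>\<^sup>+h. \<integral>\<^sup>+c. indicator {..a} h * indicator {..x} c * ?I h c \<partial>lborel \<partial>lborel)"
      by simp
  next
    case 2
    have "?I h c = ennreal (max_end_density T h c)" for h c
    proof -
      have "?I h c = (\<integral>\<^sup>+\<theta>. ennreal (peak_density T \<theta> h c) \<partial>lborel)"
        using 2 by (intro nn_integral_cong) (auto simp: peak_density_def indicator_def)
      then show ?thesis using nn_integral_peak_density_total[OF T] by simp
    qed
    then have "(\<integral>\<^sup>+h. \<integral>\<^sup>+c. indicator {..a} h * indicator {..x} c * ?I h c \<partial>lborel \<partial>lborel)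
      = (\<integral>\<^sup>+h. \<integral>\<^sup>+c. ennreal (max_end_density T h c) * indicator {..(a, x)} (h, c) \<partial>lborel \<partial>lborel)"
      by (auto intro!: nn_integral_cong simp: indicator_def less_eq_prod_def)
    also have "\<dots> = (\<integral>\<^sup>+p. (case p of (h, c) \<Rightarrow> ennreal (max_end_density T h c)) * indicator {..(a, x)} p \<partial>lborel)"
      by (subst nn_integral_lborel_fst) (auto simp: borel_prod)
    also have "\<dots> = emeasure (density lborel (\<lambda>(h, c). ennreal (max_end_density T h c))) {..(a, x)}"
      by (rule emeasure_density[symmetric]) auto
    also have "\<dots> = emeasure M {\<omega>\<in>space M. m \<omega> \<le> a \<and> W \<omega> \<le> x}"
      using mW unfolding T_def distr_max_end[OF lr, symmetric] m_def W_def
      by (subst emeasure_distr) (auto intro!: arg_cong[where f = "emeasure M"] simp: less_eq_prod_def)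
    also have "{\<omega>\<in>space M. m \<omega> \<le> a \<and> W \<omega> \<le> x} = ?Q"
      using \<tau>(2) 2 by force
    finally show "emeasure M ?Q
      = (\<integral>\<^sup>+h. \<integral>\<^sup>+c. indicator {..a} h * indicator {..x} c * ?I h c \<partial>lborel \<partial>lborel)" ..
  next
    case 3
    define p where "p = l + u"
    have p: "l < p" "p < r" using 3 by (auto simp: p_def T_def)
    have pr: "0 \<le> p" "p \<le> 1" "l \<le> p" "p \<le> r" using p lr by auto
    define X1 where "X1 \<omega> = (run_max (\<lambda>s. B s \<omega>) l p - B l \<omega>, B p \<omega> - B l \<omega>)" for \<omega>
    define X2 where "X2 \<omega> = (run_max (\<lambda>s. B s \<omega>) p r - B p \<omega>, B r \<omega> - B p \<omega>)" for \<omega>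
    let ?g1 = "\<lambda>(m, y). ennreal (max_end_density u m y)" and ?g2 = "\<lambda>(m, y). ennreal (max_end_density (T - u) m y)"
    have d1: "distr M borel X1 = density lborel ?g1" and d2: "distr M borel X2 = density lborel ?g2"
      using distr_max_end[of l p] distr_max_end[of p r] p lr pr by (simp_all add: X1_def[abs_def] X2_def[abs_def] p_def T_def algebra_simps)
    have m1: "X1 \<in> borel_measurable (incr_algebra l p)" and m2: "X2 \<in> borel_measurable (incr_algebra p r)"
      using measurable_max_end[of l p] measurable_max_end[of p r] p lr pr by (simp_all add: X1_def[abs_def] X2_def[abs_def])
    \<comment> \<open>The right part starts at height y relative to B l. Its maximum m' relative to
      that start must be at most m - y for the left maximum m to be the overall one.\<close>
    define F :: "(real \<times> real) \<times> (real \<times> real) \<Rightarrow> ennreal" where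
      "F = (\<lambda>((m, y), (m', y')). indicator {..m - y} m' * (indicator {..a} m * indicator {..x} (y + y')))"
    have F[measurable]: "F \<in> borel_measurable (borel \<Otimes>\<^sub>M borel)"
    proof -
      have "F = (\<lambda>w. if snd (fst w) + fst (snd w) \<le> fst (fst w) \<and> fst (fst w) \<le> a \<and> snd (fst w) + snd (snd w) \<le> x then 1 else 0)"
        by (auto simp: F_def fun_eq_iff indicator_def)
      then show ?thesis unfolding borel_prod[symmetric] by simp
    qed
    let ?k = "\<lambda>m y c. ennreal (killed (T - u) (m - y) (m - c)) * indicator {..m} y"
    have "emeasure M ?Q = (\<integral>\<^sup>+\<omega>. F (X1 \<omega>, X2 \<omega>) \<partial>M)"
    proof -
      have "?Q \<in> events"
        using X unfolding \<tau>_def[symmetric] m_def[symmetric] W_def[symmetric] by (auto simp: borel_prod[symmetric])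
      then have "emeasure M ?Q
        = (\<integral>\<^sup>+\<omega>. indicator ?Q \<omega> \<partial>M)" by simp
      also have "\<dots> = (\<integral>\<^sup>+\<omega>. F (X1 \<omega>, X2 \<omega>) \<partial>M)"
      proof (intro nn_integral_cong)
        fix \<omega> assume w: "\<omega> \<in> space M"
        note sp = run_max_split[OF cont[OF w] pr(3,4)] run_argmax_le_iff[OF cont[OF w] pr(3,4)]
        have "\<tau> \<omega> \<le> u \<longleftrightarrow> run_max (\<lambda>s. B s \<omega>) p r \<le> run_max (\<lambda>s. B s \<omega>) l p"
          using sp(2) by (auto simp: \<tau>_def p_def)
        moreover have "m \<omega> = run_max (\<lambda>s. B s \<omega>) l p - B l \<omega>" if "run_max (\<lambda>s. B s \<omega>) p r \<le> run_max (\<lambda>s. B s \<omega>) l p"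
          using that sp(1) by (simp add: m_def)
        ultimately show "indicator ?Q \<omega> = F (X1 \<omega>, X2 \<omega>)"
          using w by (auto simp: F_def X1_def X2_def indicator_def W_def)
      qed
      finally show ?thesis .
    qed
    also have "\<dots> = (\<integral>\<^sup>+q. ?g1 q * (\<integral>\<^sup>+q'. ?g2 q' * F (q, q') \<partial>lborel) \<partial>lborel)"
      by (rule nn_integral_two_parts[OF lr(1) pr(3,4) lr(3) m1 m2 _ _ d1 d2 F]) auto
    also have "\<dots> = (\<integral>\<^sup>+m. \<integral>\<^sup>+y. ?g1 (m, y) * (\<integral>\<^sup>+q'. ?g2 q' * F ((m, y), q') \<partial>lborel) \<partial>lborel \<partial>lborel)"
    proof (rule nn_integral_lborel_fst)
      have "(\<lambda>q. \<integral>\<^sup>+q'. ?g2 q' * F (q, q') \<partial>lborel) \<in> borel_measurable borel"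
        by measurable
      then have "(\<lambda>q. ?g1 q * (\<integral>\<^sup>+q'. ?g2 q' * F (q, q') \<partial>lborel)) \<in> borel_measurable borel"
        by measurable
      then show "(\<lambda>q. ?g1 q * (\<integral>\<^sup>+q'. ?g2 q' * F (q, q') \<partial>lborel)) \<in> borel_measurable (borel \<Otimes>\<^sub>M borel)"
        unfolding borel_prod .
    qed
    also have "\<dots> = (\<integral>\<^sup>+m. \<integral>\<^sup>+y. \<integral>\<^sup>+c. indicator {..a} m * indicator {..x} c * indicator {..m} c * (?g1 (m, y) * ?k m y c) \<partial>lborel \<partial>lborel \<partial>lborel)"
    proof (intro nn_integral_cong)
      fix m y :: real
      have "(\<integral>\<^sup>+q'. ?g2 q' * F ((m, y), q') \<partial>lborel) = (\<integral>\<^sup>+y'. \<integral>\<^sup>+m'. ?g2 (m', y') * F ((m, y), (m', y')) \<partial>lborel \<partial>lborel)"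
        by (rule nn_integral_lborel_snd) (simp add: borel_prod)
      also have "\<dots> = (\<integral>\<^sup>+y'. indicator {..a} m * indicator {..x} (y + y') *
           (\<integral>\<^sup>+m'. ennreal (max_end_density (T - u) m' y') * indicator {..m - y} m' \<partial>lborel) \<partial>lborel)"
        by (intro nn_integral_cong, subst nn_integral_cmult[symmetric]) (auto simp: F_def mult_ac)
      \<comment> \<open>The final value c = y + y' of the whole path replaces the increment y' of
        the right part; this prepares the translation in the next step.\<close>
      also have "\<dots> = (\<integral>\<^sup>+y'. (\<lambda>c. indicator {..a} m * indicator {..x} c * indicator {..m} c * ?k m y c) (y + y') \<partial>lborel)"
        using 3 by (subst nn_integral_max_end_density) (auto intro!: nn_integral_cong simp: indicator_def algebra_simps)
      also have "\<dots> = (\<integral>\<^sup>+c. indicator {..a} m * indicator {..x} c * indicator {..m} c * ?k m y c \<partial>lborel)"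
        by (rule nn_integral_lborel_shift) measurable
      finally have "(\<integral>\<^sup>+q'. ?g2 q' * F ((m, y), q') \<partial>lborel) = \<dots>" .
      then show "?g1 (m, y) * (\<integral>\<^sup>+q'. ?g2 q' * F ((m, y), q') \<partial>lborel)
        = (\<integral>\<^sup>+c. indicator {..a} m * indicator {..x} c * indicator {..m} c * (?g1 (m, y) * ?k m y c) \<partial>lborel)"
        by (simp add: nn_integral_cmult[symmetric] mult_ac)
    qed
    \<comment> \<open>The position y at the cut becomes the innermost variable, so that
      \<open>nn_integral_peak_density_partial\<close> trades it for the argmax.\<close>
    also have "\<dots> = (\<integral>\<^sup>+m. \<integral>\<^sup>+c. \<integral>\<^sup>+y. indicator {..a} m * indicator {..x} c * indicator {..m} c * (?g1 (m, y) * ?k m y c) \<partial>lborel \<partial>lborel \<partial>lborel)"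
      by (intro nn_integral_cong nn_integral_lborel_swap) simp
    also have "\<dots> = (\<integral>\<^sup>+h. \<integral>\<^sup>+c. indicator {..a} h * indicator {..x} c * ?I h c \<partial>lborel \<partial>lborel)"
    proof (intro nn_integral_cong)
      fix h c :: real
      have "(\<integral>\<^sup>+y. indicator {..a} h * indicator {..x} c * indicator {..h} c * (?g1 (h, y) * ?k h y c) \<partial>lborel)
        = indicator {..a} h * indicator {..x} c * (indicator {..h} c * (\<integral>\<^sup>+y. ?g1 (h, y) * ?k h y c \<partial>lborel))"
        by (subst nn_integral_cmult) (auto simp: mult_ac)
      also have "indicator {..h} c * (\<integral>\<^sup>+y. ?g1 (h, y) * ?k h y c \<partial>lborel) = ?I h c"
      proof (cases "c \<le> h")
        case True
        then show ?thesis using nn_integral_peak_density_partial[OF 3 True] by simp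
      qed (simp add: peak_density_def)
      finally show "(\<integral>\<^sup>+y. indicator {..a} h * indicator {..x} c * indicator {..h} c * (?g1 (h, y) * ?k h y c) \<partial>lborel)
        = indicator {..a} h * indicator {..x} c * ?I h c" .
    qed
    finally show "emeasure M ?Q
      = (\<integral>\<^sup>+h. \<integral>\<^sup>+c. indicator {..a} h * indicator {..x} c * ?I h c \<partial>lborel \<partial>lborel)" .
  qed
qed simp_all

end

section \<open>Moments of the gap below the maximum\<close>

text \<open>The densities are computed in the order (\<theta>, h, c), whereas the conditioning
  triple has the order (c, \<theta>, h).\<close>

lemma nn_integral_lborel_rotate:
  fixes F :: "real \<times> real \<times> real \<Rightarrow> ennreal"
  assumes F[measurable]: "F \<in> borel_measurable borel"
  shows "(\<integral>\<^sup>+(\<theta>, h, c). F (c, \<theta>, h) \<partial>lborel) = (\<integral>\<^sup>+p. F p \<partial>lborel)"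
proof -
  have m1: "(\<lambda>(\<theta>, h, c). F (c, \<theta>, h)) \<in> borel_measurable (borel \<Otimes>\<^sub>M borel)"
    using F unfolding borel_prod[symmetric] by (simp add: split_beta')
  have m2: "(\<lambda>(c, q). F (c, q)) \<in> borel_measurable (borel \<Otimes>\<^sub>M borel)"
    using F unfolding borel_prod[symmetric] by (simp add: split_beta')
  have "(\<integral>\<^sup>+(\<theta>, h, c). F (c, \<theta>, h) \<partial>lborel) = (\<integral>\<^sup>+\<theta>. \<integral>\<^sup>+(h, c). F (c, \<theta>, h) \<partial>lborel \<partial>lborel)"
    by (subst nn_integral_lborel_fst[OF m1]) simp
  also have "\<dots> = (\<integral>\<^sup>+\<theta>. \<integral>\<^sup>+c. \<integral>\<^sup>+h. F (c, \<theta>, h) \<partial>lborel \<partial>lborel \<partial>lborel)"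
    by (intro nn_integral_cong, subst nn_integral_lborel_snd) (simp_all add: split_beta')
  also have "\<dots> = (\<integral>\<^sup>+c. \<integral>\<^sup>+\<theta>. \<integral>\<^sup>+h. F (c, \<theta>, h) \<partial>lborel \<partial>lborel \<partial>lborel)"
    by (rule nn_integral_lborel_swap) simp
  also have "\<dots> = (\<integral>\<^sup>+c. \<integral>\<^sup>+q. F (c, q) \<partial>lborel \<partial>lborel)"
    by (intro nn_integral_cong, subst nn_integral_lborel_fst) (simp_all add: borel_prod)
  also have "\<dots> = (\<integral>\<^sup>+p. F p \<partial>lborel)"
    by (subst nn_integral_lborel_fst) (simp_all add: borel_prod)
  finally show ?thesis .
qed

text \<open>By Brownian scaling these are the moments at relative time s of a meander of length T
  ending at b. The orders meant are 1 and 2, the else-branch being the second moment.\<close>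

definition meander_moment :: "nat \<Rightarrow> real \<Rightarrow> real \<Rightarrow> real \<Rightarrow> real" where
  "meander_moment j T s b = (if j = 1 then sqrt T * M1 s (b / sqrt T) else T * M2 s (b / sqrt T))"

text \<open>The conditional moments of \<open>h - B t\<close>.\<close>
definition gap_moment :: "nat \<Rightarrow> real \<Rightarrow> real \<Rightarrow> real \<Rightarrow> real \<Rightarrow> real" where
  "gap_moment j t \<theta> h c =
     (if t < \<theta> then meander_moment j \<theta> ((\<theta> - t) / \<theta>) h
      else meander_moment j (1 - \<theta>) ((t - \<theta>) / (1 - \<theta>)) (h - c))"

lemma erf_nonneg: "0 \<le> z \<Longrightarrow> 0 \<le> erf z"
  using DERIV_nonneg_imp_nondecreasing[of 0 z erf] DERIV_erf[OF DERIV_ident] by fastforce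

lemma M1_nonneg:
  assumes "0 \<le> s" "s \<le> 1" "0 \<le> y"
  shows "0 \<le> M1 s y"
proof -
  have "0 \<le> y * sqrt s / sqrt (2 * (1 - s))" using assms by simp
  then have "0 \<le> 1 / y * (1 - s + s * y\<^sup>2) * erf (y * sqrt s / sqrt (2 * (1 - s)))"
    using assms by (intro mult_nonneg_nonneg erf_nonneg) auto
  then show ?thesis unfolding M1_def using assms
    by (simp add: add_nonneg_nonneg)
qed

lemma M2_nonneg: "0 \<le> s \<Longrightarrow> s \<le> 1 \<Longrightarrow> 0 \<le> M2 s y"
  by (simp add: M2_def)

lemma meander_moment_nonneg:
  "0 \<le> T \<Longrightarrow> 0 \<le> s \<Longrightarrow> s \<le> 1 \<Longrightarrow> 0 \<le> b \<Longrightarrow> 0 \<le> meander_moment j T s b"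
  by (simp add: meander_moment_def M1_nonneg M2_nonneg)

lemma measurable_M1 [measurable (raw)]:
  assumes [measurable]: "f \<in> borel_measurable N" "g \<in> borel_measurable N"
  shows "(\<lambda>w. M1 (f w) (g w)) \<in> borel_measurable N"
proof -
  have [measurable]: "erf \<in> borel_measurable borel"
    by (intro borel_measurable_continuous_onI continuous_intros)
  show ?thesis unfolding M1_def by measurable
qed

lemma measurable_gap_moment [measurable (raw)]:
  assumes [measurable]: "f \<in> borel_measurable N" "g \<in> borel_measurable N" "k \<in> borel_measurable N"
  shows "(\<lambda>w. gap_moment j t (f w) (g w) (k w)) \<in> borel_measurable N"
  unfolding gap_moment_def meander_moment_def M2_def by measurable

lemma nn_integral_meander_moment:
  assumes "r > 0" "s > 0" "b > 0" "j = 1 \<or> j = 2"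
  shows "(\<integral>\<^sup>+z\<in>{0..}. ennreal (z ^ j * (killed r b z * passage s z)) \<partial>lborel)
    = ennreal (passage (r + s) b * meander_moment j (r + s) (s / (r + s)) b)"
  using nn_integral_killed_passage[OF assms(1-3)] assms(4) by (auto simp: meander_moment_def)

text \<open>With x = B(t), staying below h up to time t contributes \<open>killed\<close>, and the
  peak over [t, 1] has height h - x above x. The descent from the peak does not depend on x and
  factors out, so that in z = h - x a meander integral of length \<theta> remains.\<close>

lemma nn_integral_gap_before:
  assumes t: "0 < t" "t < 1" and j: "j = 1 \<or> j = 2"
  shows "(\<integral>\<^sup>+x. (ennreal (killed t h (h - x)) * indicator {0..} h * indicator {..h} x) *
      (ennreal (peak_density (1 - t) (\<theta> - t) (h - x) (c - x)) * ennreal ((h - x) ^ j)) \<partial>lborel)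
    = ennreal (peak_density 1 \<theta> h c) * ennreal (gap_moment j t \<theta> h c) * indicator {t<..} \<theta>"
proof (cases "t < \<theta> \<and> \<theta> < 1 \<and> 0 < h \<and> c < h")
  case False
  then have "killed t h (h - x) = 0 \<or> indicator {0..} h = (0 :: ennreal) \<or> peak_density (1 - t) (\<theta> - t) (h - x) (c - x) = 0" for x
    by (cases "h = 0") (auto simp: peak_density_def killed_def gauss_diff_commute)
  then have "(ennreal (killed t h (h - x)) * indicator {0..} h * indicator {..h} x) *
      (ennreal (peak_density (1 - t) (\<theta> - t) (h - x) (c - x)) * ennreal ((h - x) ^ j)) = 0" for x
    by (metis ennreal_0 mult_zero_left mult_zero_right)
  moreover have "ennreal (peak_density 1 \<theta> h c) * ennreal (gap_moment j t \<theta> h c) * indicator {t<..} \<theta> = 0"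
    using False by (auto simp: peak_density_def indicator_def)
  ultimately show ?thesis by (simp only: nn_integral_const mult_zero_left)
next
  case True
  define p where "p = 2 * passage (1 - \<theta>) (h - c)"
  have p: "0 \<le> p" using True by (simp add: p_def passage_nonneg)
  have "(\<integral>\<^sup>+x. (ennreal (killed t h (h - x)) * indicator {0..} h * indicator {..h} x) *
      (ennreal (peak_density (1 - t) (\<theta> - t) (h - x) (c - x)) * ennreal ((h - x) ^ j)) \<partial>lborel)
    = (\<integral>\<^sup>+z. (ennreal (killed t h z) * indicator {0..} h * indicator {..h} (h - z)) *
      (ennreal (peak_density (1 - t) (\<theta> - t) z (c - (h - z))) * ennreal (z ^ j)) \<partial>lborel)"
    by (subst nn_integral_real_affine[where c = "- 1" and t = h]) simp_all
  also have "\<dots> = (\<integral>\<^sup>+z. ennreal p * (ennreal (z ^ j * (killed t h z * passage (\<theta> - t) z)) * indicator {0..} z) \<partial>lborel)"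
  proof (intro nn_integral_cong)
    fix z :: real
    consider "z < 0" | "z = 0" | "z > 0" by linarith
    then show "(ennreal (killed t h z) * indicator {0..} h * indicator {..h} (h - z)) *
      (ennreal (peak_density (1 - t) (\<theta> - t) z (c - (h - z))) * ennreal (z ^ j))
      = ennreal p * (ennreal (z ^ j * (killed t h z * passage (\<theta> - t) z)) * indicator {0..} z)"
    proof cases
      case 3
      have "peak_density (1 - t) (\<theta> - t) z (c - (h - z)) = p * passage (\<theta> - t) z"
        using True 3 by (simp add: peak_density_def p_def)
      moreover have "0 \<le> killed t h z" "0 \<le> passage (\<theta> - t) z"
        using True 3 t by (auto intro!: killed_nonneg passage_nonneg)
      ultimately show ?thesis
        using 3 True p by (simp add: ennreal_mult' mult_ac)
    qed (use j in \<open>auto simp: peak_density_def\<close>)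
  qed
  also have "\<dots> = ennreal p * ennreal (passage \<theta> h * meander_moment j \<theta> ((\<theta> - t) / \<theta>) h)"
    using nn_integral_meander_moment[of t "\<theta> - t" h j] t True j by (subst nn_integral_cmult) auto
  also have "\<dots> = ennreal (peak_density 1 \<theta> h c) * ennreal (gap_moment j t \<theta> h c) * indicator {t<..} \<theta>"
  proof -
    have "0 \<le> passage \<theta> h" using True t by (intro passage_nonneg) auto
    then show ?thesis
      using True t p by (simp add: peak_density_def gap_moment_def p_def ennreal_mult' mult_ac)
  qed
  finally show ?thesis .
qed

lemma killed_commute: "killed s x z = killed s z x"
  by (simp add: killed_def gauss_diff_commute[of s x z] add.commute)

text \<open>The mirror image: the ascent \<open>passage \<theta> h\<close> factors out, the peak of
  [0, t] has still to descend by z = h - x, and the path over [t, 1] must stay below h. At \<theta>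
  = t both sides vanish, as \<open>peak_density t\<close> does.\<close>

lemma nn_integral_gap_after:
  assumes t: "0 < t" "t < 1" and j: "j = 1 \<or> j = 2" and c: "c \<le> h"
  shows "(\<integral>\<^sup>+x. (ennreal (peak_density t \<theta> h x) * ennreal ((h - x) ^ j)) *
      (ennreal (killed (1 - t) (h - x) (h - c)) * indicator {..h} x) \<partial>lborel)
    = ennreal (peak_density 1 \<theta> h c) * ennreal (gap_moment j t \<theta> h c) * indicator {..<t} \<theta>"
proof (cases "0 < \<theta> \<and> \<theta> < t \<and> 0 < h \<and> c < h")
  case False
  then have "peak_density t \<theta> h x = 0 \<or> killed (1 - t) (h - x) (h - c) = 0" for x
    using c by (cases "c = h") (auto simp: peak_density_def killed_def)
  then have "(ennreal (peak_density t \<theta> h x) * ennreal ((h - x) ^ j)) *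
      (ennreal (killed (1 - t) (h - x) (h - c)) * indicator {..h} x) = 0" for x
    by (metis ennreal_0 mult_zero_left mult_zero_right)
  moreover have "ennreal (peak_density 1 \<theta> h c) * ennreal (gap_moment j t \<theta> h c) * indicator {..<t} \<theta> = 0"
    using False by (auto simp: peak_density_def indicator_def)
  ultimately show ?thesis by (simp only: nn_integral_const mult_zero_left)
next
  case True
  define p where "p = 2 * passage \<theta> h"
  have p: "0 \<le> p" using True by (simp add: p_def passage_nonneg)
  have "(\<integral>\<^sup>+x. (ennreal (peak_density t \<theta> h x) * ennreal ((h - x) ^ j)) *
      (ennreal (killed (1 - t) (h - x) (h - c)) * indicator {..h} x) \<partial>lborel)
    = (\<integral>\<^sup>+z. (ennreal (peak_density t \<theta> h (h - z)) * ennreal (z ^ j)) *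
      (ennreal (killed (1 - t) z (h - c)) * indicator {..h} (h - z)) \<partial>lborel)"
    by (subst nn_integral_real_affine[where c = "- 1" and t = h]) simp_all
  also have "\<dots> = (\<integral>\<^sup>+z. ennreal p * (ennreal (z ^ j * (killed (1 - t) (h - c) z * passage (t - \<theta>) z)) * indicator {0..} z) \<partial>lborel)"
  proof (intro nn_integral_cong)
    fix z :: real
    consider "z < 0" | "z = 0" | "z > 0" by linarith
    then show "(ennreal (peak_density t \<theta> h (h - z)) * ennreal (z ^ j)) *
      (ennreal (killed (1 - t) z (h - c)) * indicator {..h} (h - z))
      = ennreal p * (ennreal (z ^ j * (killed (1 - t) (h - c) z * passage (t - \<theta>) z)) * indicator {0..} z)"
    proof cases
      case 3
      have "peak_density t \<theta> h (h - z) = p * passage (t - \<theta>) z"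
        using True 3 by (simp add: peak_density_def p_def)
      moreover have "0 \<le> killed (1 - t) (h - c) z" "0 \<le> passage (t - \<theta>) z"
        using True 3 t by (auto intro!: killed_nonneg passage_nonneg)
      ultimately show ?thesis
        using 3 True p by (simp add: ennreal_mult' mult_ac killed_commute[of _ z])
    qed (use j in \<open>auto simp: peak_density_def\<close>)
  qed
  also have "\<dots> = ennreal p * ennreal (passage (1 - \<theta>) (h - c) * meander_moment j (1 - \<theta>) ((t - \<theta>) / (1 - \<theta>)) (h - c))"
    using nn_integral_meander_moment[of "1 - t" "t - \<theta>" "h - c" j] t True j by (subst nn_integral_cmult) auto
  also have "\<dots> = ennreal (peak_density 1 \<theta> h c) * ennreal (gap_moment j t \<theta> h c) * indicator {..<t} \<theta>"
  proof -
    have "0 \<le> passage (1 - \<theta>) (h - c)" using True t by (intro passage_nonneg) auto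
    then show ?thesis
      using True t p by (simp add: peak_density_def gap_moment_def p_def ennreal_mult' mult_ac)
  qed
  finally show ?thesis .
qed

text \<open>Integrating out the final value leaves the half-normal density
  \<open>2 * gauss 1 m\<close> of the maximum, whose second moment is finite.\<close>

lemma nn_integral_square_max_end_density:
  "(\<integral>\<^sup>+p. (case p of (m, y) \<Rightarrow> ennreal (max_end_density 1 m y)) * ennreal ((fst p)\<^sup>2) \<partial>lborel) < \<infinity>"
proof -
  have "(\<integral>\<^sup>+p. (case p of (m, y) \<Rightarrow> ennreal (max_end_density 1 m y)) * ennreal ((fst p)\<^sup>2) \<partial>lborel)
    = (\<integral>\<^sup>+m. \<integral>\<^sup>+y. ennreal (max_end_density 1 m y) * ennreal (m\<^sup>2) \<partial>lborel \<partial>lborel)"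
  proof (subst nn_integral_lborel_fst)
    show "(\<lambda>p. (case p of (m, y) \<Rightarrow> ennreal (max_end_density 1 m y)) * ennreal ((fst p)\<^sup>2))
        \<in> borel_measurable (borel \<Otimes>\<^sub>M borel)" by measurable
  qed simp
  also have "\<dots> = (\<integral>\<^sup>+m. 2 * (ennreal (m\<^sup>2 * gauss 1 (m - 0)) * indicator {0..} m) \<partial>lborel)"
  proof (intro nn_integral_cong_AE)
    show "AE m in lborel. (\<integral>\<^sup>+y. ennreal (max_end_density 1 m y) * ennreal (m\<^sup>2) \<partial>lborel)
      = 2 * (ennreal (m\<^sup>2 * gauss 1 (m - 0)) * indicator {0..} m)"
      using AE_lborel_singleton[of 0]
    proof eventually_elim
      fix m :: real assume m: "m \<noteq> 0"
      show "(\<integral>\<^sup>+y. ennreal (max_end_density 1 m y) * ennreal (m\<^sup>2) \<partial>lborel)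
        = 2 * (ennreal (m\<^sup>2 * gauss 1 (m - 0)) * indicator {0..} m)"
      proof (cases "m > 0")
        case True
        have "(\<integral>\<^sup>+y. ennreal (max_end_density 1 m y) \<partial>lborel) = (\<integral>\<^sup>+w. ennreal (max_end_density 1 m (2 * m - w)) \<partial>lborel)"
          by (subst nn_integral_real_affine[where c = "- 1" and t = "2 * m"]) simp_all
        also have "\<dots> = (\<integral>\<^sup>+w. 2 * (ennreal (passage 1 w) * indicator {m..} w) \<partial>lborel)"
        proof (intro nn_integral_cong_AE)
          show "AE w in lborel. ennreal (max_end_density 1 m (2 * m - w)) = 2 * (ennreal (passage 1 w) * indicator {m..} w)"
            using AE_lborel_singleton[of m]
            by eventually_elim (use True in \<open>auto simp: max_end_density_def indicator_def ennreal_mult'\<close>)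
        qed
        also have "\<dots> = 2 * (\<integral>\<^sup>+w\<in>{m..}. ennreal (passage 1 w) \<partial>lborel)"
          by (rule nn_integral_cmult) simp
        also have "(\<integral>\<^sup>+w\<in>{m..}. ennreal (passage 1 w) \<partial>lborel) = ennreal (0 - (- gauss 1 m))"
        proof (rule nn_integral_FTC_atLeast)
          show "((\<lambda>w. - gauss 1 w) has_real_derivative passage 1 x) (at x)" for x
            by (auto intro!: derivative_eq_intros simp: passage_def)
          show "0 \<le> passage 1 x" if "m \<le> x" for x using True that by (simp add: passage_nonneg)
          show "((\<lambda>w. - gauss 1 w) \<longlongrightarrow> 0) at_top" unfolding gauss_def by real_asymp
        qed simp
        finally have "(\<integral>\<^sup>+y. ennreal (max_end_density 1 m y) \<partial>lborel) = 2 * ennreal (gauss 1 m)" by simp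
        then show ?thesis
          using True by (subst nn_integral_multc) (simp_all add: ennreal_mult' mult_ac)
      qed (use m in \<open>auto simp: max_end_density_def indicator_def\<close>)
    qed
  qed
  also have "\<dots> = 2 * (\<integral>\<^sup>+m\<in>{0..}. ennreal (m\<^sup>2 * gauss 1 (m - 0)) \<partial>lborel)"
    by (rule nn_integral_cmult) simp
  also have "(\<integral>\<^sup>+m\<in>{0..}. ennreal (m\<^sup>2 * gauss 1 (m - 0)) \<partial>lborel) = ennreal (0\<^sup>2 + 1 - gmom2 1 0 0)"
  proof (rule nn_integral_FTC_atLeast[where F = "gmom2 1 0"])
    show "(gmom2 1 0 has_real_derivative x\<^sup>2 * gauss 1 (x - 0)) (at x)" for x by (rule DERIV_gmom) simp
    show "(gmom2 1 0 \<longlongrightarrow> 0\<^sup>2 + 1) at_top" by (rule tendsto_gmom) simp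
  qed auto
  finally show ?thesis by (simp add: ennreal_mult_less_top)
qed

section \<open>Square integrability of the supremum, and moments of the gap given the peak\<close>

context brownian
begin

abbreviation peak :: "'a \<Rightarrow> real \<times> real \<times> real" where
  "peak \<omega> \<equiv> (run_argmax (\<lambda>s. B s \<omega>) 0 1, run_max (\<lambda>s. B s \<omega>) 0 1, B 1 \<omega>)"

lemma measurable_run_max_0_1 [measurable]: "(\<lambda>\<omega>. run_max (\<lambda>s. B s \<omega>) 0 1) \<in> borel_measurable M"
proof -
  have "(\<lambda>\<omega>. run_max (\<lambda>s. B s \<omega>) 0 1 - B 0 \<omega>) \<in> borel_measurable M"
    by (rule measurable_incr_algebra_imp[OF measurable_run_max[of 0 0 1 1]]) auto
  then show ?thesis by (rule measurable_cong[THEN iffD1, rotated]) (simp add: B_0)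
qed

lemma measurable_run_argmax_0_1 [measurable]: "(\<lambda>\<omega>. run_argmax (\<lambda>s. B s \<omega>) 0 1) \<in> borel_measurable M"
  by (rule measurable_incr_algebra_imp[OF measurable_run_argmax]) auto

lemma run_max_square_integrable: "(\<integral>\<^sup>+\<omega>. ennreal ((run_max (\<lambda>s. B s \<omega>) 0 1)\<^sup>2) \<partial>M) < \<infinity>"
proof -
  let ?X = "\<lambda>\<omega>. (run_max (\<lambda>s. B s \<omega>) 0 1 - B 0 \<omega>, B 1 \<omega> - B 0 \<omega>)"
  have X: "?X \<in> borel_measurable M"
    using measurable_incr_algebra_imp[OF measurable_max_end[of 0 1]] by simp
  have "(\<integral>\<^sup>+\<omega>. ennreal ((run_max (\<lambda>s. B s \<omega>) 0 1)\<^sup>2) \<partial>M) = (\<integral>\<^sup>+\<omega>. ennreal ((fst (?X \<omega>))\<^sup>2) \<partial>M)"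
    by (intro nn_integral_cong) (simp add: B_0)
  also have "\<dots> = (\<integral>\<^sup>+p. ennreal ((fst p)\<^sup>2) \<partial>distr M borel ?X)"
    using X by (subst nn_integral_distr) (auto simp: borel_prod[symmetric])
  also have "\<dots> = (\<integral>\<^sup>+p. (case p of (m, y) \<Rightarrow> ennreal (max_end_density 1 m y)) * ennreal ((fst p)\<^sup>2) \<partial>lborel)"
    using distr_max_end[of 0 1] by (simp, subst nn_integral_density) (auto simp: borel_prod[symmetric])
  also have "\<dots> < \<infinity>" by (rule nn_integral_square_max_end_density)
  finally show ?thesis .
qed

text \<open>Estimates for the maximum thereby also cover the minimum, as needed for the supremum of
  the absolute value.\<close>

lemma brownian_minus: "brownian M (\<lambda>t \<omega>. - B t \<omega>)"
proof
  show "std_brownian_motion M (\<lambda>t \<omega>. - B t \<omega>)"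
    unfolding std_brownian_motion_def
  proof (intro conjI ballI allI impI)
    show "prob_space M" by unfold_locales
    show "(\<lambda>\<omega>. - B t \<omega>) \<in> borel_measurable M" if "t \<in> {0..1}" for t
      using that by measurable
    show "- B 0 \<omega> = 0" if "\<omega> \<in> space M" for \<omega> using that by (simp add: B_0)
    show "continuous_on {0..1} (\<lambda>t. - B t \<omega>)" if "\<omega> \<in> space M" for \<omega>
      using that by (intro continuous_on_minus continuous_B) auto
    show "distributed M lborel (\<lambda>\<omega>. - B t \<omega> - - B s \<omega>) (\<lambda>x. ennreal (normal_density 0 (sqrt (t - s)) x))"
      if "0 \<le> s" "s < t" "t \<le> 1" for s t
    proof -
      have "distributed M lborel (\<lambda>\<omega>. B t \<omega> - B s \<omega>) (\<lambda>x. ennreal (normal_density 0 (sqrt (t - s)) x))"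
        using distributed_increment[OF that] that by (simp add: gauss_eq_normal_density)
      from normal_density_affine[OF this, of "- 1" 0] show ?thesis using that by (simp add: algebra_simps)
    qed
    fix n :: nat and \<tau> :: "nat \<Rightarrow> real" assume "mono_on {..n} \<tau>" "\<tau> ` {..n} \<subseteq> {0..1}"
    from indep_vars_compose2[OF indep_increments[OF this], where Y = "\<lambda>_. uminus" and N = "\<lambda>_. borel"]
    show "indep_vars (\<lambda>_. borel) (\<lambda>i \<omega>. - B (\<tau> (Suc i)) \<omega> - - B (\<tau> i) \<omega>) {..<n}"
      by simp
  qed
qed

lemma abs_B_le:
  assumes "\<omega> \<in> space M" "s \<in> {0..1}"
  shows "\<bar>B s \<omega>\<bar> \<le> run_max (\<lambda>s. B s \<omega>) 0 1 + run_max (\<lambda>s. - B s \<omega>) 0 1"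
proof -
  have c: "continuous_on {0..1} (\<lambda>s. B s \<omega>)" using assms by (intro continuous_B) auto
  then have c': "continuous_on {0..1} (\<lambda>s. - B s \<omega>)" by (rule continuous_on_minus)
  show ?thesis
    using run_max_upper[OF c _ assms(2)] run_max_upper[OF c, of 0]
      run_max_upper[OF c' _ assms(2)] run_max_upper[OF c', of 0] B_0[OF assms(1)] by auto
qed

text \<open>The absolute value is bounded by the sum of the maxima of B and - B, both nonnegative as
  B starts at 0. The resulting bound is uniform in time, as dominated convergence will
  require.\<close>

lemma sup_square_integrable:
  "\<exists>Z. Z \<in> borel_measurable M \<and> (\<integral>\<^sup>+\<omega>. Z \<omega> \<partial>M) < \<infinity> \<and> (\<forall>\<omega>\<in>space M. \<forall>s\<in>{0..1}. ennreal ((B s \<omega>)\<^sup>2) \<le> Z \<omega>)"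
proof -
  interpret N: brownian M "\<lambda>t \<omega>. - B t \<omega>" by (rule brownian_minus)
  define Z where "Z \<omega> = 2 * ennreal ((run_max (\<lambda>s. B s \<omega>) 0 1)\<^sup>2) + 2 * ennreal ((run_max (\<lambda>s. - B s \<omega>) 0 1)\<^sup>2)" for \<omega>
  have "(\<integral>\<^sup>+\<omega>. Z \<omega> \<partial>M) = 2 * (\<integral>\<^sup>+\<omega>. ennreal ((run_max (\<lambda>s. B s \<omega>) 0 1)\<^sup>2) \<partial>M)
      + 2 * (\<integral>\<^sup>+\<omega>. ennreal ((run_max (\<lambda>s. - B s \<omega>) 0 1)\<^sup>2) \<partial>M)"
    unfolding Z_def by (subst nn_integral_add) (auto simp: nn_integral_cmult)
  also have "\<dots> < \<infinity>"
    using run_max_square_integrable N.run_max_square_integrable by (simp add: ennreal_mult_less_top)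
  finally have "(\<integral>\<^sup>+\<omega>. Z \<omega> \<partial>M) < \<infinity>" .
  moreover have "Z \<in> borel_measurable M" unfolding Z_def by measurable
  moreover have "ennreal ((B s \<omega>)\<^sup>2) \<le> Z \<omega>" if "\<omega> \<in> space M" "s \<in> {0..1}" for \<omega> s
  proof -
    let ?a = "run_max (\<lambda>s. B s \<omega>) 0 1" and ?b = "run_max (\<lambda>s. - B s \<omega>) 0 1"
    have "(B s \<omega>)\<^sup>2 \<le> (?a + ?b)\<^sup>2"
      using abs_B_le[OF that] by (intro power2_le_iff_abs_le[THEN iffD2]) auto
    also have "\<dots> \<le> 2 * ?a\<^sup>2 + 2 * ?b\<^sup>2"
      using sum_squares_bound[of ?a ?b] by (simp add: power2_sum)
    finally have "ennreal ((B s \<omega>)\<^sup>2) \<le> ennreal (2 * ?a\<^sup>2 + 2 * ?b\<^sup>2)" by (rule ennreal_leI)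
    then show ?thesis by (simp add: Z_def ennreal_mult')
  qed
  ultimately show ?thesis by blast
qed

text \<open>The test function \<psi> of the peak encodes conditioning. Cut at t: if the argmax lies
  after t, the overall peak is that of the second segment translated by (t, B t, B t), and the first
  segment only has to stay below it.\<close>

lemma nn_integral_gap_before_argmax:
  assumes t: "0 < t" "t < 1" and j: "j = 1 \<or> j = 2" and \<psi>[measurable]: "\<psi> \<in> borel_measurable borel"
  shows "(\<integral>\<^sup>+\<omega>. ennreal ((run_max (\<lambda>s. B s \<omega>) 0 1 - B t \<omega>) ^ j) * \<psi> (peak \<omega>)
      * indicator {t<..} (run_argmax (\<lambda>s. B s \<omega>) 0 1) \<partial>M)
    = (\<integral>\<^sup>+(\<theta>, h, c). \<psi> (\<theta>, h, c) * (ennreal (peak_density 1 \<theta> h c) * ennreal (gap_moment j t \<theta> h c) * indicator {t<..} \<theta>) \<partial>lborel)"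
proof -
  define X1 where "X1 \<omega> = (run_max (\<lambda>s. B s \<omega>) 0 t - B 0 \<omega>, B t \<omega> - B 0 \<omega>)" for \<omega>
  define X2 where "X2 \<omega> = (run_argmax (\<lambda>s. B s \<omega>) t 1 - t, run_max (\<lambda>s. B s \<omega>) t 1 - B t \<omega>, B 1 \<omega> - B t \<omega>)" for \<omega>
  let ?g1 = "\<lambda>(m, y). ennreal (max_end_density t m y)" and ?g2 = "\<lambda>(\<theta>, h, c). ennreal (peak_density (1 - t) \<theta> h c)"
  have d1: "distr M borel X1 = density lborel ?g1" and d2: "distr M borel X2 = density lborel ?g2"
    using distr_max_end[of 0 t] distr_peak[of t 1] t by (simp_all add: X1_def[abs_def] X2_def[abs_def])
  have m1: "X1 \<in> borel_measurable (incr_algebra 0 t)" and m2: "X2 \<in> borel_measurable (incr_algebra t 1)"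
    using measurable_max_end[of 0 t] measurable_peak[of t 1] t by (simp_all add: X1_def[abs_def] X2_def[abs_def])
  define F :: "(real \<times> real) \<times> (real \<times> real \<times> real) \<Rightarrow> ennreal" where
    "F = (\<lambda>((m, x), (\<theta>', h', c')). ennreal (h' ^ j) * \<psi> (t + \<theta>', x + h', x + c') * indicator {m<..} (x + h'))"
  have F[measurable]: "F \<in> borel_measurable (borel \<Otimes>\<^sub>M borel)"
  proof -
    have "F = (\<lambda>w. ennreal (fst (snd (snd w)) ^ j) * \<psi> (t + fst (snd w), snd (fst w) + fst (snd (snd w)), snd (fst w) + snd (snd (snd w)))
        * (if fst (fst w) < snd (fst w) + fst (snd (snd w)) then 1 else 0))"
      by (auto simp: F_def fun_eq_iff indicator_def)
    moreover have "\<dots> \<in> borel_measurable (borel \<Otimes>\<^sub>M borel)"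
      using \<psi> unfolding borel_prod[symmetric] by measurable
    ultimately show ?thesis by simp
  qed
  have "(\<integral>\<^sup>+\<omega>. ennreal ((run_max (\<lambda>s. B s \<omega>) 0 1 - B t \<omega>) ^ j) * \<psi> (peak \<omega>)
      * indicator {t<..} (run_argmax (\<lambda>s. B s \<omega>) 0 1) \<partial>M) = (\<integral>\<^sup>+\<omega>. F (X1 \<omega>, X2 \<omega>) \<partial>M)"
  proof (intro nn_integral_cong)
    fix \<omega> assume w: "\<omega> \<in> space M"
    have c: "continuous_on {0..1} (\<lambda>s. B s \<omega>)" using w by (intro continuous_B) auto
    note sp = run_max_split[OF c, of t] run_argmax_le_iff[OF c, of t] run_argmax_split[OF c, of t]
    show "ennreal ((run_max (\<lambda>s. B s \<omega>) 0 1 - B t \<omega>) ^ j) * \<psi> (peak \<omega>)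
      * indicator {t<..} (run_argmax (\<lambda>s. B s \<omega>) 0 1) = F (X1 \<omega>, X2 \<omega>)"
    proof (cases "run_max (\<lambda>s. B s \<omega>) t 1 \<le> run_max (\<lambda>s. B s \<omega>) 0 t")
      case True
      then show ?thesis using sp t B_0[OF w] by (simp add: F_def X1_def X2_def)
    next
      case False
      then have "run_max (\<lambda>s. B s \<omega>) 0 1 = run_max (\<lambda>s. B s \<omega>) t 1" "run_argmax (\<lambda>s. B s \<omega>) 0 1 = run_argmax (\<lambda>s. B s \<omega>) t 1"
        "t < run_argmax (\<lambda>s. B s \<omega>) t 1"
        using sp t by (auto simp: max_def not_le[symmetric])
      then show ?thesis using False B_0[OF w] by (simp add: F_def X1_def X2_def)
    qed
  qed
  also have "\<dots> = (\<integral>\<^sup>+q. ?g1 q * (\<integral>\<^sup>+q'. ?g2 q' * F (q, q') \<partial>lborel) \<partial>lborel)"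
    by (rule nn_integral_two_parts[OF _ _ _ _ m1 m2 _ _ d1 d2 F]) (use t in auto)
  also have "\<dots> = (\<integral>\<^sup>+q. \<integral>\<^sup>+p. ?g1 q * (\<psi> p * (?g2 (p - (t, snd q, snd q)) * ennreal ((fst (snd p) - snd q) ^ j)) * indicator {fst q<..} (fst (snd p))) \<partial>lborel \<partial>lborel)"
  proof (intro nn_integral_cong)
    fix q :: "real \<times> real"
    obtain m x where q: "q = (m, x)" by (cases q)
    \<comment> \<open>The integrand in the coordinates p of the overall peak; translation by (t, x,
      x) carries the peak of the second segment to it.\<close>
    define g where "g p = \<psi> p * (?g2 (p - (t, x, x)) * ennreal ((fst (snd p) - x) ^ j)) * indicator {m<..} (fst (snd p))" for p
    have g[measurable]: "g \<in> borel_measurable borel"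
      using \<psi> unfolding g_def borel_prod[symmetric] by (simp add: split_beta' minus_prod_def)
    have "(\<integral>\<^sup>+q'. ?g2 q' * F (q, q') \<partial>lborel) = (\<integral>\<^sup>+q'. g ((t, x, x) + q') \<partial>lborel)"
      by (intro nn_integral_cong) (auto simp: F_def g_def q mult_ac split_beta')
    also have "\<dots> = (\<integral>\<^sup>+p. g p \<partial>lborel)" by (rule nn_integral_lborel_shift) measurable
    finally show "?g1 q * (\<integral>\<^sup>+q'. ?g2 q' * F (q, q') \<partial>lborel)
      = (\<integral>\<^sup>+p. ?g1 q * (\<psi> p * (?g2 (p - (t, snd q, snd q)) * ennreal ((fst (snd p) - snd q) ^ j)) * indicator {fst q<..} (fst (snd p))) \<partial>lborel)"
      using g by (simp add: nn_integral_cmult[symmetric] q) (simp add: g_def)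
  qed
  \<comment> \<open>With the peak p outermost, the inner integral over the first segment carries the
    moment of the gap for that peak.\<close>
  also have "\<dots> = (\<integral>\<^sup>+p. \<integral>\<^sup>+q. ?g1 q * (\<psi> p * (?g2 (p - (t, snd q, snd q)) * ennreal ((fst (snd p) - snd q) ^ j)) * indicator {fst q<..} (fst (snd p))) \<partial>lborel \<partial>lborel)"
  proof (rule nn_integral_lborel_swap)
    have "(\<lambda>w. ennreal (max_end_density t (fst (fst w)) (snd (fst w))) * (\<psi> (fst (snd w), fst (snd (snd w)), snd (snd (snd w)))
       * (ennreal (peak_density (1 - t) (fst (snd w) - t) (fst (snd (snd w)) - snd (fst w)) (snd (snd (snd w)) - snd (fst w)))
         * ennreal ((fst (snd (snd w)) - snd (fst w)) ^ j)) * (if fst (fst w) < fst (snd (snd w)) then 1 else 0)))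
      \<in> borel_measurable (borel \<Otimes>\<^sub>M borel)"
      using \<psi> unfolding borel_prod[symmetric] by measurable
    then show "(\<lambda>(q, p). ?g1 q * (\<psi> p * (?g2 (p - (t, snd q, snd q)) * ennreal ((fst (snd p) - snd q) ^ j)) * indicator {fst q<..} (fst (snd p))))
      \<in> borel_measurable (borel \<Otimes>\<^sub>M borel)"
      by (rule measurable_cong[THEN iffD1, rotated]) (auto simp: indicator_def)
  qed
  also have "\<dots> = (\<integral>\<^sup>+(\<theta>, h, c). \<psi> (\<theta>, h, c) * (ennreal (peak_density 1 \<theta> h c) * ennreal (gap_moment j t \<theta> h c) * indicator {t<..} \<theta>) \<partial>lborel)"
  proof (intro nn_integral_cong)
    fix p :: "real \<times> real \<times> real"
    obtain \<theta> h c where p: "p = (\<theta>, h, c)" by (cases p)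
    let ?r = "\<lambda>x. ennreal (peak_density (1 - t) (\<theta> - t) (h - x) (c - x)) * ennreal ((h - x) ^ j)"
    have "(\<integral>\<^sup>+q. ?g1 q * (\<psi> p * (?g2 (p - (t, snd q, snd q)) * ennreal ((fst (snd p) - snd q) ^ j)) * indicator {fst q<..} (fst (snd p))) \<partial>lborel)
      = (\<integral>\<^sup>+x. \<integral>\<^sup>+m. ennreal (max_end_density t m x) * (\<psi> p * ?r x * indicator {m<..} h) \<partial>lborel \<partial>lborel)"
    proof -
      have "(\<lambda>q. ennreal (max_end_density t (fst q) (snd q)) * (\<psi> p * ?r (snd q) * (if fst q < h then 1 else 0)))
          \<in> borel_measurable (borel \<Otimes>\<^sub>M borel)" by measurable
      then have "(\<lambda>q. ?g1 q * (\<psi> p * (?g2 (p - (t, snd q, snd q)) * ennreal ((fst (snd p) - snd q) ^ j)) * indicator {fst q<..} (fst (snd p))))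
          \<in> borel_measurable (borel \<Otimes>\<^sub>M borel)"
        by (rule measurable_cong[THEN iffD1, rotated]) (auto simp: p indicator_def)
      from nn_integral_lborel_snd[OF this] show ?thesis by (simp add: p)
    qed
    also have "\<dots> = (\<integral>\<^sup>+x. (\<psi> p * ?r x) * (\<integral>\<^sup>+m. ennreal (max_end_density t m x) * indicator {..h} m \<partial>lborel) \<partial>lborel)"
    proof (intro nn_integral_cong, subst nn_integral_cmult[symmetric])
      fix x :: real
      show "(\<integral>\<^sup>+m. ennreal (max_end_density t m x) * (\<psi> p * ?r x * indicator {m<..} h) \<partial>lborel)
        = (\<integral>\<^sup>+m. \<psi> p * ?r x * (ennreal (max_end_density t m x) * indicator {..h} m) \<partial>lborel)"
      proof (intro nn_integral_cong_AE)
        \<comment> \<open>The condition m < h from the argmax and the range m \<le> h of the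
          distribution function differ only at m = h.\<close>
        show "AE m in lborel. ennreal (max_end_density t m x) * (\<psi> p * ?r x * indicator {m<..} h)
          = \<psi> p * ?r x * (ennreal (max_end_density t m x) * indicator {..h} m)"
          using AE_lborel_singleton[of h] by eventually_elim (auto simp: indicator_def mult_ac)
      qed
    qed simp
    also have "\<dots> = (\<integral>\<^sup>+x. \<psi> p * ((ennreal (killed t h (h - x)) * indicator {0..} h * indicator {..h} x) * ?r x) \<partial>lborel)"
      using t by (intro nn_integral_cong, subst nn_integral_max_end_density) (simp_all add: mult_ac)
    also have "\<dots> = \<psi> p * (ennreal (peak_density 1 \<theta> h c) * ennreal (gap_moment j t \<theta> h c) * indicator {t<..} \<theta>)"
      by (subst nn_integral_cmult) (use nn_integral_gap_before[OF t j] in simp_all)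
    finally show "(\<integral>\<^sup>+q. ?g1 q * (\<psi> p * (?g2 (p - (t, snd q, snd q)) * ennreal ((fst (snd p) - snd q) ^ j)) * indicator {fst q<..} (fst (snd p))) \<partial>lborel)
      = (case p of (\<theta>, h, c) \<Rightarrow> \<psi> (\<theta>, h, c) * (ennreal (peak_density 1 \<theta> h c) * ennreal (gap_moment j t \<theta> h c) * indicator {t<..} \<theta>))"
      by (simp add: p)
  qed
  finally show ?thesis .
qed

end

lemma nn_integral_lborel_triple:
  fixes f :: "real \<times> real \<times> real \<Rightarrow> ennreal"
  assumes f: "f \<in> borel_measurable borel"
  shows "(\<integral>\<^sup>+p. f p \<partial>lborel) = (\<integral>\<^sup>+a. \<integral>\<^sup>+b. \<integral>\<^sup>+c. f (a, b, c) \<partial>lborel \<partial>lborel \<partial>lborel)"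
proof -
  have [measurable]: "f \<in> borel_measurable (borel \<Otimes>\<^sub>M borel \<Otimes>\<^sub>M borel)"
    using f by (simp add: borel_prod)
  have "(\<integral>\<^sup>+p. f p \<partial>lborel) = (\<integral>\<^sup>+a. \<integral>\<^sup>+q. f (a, q) \<partial>lborel \<partial>lborel)"
    using f by (intro nn_integral_lborel_fst) (simp add: borel_prod)
  also have "\<dots> = (\<integral>\<^sup>+a. \<integral>\<^sup>+b. \<integral>\<^sup>+c. f (a, b, c) \<partial>lborel \<partial>lborel \<partial>lborel)"
    by (intro nn_integral_cong nn_integral_lborel_fst) measurable
  finally show ?thesis .
qed

context brownian
begin

text \<open>Now the first segment fixes \<theta> and h, and the second one only adds its increment
  to the final value while staying below h. Hence just one coordinate is translated.\<close>

lemma nn_integral_gap_after_argmax: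
  assumes t: "0 < t" "t < 1" and j: "j = 1 \<or> j = 2" and \<psi>[measurable]: "\<psi> \<in> borel_measurable borel"
  shows "(\<integral>\<^sup>+\<omega>. ennreal ((run_max (\<lambda>s. B s \<omega>) 0 1 - B t \<omega>) ^ j) * \<psi> (peak \<omega>)
      * indicator {..t} (run_argmax (\<lambda>s. B s \<omega>) 0 1) \<partial>M)
    = (\<integral>\<^sup>+(\<theta>, h, c). \<psi> (\<theta>, h, c) * (ennreal (peak_density 1 \<theta> h c) * ennreal (gap_moment j t \<theta> h c) * indicator {..<t} \<theta>) \<partial>lborel)"
proof -
  define X1 where "X1 \<omega> = (run_argmax (\<lambda>s. B s \<omega>) 0 t - 0, run_max (\<lambda>s. B s \<omega>) 0 t - B 0 \<omega>, B t \<omega> - B 0 \<omega>)" for \<omega>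
  define X2 where "X2 \<omega> = (run_max (\<lambda>s. B s \<omega>) t 1 - B t \<omega>, B 1 \<omega> - B t \<omega>)" for \<omega>
  let ?g1 = "\<lambda>(\<theta>, h, c). ennreal (peak_density t \<theta> h c)" and ?g2 = "\<lambda>(m, y). ennreal (max_end_density (1 - t) m y)"
  have d1: "distr M borel X1 = density lborel ?g1" and d2: "distr M borel X2 = density lborel ?g2"
    using distr_max_end[of t 1] distr_peak[of 0 t] t unfolding X1_def[abs_def] X2_def[abs_def] by simp_all
  have m1: "X1 \<in> borel_measurable (incr_algebra 0 t)" and m2: "X2 \<in> borel_measurable (incr_algebra t 1)"
    using measurable_max_end[of t 1] measurable_peak[of 0 t] t unfolding X1_def[abs_def] X2_def[abs_def] by simp_all
  have \<psi>': "\<psi> \<in> borel_measurable (borel \<Otimes>\<^sub>M borel \<Otimes>\<^sub>M borel)"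
    using \<psi> by (simp add: borel_prod)
  define F :: "(real \<times> real \<times> real) \<times> (real \<times> real) \<Rightarrow> ennreal" where
    "F = (\<lambda>((\<theta>, h, x), (m, y)). ennreal ((h - x) ^ j) * \<psi> (\<theta>, h, x + y) * indicator {..h - x} m)"
  have F[measurable]: "F \<in> borel_measurable (borel \<Otimes>\<^sub>M borel)"
  proof -
    have "F = (\<lambda>w. ennreal ((fst (snd (fst w)) - snd (snd (fst w))) ^ j) * \<psi> (fst (fst w), fst (snd (fst w)), snd (snd (fst w)) + snd (snd w))
        * (if fst (snd w) \<le> fst (snd (fst w)) - snd (snd (fst w)) then 1 else 0))"
      by (auto simp: F_def fun_eq_iff indicator_def)
    moreover have "\<dots> \<in> borel_measurable (borel \<Otimes>\<^sub>M borel)"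
      using \<psi> unfolding borel_prod[symmetric] by measurable
    ultimately show ?thesis by simp
  qed
  let ?k = "\<lambda>h x c. ennreal (killed (1 - t) (h - x) (h - c)) * indicator {..h} x"
  let ?G = "\<lambda>\<theta> h x c. \<psi> (\<theta>, h, c) * indicator {..h} c * (ennreal (peak_density t \<theta> h x) * ennreal ((h - x) ^ j) * ?k h x c)"
  have "(\<integral>\<^sup>+\<omega>. ennreal ((run_max (\<lambda>s. B s \<omega>) 0 1 - B t \<omega>) ^ j) * \<psi> (peak \<omega>)
      * indicator {..t} (run_argmax (\<lambda>s. B s \<omega>) 0 1) \<partial>M) = (\<integral>\<^sup>+\<omega>. F (X1 \<omega>, X2 \<omega>) \<partial>M)"
  proof (intro nn_integral_cong)
    fix \<omega> assume w: "\<omega> \<in> space M"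
    have c: "continuous_on {0..1} (\<lambda>s. B s \<omega>)" using w by (intro continuous_B) auto
    note sp = run_max_split[OF c, of t] run_argmax_le_iff[OF c, of t] run_argmax_split[OF c, of t]
    show "ennreal ((run_max (\<lambda>s. B s \<omega>) 0 1 - B t \<omega>) ^ j) * \<psi> (peak \<omega>)
      * indicator {..t} (run_argmax (\<lambda>s. B s \<omega>) 0 1) = F (X1 \<omega>, X2 \<omega>)"
    proof (cases "run_max (\<lambda>s. B s \<omega>) t 1 \<le> run_max (\<lambda>s. B s \<omega>) 0 t")
      case True
      then have "run_max (\<lambda>s. B s \<omega>) 0 1 = run_max (\<lambda>s. B s \<omega>) 0 t" "run_argmax (\<lambda>s. B s \<omega>) 0 1 = run_argmax (\<lambda>s. B s \<omega>) 0 t"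
        "run_argmax (\<lambda>s. B s \<omega>) 0 t \<le> t"
        using sp t by auto
      then show ?thesis using True B_0[OF w] by (simp add: F_def X1_def X2_def)
    next
      case False
      then have "\<not> run_argmax (\<lambda>s. B s \<omega>) 0 1 \<le> t" using sp t by simp
      then show ?thesis using False B_0[OF w] by (simp add: F_def X1_def X2_def)
    qed
  qed
  also have "\<dots> = (\<integral>\<^sup>+q. ?g1 q * (\<integral>\<^sup>+q'. ?g2 q' * F (q, q') \<partial>lborel) \<partial>lborel)"
    by (rule nn_integral_two_parts[OF _ _ _ _ m1 m2 _ _ d1 d2 F]) (use t in auto)
  also have "\<dots> = (\<integral>\<^sup>+\<theta>. \<integral>\<^sup>+h. \<integral>\<^sup>+x. ?g1 (\<theta>, h, x) * (\<integral>\<^sup>+q'. ?g2 q' * F ((\<theta>, h, x), q') \<partial>lborel) \<partial>lborel \<partial>lborel \<partial>lborel)"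
  proof (rule nn_integral_lborel_triple)
    have "(\<lambda>q. \<integral>\<^sup>+q'. ?g2 q' * F (q, q') \<partial>lborel) \<in> borel_measurable borel"
      by measurable
    then show "(\<lambda>q. ?g1 q * (\<integral>\<^sup>+q'. ?g2 q' * F (q, q') \<partial>lborel)) \<in> borel_measurable borel"
      by measurable
  qed
  also have "\<dots> = (\<integral>\<^sup>+\<theta>. \<integral>\<^sup>+h. \<integral>\<^sup>+x. \<integral>\<^sup>+c. ?G \<theta> h x c \<partial>lborel \<partial>lborel \<partial>lborel \<partial>lborel)"
  proof (intro nn_integral_cong)
    fix \<theta> h x :: real
    have "(\<integral>\<^sup>+q'. ?g2 q' * F ((\<theta>, h, x), q') \<partial>lborel) = (\<integral>\<^sup>+y. \<integral>\<^sup>+m. ?g2 (m, y) * F ((\<theta>, h, x), (m, y)) \<partial>lborel \<partial>lborel)"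
      by (rule nn_integral_lborel_snd) (simp add: borel_prod)
    also have "\<dots> = (\<integral>\<^sup>+y. ennreal ((h - x) ^ j) * \<psi> (\<theta>, h, x + y) *
         (\<integral>\<^sup>+m. ennreal (max_end_density (1 - t) m y) * indicator {..h - x} m \<partial>lborel) \<partial>lborel)"
      by (intro nn_integral_cong, subst nn_integral_cmult[symmetric]) (auto simp: F_def mult_ac)
    also have "\<dots> = (\<integral>\<^sup>+y. (\<lambda>c. \<psi> (\<theta>, h, c) * indicator {..h} c * (ennreal ((h - x) ^ j) * ?k h x c)) (x + y) \<partial>lborel)"
      using t by (subst nn_integral_max_end_density) (auto intro!: nn_integral_cong simp: indicator_def algebra_simps)
    also have "\<dots> = (\<integral>\<^sup>+c. \<psi> (\<theta>, h, c) * indicator {..h} c * (ennreal ((h - x) ^ j) * ?k h x c) \<partial>lborel)"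
      using \<psi>' by (intro nn_integral_lborel_shift) measurable
    finally have "(\<integral>\<^sup>+q'. ?g2 q' * F ((\<theta>, h, x), q') \<partial>lborel) = \<dots>" .
    then show "?g1 (\<theta>, h, x) * (\<integral>\<^sup>+q'. ?g2 q' * F ((\<theta>, h, x), q') \<partial>lborel) = (\<integral>\<^sup>+c. ?G \<theta> h x c \<partial>lborel)"
      using \<psi>' by (simp add: nn_integral_cmult[symmetric] mult_ac)
  qed
  also have "\<dots> = (\<integral>\<^sup>+\<theta>. \<integral>\<^sup>+h. \<integral>\<^sup>+c. \<integral>\<^sup>+x. ?G \<theta> h x c \<partial>lborel \<partial>lborel \<partial>lborel \<partial>lborel)"
    using \<psi>' by (intro nn_integral_cong nn_integral_lborel_swap) simp
  also have "\<dots> = (\<integral>\<^sup>+\<theta>. \<integral>\<^sup>+h. \<integral>\<^sup>+c. \<psi> (\<theta>, h, c) * (ennreal (peak_density 1 \<theta> h c) * ennreal (gap_moment j t \<theta> h c) * indicator {..<t} \<theta>) \<partial>lborel \<partial>lborel \<partial>lborel)"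
  proof (intro nn_integral_cong)
    fix \<theta> h c :: real
    show "(\<integral>\<^sup>+x. ?G \<theta> h x c \<partial>lborel)
      = \<psi> (\<theta>, h, c) * (ennreal (peak_density 1 \<theta> h c) * ennreal (gap_moment j t \<theta> h c) * indicator {..<t} \<theta>)"
    proof (cases "c \<le> h")
      case True
      then show ?thesis
        using nn_integral_gap_after[OF t j True, of \<theta>] by (subst nn_integral_cmult) simp_all
    qed (simp add: peak_density_def)
  qed
  also have "\<dots> = (\<integral>\<^sup>+(\<theta>, h, c). \<psi> (\<theta>, h, c) * (ennreal (peak_density 1 \<theta> h c) * ennreal (gap_moment j t \<theta> h c) * indicator {..<t} \<theta>) \<partial>lborel)"
    using \<psi>' by (subst nn_integral_lborel_triple) (simp_all add: borel_prod[symmetric])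
  finally show ?thesis .
qed

lemma end_argmax_max_eq: "end_argmax_max B \<omega> = (case peak \<omega> of (\<theta>, h, c) \<Rightarrow> (c, \<theta>, h))"
  by (simp add: end_argmax_max_def path_max_eq_run_max first_argmax_eq_run_argmax)

lemma distr_end_argmax_max:
  "distr M borel (end_argmax_max B) = density lborel (\<lambda>(c, \<theta>, h). ennreal (peak_density 1 \<theta> h c))"
proof (rule measure_eqI)
  have X[measurable]: "end_argmax_max B \<in> borel_measurable M"
    unfolding end_argmax_max_eq[abs_def] borel_prod[symmetric] by simp
  have P: "peak \<in> borel_measurable M" unfolding borel_prod[symmetric] by measurable
  have f: "(\<lambda>(c, \<theta>, h). ennreal (peak_density 1 \<theta> h c)) \<in> borel_measurable borel"
    unfolding borel_prod[symmetric] by measurable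
  fix A assume "A \<in> sets (distr M borel (end_argmax_max B))"
  then have A: "A \<in> sets borel" by simp
  then have iA[measurable]: "(indicator A :: real \<times> real \<times> real \<Rightarrow> ennreal) \<in> borel_measurable (borel \<Otimes>\<^sub>M borel \<Otimes>\<^sub>M borel)"
    unfolding borel_prod by (intro borel_measurable_indicator)
  have "distr M borel peak = density lborel (\<lambda>(\<theta>, h, c). ennreal (peak_density 1 \<theta> h c))"
  proof -
    have "distr M borel peak = distr M borel (\<lambda>\<omega>. (run_argmax (\<lambda>s. B s \<omega>) 0 1 - 0, run_max (\<lambda>s. B s \<omega>) 0 1 - B 0 \<omega>, B 1 \<omega> - B 0 \<omega>))"
      by (rule distr_cong) (simp_all add: B_0)
    then show ?thesis using distr_peak[of 0 1] by simp
  qed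
  note d = this
  have iA': "(\<lambda>(\<theta>, h, c). indicator A (c, \<theta>, h) :: ennreal) \<in> borel_measurable borel"
    unfolding borel_prod[symmetric] by measurable
  have "emeasure (distr M borel (end_argmax_max B)) A = (\<integral>\<^sup>+p. indicator A p \<partial>distr M borel (end_argmax_max B))"
    using A by simp
  also have "\<dots> = (\<integral>\<^sup>+\<omega>. (\<lambda>(\<theta>, h, c). indicator A (c, \<theta>, h)) (peak \<omega>) \<partial>M)"
    using A by (subst nn_integral_distr) (simp_all add: end_argmax_max_eq)
  also have "\<dots> = (\<integral>\<^sup>+p. (\<lambda>(\<theta>, h, c). indicator A (c, \<theta>, h)) p \<partial>distr M borel peak)"
    using P iA' by (intro nn_integral_distr[symmetric]) simp_all
  also have "\<dots> = (\<integral>\<^sup>+p. (\<lambda>(\<theta>, h, c). ennreal (peak_density 1 \<theta> h c)) p * (\<lambda>(\<theta>, h, c). indicator A (c, \<theta>, h)) p \<partial>lborel)"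
    unfolding d using iA' by (intro nn_integral_density) simp_all
  also have "\<dots> = (\<integral>\<^sup>+(\<theta>, h, c). (\<lambda>(c, \<theta>, h). ennreal (peak_density 1 \<theta> h c) * indicator A (c, \<theta>, h)) (c, \<theta>, h) \<partial>lborel)"
    by (simp add: split_beta')
  also have "\<dots> = (\<integral>\<^sup>+p. (\<lambda>(c, \<theta>, h). ennreal (peak_density 1 \<theta> h c) * indicator A (c, \<theta>, h)) p \<partial>lborel)"
    by (rule nn_integral_lborel_rotate) (simp add: borel_prod[symmetric])
  also have "\<dots> = emeasure (density lborel (\<lambda>(c, \<theta>, h). ennreal (peak_density 1 \<theta> h c))) A"
    using A f by (simp add: emeasure_density split_beta')
  finally show "emeasure (distr M borel (end_argmax_max B)) A = \<dots>" .
qed simp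

text \<open>The two cases are added; they omit only \<theta> = t, which is Lebesgue null. With
  \<psi> an indicator, this is the defining property of a conditional expectation of the powers of
  the gap.\<close>

lemma nn_integral_gap_moment:
  assumes t: "0 < t" "t < 1" and j: "j = 1 \<or> j = 2" and \<psi>: "\<psi> \<in> borel_measurable borel"
  shows "(\<integral>\<^sup>+\<omega>. ennreal ((path_max (\<lambda>s. B s \<omega>) - B t \<omega>) ^ j) * \<psi> (end_argmax_max B \<omega>) \<partial>M)
    = (\<integral>\<^sup>+(c, \<theta>, h). \<psi> (c, \<theta>, h) * (ennreal (peak_density 1 \<theta> h c) * ennreal (gap_moment j t \<theta> h c)) \<partial>lborel)"
proof -
  have \<psi>'[measurable]: "\<psi> \<in> borel_measurable (borel \<Otimes>\<^sub>M borel \<Otimes>\<^sub>M borel)"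
    using \<psi> by (simp add: borel_prod)
  let ?\<phi> = "\<lambda>(\<theta>, h, c). \<psi> (c, \<theta>, h)"
  have \<phi>: "?\<phi> \<in> borel_measurable borel" unfolding borel_prod[symmetric] by measurable
  have [measurable]: "B t \<in> borel_measurable M" using t by (intro measurable_B) simp
  have P: "peak \<in> borel_measurable M" unfolding borel_prod[symmetric] by measurable
  then have [measurable]: "(\<lambda>\<omega>. ?\<phi> (peak \<omega>)) \<in> borel_measurable M"
    using \<phi> by (rule measurable_compose)
  let ?g = "\<lambda>\<theta> h c. ennreal (peak_density 1 \<theta> h c) * ennreal (gap_moment j t \<theta> h c)"
  let ?f = "\<lambda>\<omega>. ennreal ((run_max (\<lambda>s. B s \<omega>) 0 1 - B t \<omega>) ^ j) * ?\<phi> (peak \<omega>)"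
  have "(\<integral>\<^sup>+\<omega>. ennreal ((path_max (\<lambda>s. B s \<omega>) - B t \<omega>) ^ j) * \<psi> (end_argmax_max B \<omega>) \<partial>M)
    = (\<integral>\<^sup>+\<omega>. ?f \<omega> * indicator {..t} (run_argmax (\<lambda>s. B s \<omega>) 0 1) + ?f \<omega> * indicator {t<..} (run_argmax (\<lambda>s. B s \<omega>) 0 1) \<partial>M)"
    by (intro nn_integral_cong) (auto simp: path_max_eq_run_max end_argmax_max_eq indicator_def)
  also have "\<dots> = (\<integral>\<^sup>+\<omega>. ?f \<omega> * indicator {..t} (run_argmax (\<lambda>s. B s \<omega>) 0 1) \<partial>M)
      + (\<integral>\<^sup>+\<omega>. ?f \<omega> * indicator {t<..} (run_argmax (\<lambda>s. B s \<omega>) 0 1) \<partial>M)"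
    by (rule nn_integral_add) measurable
  also have "\<dots> = (\<integral>\<^sup>+(\<theta>, h, c). ?\<phi> (\<theta>, h, c) * (?g \<theta> h c * indicator {..<t} \<theta>) \<partial>lborel)
      + (\<integral>\<^sup>+(\<theta>, h, c). ?\<phi> (\<theta>, h, c) * (?g \<theta> h c * indicator {t<..} \<theta>) \<partial>lborel)"
    unfolding nn_integral_gap_after_argmax[OF t j \<phi>] nn_integral_gap_before_argmax[OF t j \<phi>] ..
  also have "\<dots> = (\<integral>\<^sup>+(\<theta>, h, c). ?\<phi> (\<theta>, h, c) * (?g \<theta> h c * indicator {..<t} \<theta>) + ?\<phi> (\<theta>, h, c) * (?g \<theta> h c * indicator {t<..} \<theta>) \<partial>lborel)"
    unfolding split_beta' by (rule nn_integral_add[symmetric]) (simp_all add: borel_prod[symmetric])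
  also have "\<dots> = (\<integral>\<^sup>+\<theta>. \<integral>\<^sup>+h. \<integral>\<^sup>+c. ?\<phi> (\<theta>, h, c) * (?g \<theta> h c * indicator {..<t} \<theta>) + ?\<phi> (\<theta>, h, c) * (?g \<theta> h c * indicator {t<..} \<theta>) \<partial>lborel \<partial>lborel \<partial>lborel)"
    by (subst nn_integral_lborel_triple) (simp_all add: borel_prod[symmetric] split_beta')
  also have "\<dots> = (\<integral>\<^sup>+\<theta>. \<integral>\<^sup>+h. \<integral>\<^sup>+c. \<psi> (c, \<theta>, h) * ?g \<theta> h c \<partial>lborel \<partial>lborel \<partial>lborel)"
  proof (intro nn_integral_cong_AE)
    show "AE \<theta> in lborel. (\<integral>\<^sup>+h. \<integral>\<^sup>+c. ?\<phi> (\<theta>, h, c) * (?g \<theta> h c * indicator {..<t} \<theta>) + ?\<phi> (\<theta>, h, c) * (?g \<theta> h c * indicator {t<..} \<theta>) \<partial>lborel \<partial>lborel)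
      = (\<integral>\<^sup>+h. \<integral>\<^sup>+c. \<psi> (c, \<theta>, h) * ?g \<theta> h c \<partial>lborel \<partial>lborel)"
      using AE_lborel_singleton[of t]
      by eventually_elim (auto intro!: nn_integral_cong simp: indicator_def)
  qed
  also have "\<dots> = (\<integral>\<^sup>+(\<theta>, h, c). (\<lambda>(c, \<theta>, h). \<psi> (c, \<theta>, h) * ?g \<theta> h c) (c, \<theta>, h) \<partial>lborel)"
    by (subst nn_integral_lborel_triple) (simp_all add: borel_prod[symmetric] split_beta')
  also have "\<dots> = (\<integral>\<^sup>+p. (\<lambda>(c, \<theta>, h). \<psi> (c, \<theta>, h) * ?g \<theta> h c) p \<partial>lborel)"
    by (rule nn_integral_lborel_rotate) (simp add: borel_prod[symmetric] split_beta')
  finally show ?thesis .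
qed

end

section \<open>From rational times to all times\<close>

text \<open>The delicate point is s = 1, where the formula is replaced by its limit. It corresponds
  to the end times t = 0 and t = 1.\<close>

lemma continuous_on_M1:
  assumes y: "y > 0"
  shows "continuous_on {0..1} (\<lambda>s. M1 s y)"
  unfolding continuous_on_def
proof
  fix s :: real assume s: "s \<in> {0..1}"
  show "((\<lambda>s. M1 s y) \<longlongrightarrow> M1 s y) (at s within {0..1})"
  proof (cases "s = 1")
    case True
    then show ?thesis using M1_tendsto_1[OF y] by (simp add: at_within_Icc_at_left)
  next
    case False
    then have s1: "s < 1" using s by simp
    let ?g = "\<lambda>s. 1 / y * (1 - s + s * y\<^sup>2) * erf (y * sqrt s / sqrt (2 * (1 - s)))
           + sqrt (2 * s * (1 - s) / pi) * exp (- (s * y\<^sup>2) / (2 * (1 - s)))"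
    have "continuous_on {..<1} ?g" by (intro continuous_intros) auto
    then have "continuous_on {..<1} (\<lambda>s. M1 s y)"
      by (rule continuous_on_cong[THEN iffD1, rotated 2]) (auto simp: M1_def)
    then have "isCont (\<lambda>s. M1 s y) s" using s1 by (simp add: continuous_on_eq_continuous_at)
    then show ?thesis unfolding isCont_def by (rule tendsto_within_subset) simp
  qed
qed

lemma continuous_on_meander_moment:
  assumes b: "b > 0" and T: "T > 0" and f: "continuous_on S f" "f ` S \<subseteq> {0..1}"
  shows "continuous_on S (\<lambda>t. meander_moment j T (f t) b)"
proof -
  have "continuous_on {0..1} (\<lambda>s. meander_moment j T s b)"
    unfolding meander_moment_def M2_def using b T
    by (cases "j = 1") (auto intro!: continuous_intros continuous_on_M1)
  from continuous_on_compose2[OF this f] show ?thesis .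
qed

text \<open>Agreement is asked only at interior rationals, because the moment identities are not
  established directly at t = 0, t = \<theta> and t = 1.\<close>

lemma continuous_on_eq_if_eq_on_Rats:
  fixes f g :: "real \<Rightarrow> real"
  assumes ab: "a < b" and f: "continuous_on {a..b} f" and g: "continuous_on {a..b} g"
    and eq: "\<And>q. q \<in> \<rat> \<Longrightarrow> a < q \<Longrightarrow> q < b \<Longrightarrow> f q = g q" and t: "t \<in> {a..b}"
  shows "f t = g t"
proof -
  have cl: "closure ({a<..<b} \<inter> \<rat>) = {a..b}"
    using closure_open_Int_superset[of "{a<..<b}" \<rat>] ab by (simp add: Rats_closure_real)
  have "f t - g t = 0"
    using continuous_constant_on_closure[of "{a<..<b} \<inter> \<rat>" "\<lambda>t. f t - g t" 0 t] f g eq t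
    unfolding cl by (auto intro!: continuous_on_diff)
  then show ?thesis by simp
qed

section \<open>Paths and their suprema\<close>

lemma measurable_path_eval:
  assumes "t \<in> {0..1}"
  shows "(\<lambda>f. f t) \<in> borel_measurable path_space"
  unfolding path_space_def using assms
  by (intro measurable_restrict_space1 measurable_component_singleton)

lemma space_path_space: "f \<in> space path_space \<Longrightarrow> continuous_on {0..1} f"
  by (simp add: path_space_def space_restrict_space)

lemma le_on_Rats_imp:
  fixes f :: "real \<Rightarrow> real"
  assumes f: "continuous_on {0..1} f" and le: "\<And>q. q \<in> \<rat> \<inter> {0..1} \<Longrightarrow> f q \<le> a" and t: "t \<in> {0..1}"
  shows "f t \<le> a"
proof -
  have cl: "closure ({0<..<1} \<inter> \<rat>) = {0..1 :: real}"
    using closure_open_Int_superset[of "{0<..<1 :: real}" \<rat>] by (simp add: Rats_closure_real)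
  show ?thesis
    using continuous_le_on_closure[of "{0<..<1} \<inter> \<rat>" f t a] f le t unfolding cl by auto
qed

text \<open>The restriction to rational times keeps the supremum measurable for the cylinder
  sigma-algebra; by continuity it still bounds all times.\<close>

definition sup_square :: "(real \<Rightarrow> real) \<Rightarrow> ennreal" where
  "sup_square f = (SUP q\<in>\<rat> \<inter> {0..1}. ennreal ((f q)\<^sup>2))"

lemma measurable_sup_square [measurable]: "sup_square \<in> borel_measurable path_space"
  unfolding sup_square_def
proof (rule borel_measurable_SUP)
  show "countable (\<rat> \<inter> {0..1 :: real})" using countable_rat by blast
  fix q :: real assume "q \<in> \<rat> \<inter> {0..1}"
  then have [measurable]: "(\<lambda>f. f q) \<in> borel_measurable path_space" by (intro measurable_path_eval) auto
  show "(\<lambda>f. ennreal ((f q)\<^sup>2)) \<in> borel_measurable path_space" by measurable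
qed

lemma square_le_sup_square:
  assumes f: "continuous_on {0..1} f" and t: "t \<in> {0..1}"
  shows "ennreal ((f t)\<^sup>2) \<le> sup_square f"
proof (cases "sup_square f")
  case (real r)
  have "(\<lambda>x. (f x)\<^sup>2) t \<le> r"
  proof (rule le_on_Rats_imp[OF _ _ t])
    show "continuous_on {0..1} (\<lambda>x. (f x)\<^sup>2)" using f by (intro continuous_intros)
    fix q :: real assume "q \<in> \<rat> \<inter> {0..1}"
    then have "ennreal ((f q)\<^sup>2) \<le> sup_square f" unfolding sup_square_def by (rule SUP_upper)
    then show "(f q)\<^sup>2 \<le> r" using real by simp
  qed
  then show ?thesis using real by (simp add: ennreal_leI)
qed simp

text \<open>For t > 0 this is the substitution s = 1 - t / \<theta>, y = h / sqrt \<theta> in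
  \<open>M1\<close>. At t = 0 the limit values agree: \<open>M1 1 y = y\<close> makes the left side
  0.\<close>

lemma pre_max_mean_eq:
  assumes \<theta>: "0 < \<theta>" and h: "0 < h" and t: "t \<in> {0..\<theta>}"
  shows "h - sqrt \<theta> * M1 (1 - t / \<theta>) (h / sqrt \<theta>) = pre_max_mean \<theta> h t"
proof (cases "t = 0")
  case True
  then show ?thesis using \<theta> by (simp add: M1_def pre_max_mean_def)
next
  case False
  then have t: "0 < t" "t \<le> \<theta>" using t by auto
  define r where "r = sqrt \<theta>"
  have r: "r > 0" and \<theta>r: "\<theta> = r\<^sup>2" using \<theta> by (auto simp: r_def)
  have pw: "\<theta> powr (3/2) = \<theta> * r"
    using \<theta> powr_add[of \<theta> 1 "1/2"] by (simp add: powr_half_sqrt r_def)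
  have s1: "1 - t / \<theta> \<noteq> 1" using t \<theta> by simp
  have c: "1 / (h / r) * (1 - (1 - t / \<theta>) + (1 - t / \<theta>) * (h / r)\<^sup>2) = t / (h * r) + h * (\<theta> - t) / \<theta> powr (3/2)"
    unfolding pw unfolding \<theta>r using h r by (simp add: divide_simps power2_eq_square)
  have a: "h / r * sqrt (1 - t / \<theta>) / sqrt (2 * (1 - (1 - t / \<theta>))) = h * sqrt (\<theta> - t) / sqrt (2 * t * \<theta>)"
  proof -
    have "sqrt (1 - t / \<theta>) = sqrt (\<theta> - t) / r"
      using \<theta> by (simp add: r_def real_sqrt_divide[symmetric] diff_divide_distrib)
    moreover have "sqrt (2 * (1 - (1 - t / \<theta>))) = sqrt (2 * t) / r"
      by (simp add: r_def real_sqrt_divide[symmetric])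
    moreover have "sqrt (2 * t * \<theta>) = sqrt (2 * t) * r" by (simp add: r_def real_sqrt_mult)
    ultimately show ?thesis using r t by simp
  qed
  have e: "- ((1 - t / \<theta>) * (h / r)\<^sup>2) / (2 * (1 - (1 - t / \<theta>))) = - ((\<theta> - t) * h\<^sup>2) / (2 * t * \<theta>)"
    unfolding \<theta>r using r t by (simp add: divide_simps power2_eq_square)
  have d: "r * sqrt (2 * (1 - t / \<theta>) * (1 - (1 - t / \<theta>)) / pi) = sqrt (2 * t * (\<theta> - t)) / sqrt (pi * \<theta>)"
  proof -
    have "2 * (1 - t / \<theta>) * (1 - (1 - t / \<theta>)) / pi = (2 * t * (\<theta> - t)) / (pi * \<theta>) / \<theta>"
      using \<theta> by (simp add: field_simps)
    then have "sqrt (2 * (1 - t / \<theta>) * (1 - (1 - t / \<theta>)) / pi) = sqrt (2 * t * (\<theta> - t)) / sqrt (pi * \<theta>) / r"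
      by (simp only: real_sqrt_divide r_def)
    then show ?thesis using r by simp
  qed
  have "M1 (1 - t / \<theta>) (h / r) = (t / (h * r) + h * (\<theta> - t) / \<theta> powr (3/2)) * erf (h * sqrt (\<theta> - t) / sqrt (2 * t * \<theta>))
     + sqrt (2 * (1 - t / \<theta>) * (1 - (1 - t / \<theta>)) / pi) * exp (- ((\<theta> - t) * h\<^sup>2) / (2 * t * \<theta>))"
    unfolding M1_def c a e using s1 by (simp only: if_False)
  moreover have "r * (A * x + S * y) = r * A * x + r * S * y" for A x S y :: real
    by (simp add: distrib_left mult.assoc)
  ultimately have "r * M1 (1 - t / \<theta>) (h / r) = r * (t / (h * r) + h * (\<theta> - t) / \<theta> powr (3/2)) * erf (h * sqrt (\<theta> - t) / sqrt (2 * t * \<theta>))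
     + r * sqrt (2 * (1 - t / \<theta>) * (1 - (1 - t / \<theta>)) / pi) * exp (- ((\<theta> - t) * h\<^sup>2) / (2 * t * \<theta>))"
    by (simp only:)
  then show ?thesis
    using False unfolding d pre_max_mean_def r_def[symmetric] by simp
qed

text \<open>The triple (c, \<theta>, h) is fixed here and K plays the conditional law. Both the
  moments of the gap and the meander formulas are continuous in t on [0, \<theta>] and on
  [\<theta>, 1], so agreement at rational times suffices.\<close>

lemma moments_from_rational_times:
  fixes K :: "(real \<Rightarrow> real) measure"
  assumes K: "prob_space K" and sets_K: "sets K = sets path_space"
    and \<theta>: "0 < \<theta>" "\<theta> < 1" and h: "0 < h" "c < h"
    and le: "AE f in K. \<forall>q\<in>\<rat> \<inter> {0..1}. f q \<le> h"
    and sq: "(\<integral>\<^sup>+f. sup_square f \<partial>K) < \<infinity>"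
    and mom: "\<And>q j. q \<in> \<rat> \<Longrightarrow> 0 < q \<Longrightarrow> q < 1 \<Longrightarrow> j \<in> {1, 2} \<Longrightarrow>
        (\<integral>\<^sup>+f. ennreal ((h - f q) ^ j) \<partial>K) = ennreal (gap_moment j q \<theta> h c)"
  shows "(\<forall>t\<in>{0..1}. integrable K (\<lambda>f. f t) \<and> integrable K (\<lambda>f. (f t)\<^sup>2)) \<and>
      (\<forall>t\<in>{0..\<theta>}. \<forall>j\<in>{1, 2}. (\<integral>f. (h - f t) ^ j \<partial>K) = meander_moment j \<theta> (1 - t / \<theta>) h) \<and>
      (\<forall>t\<in>{\<theta>..1}. \<forall>j\<in>{1, 2}. (\<integral>f. (h - f t) ^ j \<partial>K) = meander_moment j (1 - \<theta>) ((t - \<theta>) / (1 - \<theta>)) (h - c))"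
proof -
  interpret K: prob_space K by (rule K)
  have spK: "space K = space path_space" using sets_K by (rule sets_eq_imp_space_eq)
  have mK[measurable_cong]: "sets K = sets path_space" by (rule sets_K)
  have ev[measurable]: "(\<lambda>f. f t) \<in> borel_measurable K" if "t \<in> {0..1}" for t
    using measurable_path_eval[OF that] by (simp add: measurable_cong_sets[OF sets_K])
  have cf: "continuous_on {0..1} f" if "f \<in> space K" for f
    using that by (simp add: spK space_path_space)
  define G where "G f = enn2real (sup_square f)" for f
  have ms[measurable]: "sup_square \<in> borel_measurable K"
    by measurable
  have [measurable]: "G \<in> borel_measurable K"
    unfolding G_def by measurable
  have fin: "AE f in K. sup_square f \<noteq> \<infinity>"
    using sq by (intro nn_integral_PInf_AE) auto
  have G: "AE f in K. \<forall>t\<in>{0..1}. (f t)\<^sup>2 \<le> G f"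
    using fin AE_space
  proof eventually_elim
    case (elim f)
    show ?case
    proof
      fix t :: real assume t: "t \<in> {0..1}"
      have "ennreal ((f t)\<^sup>2) \<le> ennreal (G f)"
        using square_le_sup_square[OF cf[OF elim(2)] t] elim(1)
        by (simp add: G_def less_top)
      then show "(f t)\<^sup>2 \<le> G f" by (simp add: G_def)
    qed
  qed
  have iG: "integrable K G"
  proof (rule integrableI_nonneg)
    have "(\<integral>\<^sup>+f. ennreal (G f) \<partial>K) = (\<integral>\<^sup>+f. sup_square f \<partial>K)"
      using fin by (intro nn_integral_cong_AE) (auto simp: G_def less_top)
    then show "(\<integral>\<^sup>+f. ennreal (G f) \<partial>K) < \<infinity>" using sq by simp
  qed (auto simp: G_def)
  \<comment> \<open>One dominating function for both powers: the square of h - x is at most 2 h^2 +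
    2 x^2, and the absolute value is at most 1 plus the square.\<close>
  let ?w = "\<lambda>f. 1 + 2 * h\<^sup>2 + 2 * G f"
  have iw: "integrable K ?w" using iG by auto
  have bound: "\<bar>h - x\<bar> ^ j \<le> 1 + 2 * h\<^sup>2 + 2 * x\<^sup>2" if "j \<in> {1, 2}" for x :: real and j :: nat
  proof -
    have 1: "(h - x)\<^sup>2 \<le> 2 * h\<^sup>2 + 2 * x\<^sup>2"
      using zero_le_power2[of "h + x"] by (simp add: power2_sum power2_diff)
    have 2: "\<bar>h - x\<bar> \<le> 1 + (h - x)\<^sup>2"
      using zero_le_power2[of "\<bar>h - x\<bar> - 1"] zero_le_power2[of "h - x"] by (simp add: power2_diff)
    show ?thesis using that 1 2 by auto
  qed
  have dom: "AE f in K. norm ((h - f t) ^ j) \<le> ?w f" if "t \<in> {0..1}" "j \<in> {1, 2}" for t j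
    using G
  proof eventually_elim
    case (elim f)
    then show ?case using bound[OF that(2), of "f t"] that(1) by (force simp: power_abs)
  qed
  have int: "integrable K (\<lambda>f. (h - f t) ^ j)" if "t \<in> {0..1}" "j \<in> {1, 2}" for t j
    using dom[OF that] that by (intro Bochner_Integration.integrable_bound[OF iw]) (auto simp: G_def)
  have int1: "integrable K (\<lambda>f. f t)" if "t \<in> {0..1}" for t
  proof -
    have "integrable K (\<lambda>f. h - (h - f t) ^ 1)" by (intro Bochner_Integration.integrable_diff int that) auto
    then show ?thesis by simp
  qed
  have int2: "integrable K (\<lambda>f. (f t)\<^sup>2)" if "t \<in> {0..1}" for t
  proof (rule Bochner_Integration.integrable_bound[OF iG])
    show "AE f in K. norm ((f t)\<^sup>2) \<le> norm (G f)"
      using G by eventually_elim (use that in force)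
  qed (use that in measurable)
  define E where "E j t = (\<integral>f. (h - f t) ^ j \<partial>K)" for j t
  have contE: "continuous_on {0..1} (E j)" if j: "j \<in> {1, 2}" for j
    unfolding continuous_on_sequentially
  proof (intro allI ballI impI)
    fix x and t :: real assume t: "t \<in> {0..1}" and x: "(\<forall>n. x n \<in> {0..1}) \<and> x \<longlonglongrightarrow> t"
    have "(\<lambda>n. E j (x n)) \<longlonglongrightarrow> E j t"
      unfolding E_def
    proof (rule integral_dominated_convergence[OF _ _ iw])
      show "AE f in K. (\<lambda>n. (h - f (x n)) ^ j) \<longlonglongrightarrow> (h - f t) ^ j"
      proof (rule AE_I2)
        fix f assume f: "f \<in> space K"
        have "(\<lambda>n. f (x n)) \<longlonglongrightarrow> f t"
          using cf[OF f] t x unfolding continuous_on_sequentially by (auto simp: o_def)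
        then show "(\<lambda>n. (h - f (x n)) ^ j) \<longlonglongrightarrow> (h - f t) ^ j" by (intro tendsto_intros)
      qed
      show "AE f in K. norm ((h - f (x n)) ^ j) \<le> ?w f" for n
        using dom x j by blast
      show "(\<lambda>f. (h - f t) ^ j) \<in> borel_measurable K" using t by measurable
      show "(\<lambda>f. (h - f (x n)) ^ j) \<in> borel_measurable K" for n
      proof -
        have "x n \<in> {0..1}" using x by blast
        then show ?thesis by measurable
      qed
    qed
    then show "(E j \<circ> x) \<longlonglongrightarrow> E j t" by (simp add: o_def)
  qed
  have Eq: "E j q = gap_moment j q \<theta> h c" if q: "q \<in> \<rat>" "0 < q" "q < 1" and j: "j \<in> {1, 2}" for q j
  proof -
    \<comment> \<open>\<open>ennreal\<close> truncates negative values, so \<open>mom\<close> speaks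
      of the real moment only once the paths are known to stay below h.\<close>
    have nn: "AE f in K. 0 \<le> (h - f q) ^ j" using le by eventually_elim (use q in auto)
    have "0 \<le> gap_moment j q \<theta> h c"
      using \<theta> h q unfolding gap_moment_def by (auto intro!: meander_moment_nonneg)
    moreover have "ennreal (E j q) = (\<integral>\<^sup>+f. ennreal ((h - f q) ^ j) \<partial>K)"
      unfolding E_def
    proof (rule nn_integral_eq_integral[symmetric])
      show "integrable K (\<lambda>f. (h - f q) ^ j)" using q j by (intro int) auto
      show "AE f in K. 0 \<le> (h - f q) ^ j" by (rule nn)
    qed
    moreover have "0 \<le> E j q"
      unfolding E_def by (rule integral_nonneg_AE[OF nn])
    ultimately show ?thesis using mom[OF q j] by simp
  qed
  have "E j t = meander_moment j \<theta> (1 - t / \<theta>) h" if "t \<in> {0..\<theta>}" and j: "j \<in> {1, 2}" for t j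
  proof (rule continuous_on_eq_if_eq_on_Rats[OF \<theta>(1) _ _ _ that(1)])
    show "continuous_on {0..\<theta>} (E j)" using contE[OF j] \<theta> by (auto elim: continuous_on_subset)
    show "continuous_on {0..\<theta>} (\<lambda>t. meander_moment j \<theta> (1 - t / \<theta>) h)"
      using \<theta> h by (intro continuous_on_meander_moment continuous_intros) (auto simp: field_simps)
    show "E j q = meander_moment j \<theta> (1 - q / \<theta>) h" if "q \<in> \<rat>" "0 < q" "q < \<theta>" for q
      using Eq[of q j] that j \<theta> by (simp add: gap_moment_def diff_divide_distrib)
  qed
  moreover have "E j t = meander_moment j (1 - \<theta>) ((t - \<theta>) / (1 - \<theta>)) (h - c)" if "t \<in> {\<theta>..1}" and j: "j \<in> {1, 2}" for t j
  proof (rule continuous_on_eq_if_eq_on_Rats[OF \<theta>(2) _ _ _ that(1)])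
    show "continuous_on {\<theta>..1} (E j)" using contE[OF j] \<theta> by (auto elim: continuous_on_subset)
    show "continuous_on {\<theta>..1} (\<lambda>t. meander_moment j (1 - \<theta>) ((t - \<theta>) / (1 - \<theta>)) (h - c))"
      using \<theta> h by (intro continuous_on_meander_moment continuous_intros) auto
    show "E j q = meander_moment j (1 - \<theta>) ((q - \<theta>) / (1 - \<theta>)) (h - c)" if "q \<in> \<rat>" "\<theta> < q" "q < 1" for q
      using Eq[of q j] that j \<theta> by (simp add: gap_moment_def)
  qed
  ultimately show ?thesis using int1 int2 unfolding E_def by blast
qed

text \<open>Since B(t) is h minus the gap, the mean and the second moment follow by expansion, and
  the variance is that of the gap, with the scaling factor T pulled out of
  \<open>T * M2 - (sqrt T * M1)^2\<close>.\<close>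

lemma conditional_moments:
  fixes K :: "(real \<Rightarrow> real) measure"
  assumes K: "prob_space K" and \<theta>: "0 < \<theta>" "\<theta> < 1" and h: "0 < h" "c < h"
    and int: "\<And>t. t \<in> {0..1} \<Longrightarrow> integrable K (\<lambda>f. f t) \<and> integrable K (\<lambda>f. (f t)\<^sup>2)"
    and E1: "\<And>t j. t \<in> {0..\<theta>} \<Longrightarrow> j \<in> {1, 2} \<Longrightarrow> (\<integral>f. (h - f t) ^ j \<partial>K) = meander_moment j \<theta> (1 - t / \<theta>) h"
    and E2: "\<And>t j. t \<in> {\<theta>..1} \<Longrightarrow> j \<in> {1, 2} \<Longrightarrow> (\<integral>f. (h - f t) ^ j \<partial>K) = meander_moment j (1 - \<theta>) ((t - \<theta>) / (1 - \<theta>)) (h - c)"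
  shows "(\<forall>t\<in>{0..1}. integrable K (\<lambda>f. f t) \<and> integrable K (\<lambda>f. (f t)\<^sup>2)) \<and>
      (\<forall>t\<in>{0..\<theta>}.
         prob_space.expectation K (\<lambda>f. f t) = h - sqrt \<theta> * M1 (1 - t / \<theta>) (h / sqrt \<theta>) \<and>
         h - sqrt \<theta> * M1 (1 - t / \<theta>) (h / sqrt \<theta>) = pre_max_mean \<theta> h t) \<and>
      (\<forall>t\<in>{\<theta>..1}.
         prob_space.expectation K (\<lambda>f. f t)
           = h - sqrt (1 - \<theta>) * M1 ((t - \<theta>) / (1 - \<theta>)) ((h - c) / sqrt (1 - \<theta>))) \<and>
      (\<forall>t\<in>{0..\<theta>}.
         let s = 1 - t / \<theta> in
         prob_space.expectation K (\<lambda>f. (f t)\<^sup>2)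
           = h\<^sup>2 - 2 * h * sqrt \<theta> * M1 s (h / sqrt \<theta>) + \<theta> * M2 s (h / sqrt \<theta>)) \<and>
      (\<forall>t\<in>{0..\<theta>}.
         prob_space.variance K (\<lambda>f. f t) = \<theta> * Vr (1 - t / \<theta>) (h / sqrt \<theta>)) \<and>
      (\<forall>t\<in>{\<theta>..1}.
         prob_space.variance K (\<lambda>f. f t)
           = (1 - \<theta>) * Vr ((t - \<theta>) / (1 - \<theta>)) ((h - c) / sqrt (1 - \<theta>)))"
proof -
  interpret K: prob_space K by (rule K)
  have mean: "(\<integral>f. f t \<partial>K) = h - (\<integral>f. (h - f t) ^ 1 \<partial>K)" if "t \<in> {0..1}" for t
    using int[OF that] by (simp add: K.prob_space)
  have square: "(\<integral>f. (f t)\<^sup>2 \<partial>K) = h\<^sup>2 - 2 * h * (\<integral>f. (h - f t) ^ 1 \<partial>K) + (\<integral>f. (h - f t) ^ 2 \<partial>K)" if "t \<in> {0..1}" for t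
    using int[OF that] by (simp add: K.prob_space power2_diff algebra_simps) (simp add: power2_eq_square algebra_simps)
  have var: "K.variance (\<lambda>f. f t) = (\<integral>f. (h - f t) ^ 2 \<partial>K) - (\<integral>f. (h - f t) ^ 1 \<partial>K)\<^sup>2" if "t \<in> {0..1}" for t
  proof -
    have "K.variance (\<lambda>f. f t) = K.expectation (\<lambda>f. (f t)\<^sup>2) - (K.expectation (\<lambda>f. f t))\<^sup>2"
      using int[OF that] by (intro K.variance_eq) auto
    then show ?thesis unfolding mean[OF that] square[OF that] by (simp add: power2_diff algebra_simps)
  qed
  have sub: "t \<in> {0..1}" if "t \<in> {0..\<theta>} \<or> t \<in> {\<theta>..1}" for t using that \<theta> by auto
  have m1: "meander_moment 1 T s b = sqrt T * M1 s (b / sqrt T)" and m2: "meander_moment 2 T s b = T * M2 s (b / sqrt T)" for T s b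
    by (simp_all add: meander_moment_def)
  have Vr: "T * M2 s y - (sqrt T * M1 s y)\<^sup>2 = T * Vr s y" if "T > 0" for T s y
    using that by (simp add: Vr_def power_mult_distrib right_diff_distrib)
  have e: "(\<integral>f. (h - f t) ^ 1 \<partial>K) = sqrt \<theta> * M1 (1 - t / \<theta>) (h / sqrt \<theta>)"
     "(\<integral>f. (h - f t) ^ 2 \<partial>K) = \<theta> * M2 (1 - t / \<theta>) (h / sqrt \<theta>)" if "t \<in> {0..\<theta>}" for t
    using E1[OF that, of 1, unfolded m1] E1[OF that, of 2, unfolded m2] by simp_all
  have e': "(\<integral>f. (h - f t) ^ 1 \<partial>K) = sqrt (1 - \<theta>) * M1 ((t - \<theta>) / (1 - \<theta>)) ((h - c) / sqrt (1 - \<theta>))"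
     "(\<integral>f. (h - f t) ^ 2 \<partial>K) = (1 - \<theta>) * M2 ((t - \<theta>) / (1 - \<theta>)) ((h - c) / sqrt (1 - \<theta>))" if "t \<in> {\<theta>..1}" for t
    using E2[OF that, of 1, unfolded m1] E2[OF that, of 2, unfolded m2] by simp_all
  show ?thesis
  proof (intro conjI ballI)
    fix t assume t: "t \<in> {0..\<theta>}"
    then have t': "t \<in> {0..1}" by (intro sub) simp
    show "K.expectation (\<lambda>f. f t) = h - sqrt \<theta> * M1 (1 - t / \<theta>) (h / sqrt \<theta>)"
      unfolding mean[OF t'] e[OF t] ..
    show "h - sqrt \<theta> * M1 (1 - t / \<theta>) (h / sqrt \<theta>) = pre_max_mean \<theta> h t"
      using \<theta>(1) h(1) t by (rule pre_max_mean_eq)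
    show "let s = 1 - t / \<theta> in K.expectation (\<lambda>f. (f t)\<^sup>2)
           = h\<^sup>2 - 2 * h * sqrt \<theta> * M1 s (h / sqrt \<theta>) + \<theta> * M2 s (h / sqrt \<theta>)"
      unfolding square[OF t'] e[OF t] Let_def by simp
    show "K.variance (\<lambda>f. f t) = \<theta> * Vr (1 - t / \<theta>) (h / sqrt \<theta>)"
      unfolding var[OF t'] e[OF t] by (rule Vr[OF \<theta>(1)])
  next
    fix t assume t: "t \<in> {\<theta>..1}"
    then have t': "t \<in> {0..1}" by (intro sub) simp
    show "K.expectation (\<lambda>f. f t) = h - sqrt (1 - \<theta>) * M1 ((t - \<theta>) / (1 - \<theta>)) ((h - c) / sqrt (1 - \<theta>))"
      unfolding mean[OF t'] e'[OF t] ..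
    show "K.variance (\<lambda>f. f t) = (1 - \<theta>) * Vr ((t - \<theta>) / (1 - \<theta>)) ((h - c) / sqrt (1 - \<theta>))"
      unfolding var[OF t'] e'[OF t] using \<theta>(2) by (intro Vr) simp
  qed (use int in auto)
qed

section \<open>Disintegration along the conditional distribution\<close>

text \<open>The definition disintegrates rectangles only. Rectangles are closed under intersection
  and generate the product sigma-algebra, so the joint law equals the kernel mixed over the law of
  X, and integration against that mixture is iterated.\<close>

lemma nn_integral_regular_cond_distr:
  assumes M: "prob_space M" and \<kappa>: "regular_cond_distr M N X S Y \<kappa>"
    and \<Phi>[measurable]: "\<Phi> \<in> borel_measurable (N \<Otimes>\<^sub>M S)"
  shows "(\<integral>\<^sup>+\<omega>. \<Phi> (X \<omega>, Y \<omega>) \<partial>M) = (\<integral>\<^sup>+x. \<integral>\<^sup>+y. \<Phi> (x, y) \<partial>\<kappa> x \<partial>distr M N X)"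
proof -
  interpret prob_space M by (rule M)
  have X[measurable]: "X \<in> measurable M N" and Y[measurable]: "Y \<in> measurable M S"
    and \<kappa>m: "\<kappa> \<in> measurable N (prob_algebra S)"
    and joint: "\<And>A C. A \<in> sets N \<Longrightarrow> C \<in> sets S \<Longrightarrow>
        emeasure M {\<omega> \<in> space M. X \<omega> \<in> A \<and> Y \<omega> \<in> C} = (\<integral>\<^sup>+x\<in>A. emeasure (\<kappa> x) C \<partial>distr M N X)"
    using \<kappa> by (auto simp: regular_cond_distr_def)
  have \<kappa>s[measurable]: "\<kappa> \<in> measurable N (subprob_algebra S)"
    by (rule measurable_prob_algebraD[OF \<kappa>m])
  let ?L = "distr M N X" and ?K = "\<lambda>x. distr (\<kappa> x) (N \<Otimes>\<^sub>M S) (Pair x)"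
  have K: "?K \<in> measurable ?L (subprob_algebra (N \<Otimes>\<^sub>M S))"
    using measurable_distr2[of Pair N S "N \<Otimes>\<^sub>M S" \<kappa>] by (simp add: split_beta')
  have ne: "space ?L \<noteq> {}"
    using measurable_space[OF X] not_empty by auto
  have \<kappa>S: "sets (\<kappa> x) = sets S" if "x \<in> space N" for x
    using measurable_space[OF \<kappa>s that] by (simp add: space_subprob_algebra)
  have Pm: "Pair x \<in> measurable (\<kappa> x) (N \<Otimes>\<^sub>M S)" if "x \<in> space N" for x
    using that by (simp add: measurable_cong_sets[OF \<kappa>S[OF that] refl])
  let ?D = "distr M (N \<Otimes>\<^sub>M S) (\<lambda>\<omega>. (X \<omega>, Y \<omega>))" and ?E = "?L \<bind> ?K"
  have sE: "sets ?E = sets (N \<Otimes>\<^sub>M S)"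
    using K ne by (intro sets_bind) (auto simp: measurable_def space_subprob_algebra)
  have DE: "?D = ?E"
  proof (rule measure_eqI_generator_eq[OF Int_stable_pair_measure_generator[of N S], where A = "\<lambda>_. space N \<times> space S"])
    show "{a \<times> b |a b. a \<in> sets N \<and> b \<in> sets S} \<subseteq> Pow (space N \<times> space S)"
      using sets.space_closed[of N] sets.space_closed[of S] by blast
    show "sets ?D = sigma_sets (space N \<times> space S) {a \<times> b |a b. a \<in> sets N \<and> b \<in> sets S}"
      "sets ?E = sigma_sets (space N \<times> space S) {a \<times> b |a b. a \<in> sets N \<and> b \<in> sets S}"
      unfolding sE by (simp_all add: sets_pair_measure)
    show "range (\<lambda>_. space N \<times> space S) \<subseteq> {a \<times> b |a b. a \<in> sets N \<and> b \<in> sets S}"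
      by auto
    show "emeasure ?D (space N \<times> space S) \<noteq> \<infinity>"
      by (simp add: emeasure_distr emeasure_eq_measure)
    fix Z assume "Z \<in> {a \<times> b |a b. a \<in> sets N \<and> b \<in> sets S}"
    then obtain A C where A[measurable]: "A \<in> sets N" and C[measurable]: "C \<in> sets S" and Z: "Z = A \<times> C" by auto
    have "emeasure ?D Z = emeasure M {\<omega> \<in> space M. X \<omega> \<in> A \<and> Y \<omega> \<in> C}"
      by (subst emeasure_distr) (auto intro!: arg_cong[where f = "emeasure M"] simp: Z)
    also have "\<dots> = (\<integral>\<^sup>+x\<in>A. emeasure (\<kappa> x) C \<partial>?L)" by (rule joint[OF A C])
    also have "\<dots> = (\<integral>\<^sup>+x. emeasure (?K x) Z \<partial>?L)"
    proof (intro nn_integral_cong)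
      fix x assume "x \<in> space ?L"
      then have x: "x \<in> space N" by simp
      have "emeasure (?K x) Z = emeasure (\<kappa> x) (Pair x -` Z \<inter> space (\<kappa> x))"
        using Pm[OF x] by (intro emeasure_distr) (auto simp: Z)
      also have "Pair x -` Z \<inter> space (\<kappa> x) = (if x \<in> A then C else {})"
        using sets.sets_into_space[OF C] sets_eq_imp_space_eq[OF \<kappa>S[OF x]] by (auto simp: Z)
      finally show "emeasure (\<kappa> x) C * indicator A x = emeasure (?K x) Z"
        by (auto simp: indicator_def)
    qed
    also have "\<dots> = emeasure ?E Z"
      by (rule emeasure_bind[OF ne K, symmetric]) (simp add: Z)
    finally show "emeasure ?D Z = emeasure ?E Z" .
  qed auto
  have "(\<integral>\<^sup>+\<omega>. \<Phi> (X \<omega>, Y \<omega>) \<partial>M) = (\<integral>\<^sup>+z. \<Phi> z \<partial>?D)"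
    by (rule nn_integral_distr[symmetric]) measurable
  also have "\<dots> = (\<integral>\<^sup>+x. \<integral>\<^sup>+z. \<Phi> z \<partial>?K x \<partial>?L)"
    unfolding DE by (rule nn_integral_bind[OF \<Phi> K])
  also have "\<dots> = (\<integral>\<^sup>+x. \<integral>\<^sup>+y. \<Phi> (x, y) \<partial>\<kappa> x \<partial>?L)"
    by (intro nn_integral_cong nn_integral_distr Pm) simp_all
  finally show ?thesis .
qed

section \<open>Identifying the kernel outside a null set\<close>

context
  fixes M :: "'a measure" and B :: "real \<Rightarrow> 'a \<Rightarrow> real"
    and \<kappa> :: "real \<times> real \<times> real \<Rightarrow> (real \<Rightarrow> real) measure"
  assumes bm: "std_brownian_motion M B"
    and rcd: "regular_cond_distr M borel (end_argmax_max B) path_space (sample_path B) \<kappa>"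
begin

interpretation brownian M B
  using bm unfolding brownian_def brownian_axioms_def by (auto simp: std_brownian_motion_def)

private lemma \<kappa>_measurable: "\<kappa> \<in> measurable borel (prob_algebra path_space)"
  using rcd by (auto simp: regular_cond_distr_def)

private lemma \<kappa>_subprob: "\<kappa> \<in> measurable borel (subprob_algebra path_space)"
  by (rule measurable_prob_algebraD[OF \<kappa>_measurable])

lemma \<kappa>_prob_space: "prob_space (\<kappa> x)" and sets_\<kappa>: "sets (\<kappa> x) = sets path_space"
  using measurable_space[OF \<kappa>_measurable, of x] by (auto simp: space_prob_algebra)

private abbreviation "law x \<equiv> (case x of (c, \<theta>, h) \<Rightarrow> ennreal (peak_density 1 \<theta> h c))"

private lemma law_measurable: "(\<lambda>x. law x) \<in> borel_measurable borel"
  unfolding borel_prod[symmetric] by measurable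

private lemma disintegration:
  assumes \<Phi>: "\<Phi> \<in> borel_measurable (borel \<Otimes>\<^sub>M path_space)"
  shows "(\<integral>\<^sup>+\<omega>. \<Phi> (end_argmax_max B \<omega>, sample_path B \<omega>) \<partial>M) = (\<integral>\<^sup>+x. law x * (\<integral>\<^sup>+f. \<Phi> (x, f) \<partial>\<kappa> x) \<partial>lborel)"
proof -
  have "(\<lambda>x. \<integral>\<^sup>+f. \<Phi> (x, f) \<partial>\<kappa> x) \<in> borel_measurable borel"
    using \<Phi> \<kappa>_subprob by (intro nn_integral_measurable_subprob_algebra2) auto
  then show ?thesis
    unfolding nn_integral_regular_cond_distr[OF prob_space_axioms rcd \<Phi>] distr_end_argmax_max
    using law_measurable by (intro nn_integral_density) simp_all
qed

text \<open>A zero density would hide an infinite g, as 0 times infinity is 0; hence the restriction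
  to points of positive density.\<close>

private lemma AE_law_mult_finite:
  assumes g: "g \<in> borel_measurable borel" and fin: "(\<integral>\<^sup>+x. law x * g x \<partial>lborel) < \<infinity>"
  shows "AE x in lborel. 0 < law x \<longrightarrow> g x < \<infinity>"
proof -
  have "AE x in lborel. law x * g x \<noteq> \<infinity>"
    using g law_measurable fin by (intro nn_integral_PInf_AE) (simp_all add: borel_measurable_times_ennreal)
  then show ?thesis
    by eventually_elim (auto simp: ennreal_mult_eq_top_iff less_top)
qed

text \<open>Rational times make the exceptional event measurable. Its probability is 0 because h is
  the maximum of the path, so it has conditional probability 0 wherever the density is positive, up
  to a null set.\<close>

private lemma AE_paths_le_max:
  "AE x in lborel. 0 < law x \<longrightarrow> (AE f in \<kappa> x. \<forall>q\<in>\<rat> \<inter> {0..1}. f q \<le> snd (snd x))"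
proof -
  define \<Phi> :: "(real \<times> real \<times> real) \<times> (real \<Rightarrow> real) \<Rightarrow> ennreal" where
    "\<Phi> z = (if \<forall>q\<in>\<rat> \<inter> {0..1}. snd z q \<le> snd (snd (fst z)) then 0 else 1)" for z
  have mx: "(\<lambda>x. snd (snd x)) \<in> borel_measurable (borel :: (real \<times> real \<times> real) measure)"
    unfolding borel_prod[symmetric] by measurable
  have \<Phi>: "\<Phi> \<in> borel_measurable (borel \<Otimes>\<^sub>M path_space)"
    unfolding \<Phi>_def
  proof (rule measurable_If)
    show "{z \<in> space ((borel :: (real \<times> real \<times> real) measure) \<Otimes>\<^sub>M path_space). \<forall>q\<in>\<rat> \<inter> {0..1}. snd z q \<le> snd (snd (fst z))}
      \<in> sets (borel \<Otimes>\<^sub>M path_space)"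
    proof (rule sets.sets_Collect_countable_All')
      fix q :: real assume "q \<in> \<rat> \<inter> {0..1}"
      then have [measurable]: "(\<lambda>z. snd z q) \<in> borel_measurable ((borel :: (real \<times> real \<times> real) measure) \<Otimes>\<^sub>M path_space)"
        by (intro measurable_compose[OF measurable_snd measurable_path_eval]) auto
      have [measurable]: "(\<lambda>z. snd (snd (fst z))) \<in> borel_measurable ((borel :: (real \<times> real \<times> real) measure) \<Otimes>\<^sub>M path_space)"
        by (rule measurable_compose[OF measurable_fst mx])
      show "{z \<in> space ((borel :: (real \<times> real \<times> real) measure) \<Otimes>\<^sub>M path_space). snd z q \<le> snd (snd (fst z))} \<in> sets ((borel :: (real \<times> real \<times> real) measure) \<Otimes>\<^sub>M path_space)"
        by measurable
    next
      show "countable (\<rat> \<inter> {0..1 :: real})" using countable_rat by blast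
    qed
  qed auto
  have m: "(\<lambda>x. \<integral>\<^sup>+f. \<Phi> (x, f) \<partial>\<kappa> x) \<in> borel_measurable borel"
    using \<Phi> \<kappa>_subprob by (intro nn_integral_measurable_subprob_algebra2) auto
  have "(\<integral>\<^sup>+x. law x * (\<integral>\<^sup>+f. \<Phi> (x, f) \<partial>\<kappa> x) \<partial>lborel) = (\<integral>\<^sup>+\<omega>. \<Phi> (end_argmax_max B \<omega>, sample_path B \<omega>) \<partial>M)"
    by (rule disintegration[OF \<Phi>, symmetric])
  also have "\<dots> = (\<integral>\<^sup>+\<omega>. 0 \<partial>M)"
  proof (intro nn_integral_cong)
    fix \<omega> assume w: "\<omega> \<in> space M"
    have c: "continuous_on {0..1} (\<lambda>s. B s \<omega>)" using w by (intro continuous_B) auto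
    show "\<Phi> (end_argmax_max B \<omega>, sample_path B \<omega>) = 0"
      using run_max_upper[OF c] by (simp add: \<Phi>_def end_argmax_max_eq sample_path_def)
  qed
  finally have "AE x in lborel. law x * (\<integral>\<^sup>+f. \<Phi> (x, f) \<partial>\<kappa> x) = 0"
    using m law_measurable by (subst nn_integral_0_iff_AE[symmetric]) (simp_all add: borel_measurable_times_ennreal)
  then show ?thesis
  proof eventually_elim
    case (elim x)
    show ?case
    proof
      assume "0 < law x"
      then have "(\<integral>\<^sup>+f. \<Phi> (x, f) \<partial>\<kappa> x) = 0" using elim by auto
      moreover have "(\<lambda>f. \<Phi> (x, f)) \<in> borel_measurable (\<kappa> x)"
        using measurable_compose[OF measurable_Pair1' \<Phi>, of x] by (simp add: measurable_cong_sets[OF sets_\<kappa>])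
      ultimately have "AE f in \<kappa> x. \<Phi> (x, f) = 0"
        by (simp add: nn_integral_0_iff_AE)
      then show "AE f in \<kappa> x. \<forall>q\<in>\<rat> \<inter> {0..1}. f q \<le> snd (snd x)"
        by eventually_elim (auto simp: \<Phi>_def split: if_splits)
    qed
  qed
qed

private lemma AE_sup_square_finite:
  "AE x in lborel. 0 < law x \<longrightarrow> (\<integral>\<^sup>+f. sup_square f \<partial>\<kappa> x) < \<infinity>"
proof (rule AE_law_mult_finite)
  have \<Phi>: "(\<lambda>z. sup_square (snd z)) \<in> borel_measurable ((borel :: (real \<times> real \<times> real) measure) \<Otimes>\<^sub>M path_space)"
    by (rule measurable_compose[OF measurable_snd measurable_sup_square])
  then show "(\<lambda>x. \<integral>\<^sup>+f. sup_square f \<partial>\<kappa> x) \<in> borel_measurable borel"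
    using \<kappa>_subprob by (intro nn_integral_measurable_subprob_algebra2) (auto simp: split_beta')
  obtain Z where Z: "(\<integral>\<^sup>+\<omega>. Z \<omega> \<partial>M) < \<infinity>" "\<And>\<omega> s. \<omega> \<in> space M \<Longrightarrow> s \<in> {0..1} \<Longrightarrow> ennreal ((B s \<omega>)\<^sup>2) \<le> Z \<omega>"
    using sup_square_integrable by blast
  have "(\<integral>\<^sup>+x. law x * (\<integral>\<^sup>+f. sup_square f \<partial>\<kappa> x) \<partial>lborel) = (\<integral>\<^sup>+\<omega>. sup_square (sample_path B \<omega>) \<partial>M)"
    using disintegration[OF \<Phi>] by simp
  also have "\<dots> \<le> (\<integral>\<^sup>+\<omega>. Z \<omega> \<partial>M)"
    unfolding sup_square_def using Z(2) by (intro nn_integral_mono SUP_least) (auto simp: sample_path_def)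
  finally show "(\<integral>\<^sup>+x. law x * (\<integral>\<^sup>+f. sup_square f \<partial>\<kappa> x) \<partial>lborel) < \<infinity>" using Z(1) by simp
qed

private lemma gap_integrable:
  assumes q: "0 < q" "q < 1" and j: "j \<in> {1, 2}"
  shows "(\<integral>\<^sup>+\<omega>. ennreal ((path_max (\<lambda>s. B s \<omega>) - B q \<omega>) ^ j) \<partial>M) < \<infinity>"
proof -
  obtain Z where Zm[measurable]: "Z \<in> borel_measurable M" and Z: "(\<integral>\<^sup>+\<omega>. Z \<omega> \<partial>M) < \<infinity>" "\<And>\<omega> s. \<omega> \<in> space M \<Longrightarrow> s \<in> {0..1} \<Longrightarrow> ennreal ((B s \<omega>)\<^sup>2) \<le> Z \<omega>"
    using sup_square_integrable by blast
  have "(\<integral>\<^sup>+\<omega>. ennreal ((path_max (\<lambda>s. B s \<omega>) - B q \<omega>) ^ j) \<partial>M) \<le> (\<integral>\<^sup>+\<omega>. 1 + 4 * Z \<omega> \<partial>M)"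
  proof (intro nn_integral_mono)
    fix \<omega> assume w: "\<omega> \<in> space M"
    have c: "continuous_on {0..1} (\<lambda>s. B s \<omega>)" using w by (intro continuous_B) auto
    obtain s where s: "s \<in> {0..1}" "B s \<omega> = path_max (\<lambda>s. B s \<omega>)"
      using run_max_attained[OF c] by (auto simp: path_max_eq_run_max)
    show "ennreal ((path_max (\<lambda>s. B s \<omega>) - B q \<omega>) ^ j) \<le> 1 + 4 * Z \<omega>"
    proof (cases "Z \<omega>")
      case (real r)
      have r: "(B s \<omega>)\<^sup>2 \<le> r" "(B q \<omega>)\<^sup>2 \<le> r"
        using Z(2)[OF w s(1)] Z(2)[OF w, of q] q real by auto
      define d where "d = B s \<omega> - B q \<omega>"
      have "d\<^sup>2 \<le> 2 * (B s \<omega>)\<^sup>2 + 2 * (B q \<omega>)\<^sup>2"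
        using zero_le_power2[of "B s \<omega> + B q \<omega>"] by (simp add: d_def power2_sum power2_diff)
      then have d2: "d\<^sup>2 \<le> 4 * r" using r by simp
      have "2 * d \<le> 1 + d\<^sup>2"
        using zero_le_power2[of "d - 1"] by (simp add: power2_diff)
      moreover have "0 \<le> d\<^sup>2" by simp
      ultimately have "d \<le> 1 + d\<^sup>2" by linarith
      \<comment> \<open>The common bound for both orders; 4 arises because each of the two squares
        is at most r and enters with factor 2.\<close>
      then have "d ^ j \<le> 1 + 4 * r" using d2 j by auto
      then have "ennreal (d ^ j) \<le> ennreal (1 + 4 * r)" by (rule ennreal_leI)
      then show ?thesis using real by (simp add: d_def s(2) ennreal_mult')
    qed (simp add: ennreal_mult_eq_top_iff)
  qed
  also have "\<dots> = 1 + 4 * (\<integral>\<^sup>+\<omega>. Z \<omega> \<partial>M)"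
    by (subst nn_integral_add) (simp_all add: nn_integral_cmult emeasure_space_1)
  also have "\<dots> < \<infinity>" using Z(1) by (simp add: ennreal_mult_less_top)
  finally show ?thesis .
qed

text \<open>The conditional moment and the meander formula, both multiplied by the density, have
  equal integrals over every Borel set. The total mass is finite, so they agree almost everywhere,
  and the density cancels where it is positive.\<close>

private lemma AE_gap_moment:
  assumes q: "0 < q" "q < 1" and j: "j \<in> {1, 2}"
  shows "AE x in lborel. 0 < law x \<longrightarrow>
    (\<integral>\<^sup>+f. ennreal ((snd (snd x) - f q) ^ j) \<partial>\<kappa> x) = ennreal (gap_moment j q (fst (snd x)) (snd (snd x)) (fst x))"
proof -
  define k where "k x = (\<integral>\<^sup>+f. ennreal ((snd (snd x) - f q) ^ j) \<partial>\<kappa> x)" for x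
  define g where "g x = ennreal (gap_moment j q (fst (snd x)) (snd (snd x)) (fst x))" for x :: "real \<times> real \<times> real"
  have mx: "(\<lambda>x. snd (snd x)) \<in> borel_measurable (borel :: (real \<times> real \<times> real) measure)"
    unfolding borel_prod[symmetric] by measurable
  have [measurable]: "(\<lambda>z. snd z q) \<in> borel_measurable ((borel :: (real \<times> real \<times> real) measure) \<Otimes>\<^sub>M path_space)"
    using q by (intro measurable_compose[OF measurable_snd measurable_path_eval]) auto
  have [measurable]: "(\<lambda>z. snd (snd (fst z))) \<in> borel_measurable ((borel :: (real \<times> real \<times> real) measure) \<Otimes>\<^sub>M path_space)"
    by (rule measurable_compose[OF measurable_fst mx])
  have \<Phi>[measurable]: "(\<lambda>z. ennreal ((snd (snd (fst z)) - snd z q) ^ j)) \<in> borel_measurable ((borel :: (real \<times> real \<times> real) measure) \<Otimes>\<^sub>M path_space)"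
    by measurable
  have k: "k \<in> borel_measurable borel"
    unfolding k_def using \<Phi> \<kappa>_subprob by (intro nn_integral_measurable_subprob_algebra2) (auto simp: split_beta')
  have g: "g \<in> borel_measurable borel"
    unfolding g_def borel_prod[symmetric] by measurable
  have lk: "(\<lambda>x. law x * k x) \<in> borel_measurable lborel" and lg: "(\<lambda>x. law x * g x) \<in> borel_measurable lborel"
    using k g law_measurable by (simp_all add: borel_measurable_times_ennreal)
  have j': "j = 1 \<or> j = 2" using j by auto
  have test: "(\<integral>\<^sup>+x. law x * k x * indicator A x \<partial>lborel) = (\<integral>\<^sup>+x. law x * g x * indicator A x \<partial>lborel)"
    "(\<integral>\<^sup>+x. law x * k x * indicator A x \<partial>lborel) = (\<integral>\<^sup>+\<omega>. ennreal ((path_max (\<lambda>s. B s \<omega>) - B q \<omega>) ^ j) * indicator A (end_argmax_max B \<omega>) \<partial>M)"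
    if A: "A \<in> sets borel" for A
  proof -
    have iA: "(indicator A :: _ \<Rightarrow> ennreal) \<in> borel_measurable borel" using A by simp
    have iA': "(\<lambda>z. indicator A (fst z) :: ennreal) \<in> borel_measurable (borel \<Otimes>\<^sub>M path_space)"
      by (rule measurable_compose[OF measurable_fst iA])
    have "(\<integral>\<^sup>+x. law x * k x * indicator A x \<partial>lborel)
      = (\<integral>\<^sup>+x. law x * (\<integral>\<^sup>+f. ennreal ((snd (snd x) - f q) ^ j) * indicator A x \<partial>\<kappa> x) \<partial>lborel)"
    proof (intro nn_integral_cong)
      fix x :: "real \<times> real \<times> real"
      have "(\<lambda>f. ennreal ((snd (snd x) - f q) ^ j)) \<in> borel_measurable (\<kappa> x)"
        using measurable_compose[OF measurable_Pair1' \<Phi>, of x] by (simp add: measurable_cong_sets[OF sets_\<kappa>])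
      then show "law x * k x * indicator A x = law x * (\<integral>\<^sup>+f. ennreal ((snd (snd x) - f q) ^ j) * indicator A x \<partial>\<kappa> x)"
        by (simp add: nn_integral_multc k_def mult.assoc)
    qed
    also have "\<dots> = (\<integral>\<^sup>+\<omega>. ennreal ((path_max (\<lambda>s. B s \<omega>) - B q \<omega>) ^ j) * indicator A (end_argmax_max B \<omega>) \<partial>M)"
      using disintegration[of "\<lambda>z. ennreal ((snd (snd (fst z)) - snd z q) ^ j) * indicator A (fst z)"] iA' q
      by (simp add: borel_measurable_times_ennreal[OF \<Phi> iA'] end_argmax_max_def sample_path_def)
    finally show 2: "(\<integral>\<^sup>+x. law x * k x * indicator A x \<partial>lborel)
      = (\<integral>\<^sup>+\<omega>. ennreal ((path_max (\<lambda>s. B s \<omega>) - B q \<omega>) ^ j) * indicator A (end_argmax_max B \<omega>) \<partial>M)" .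
    also have "\<dots> = (\<integral>\<^sup>+(c, \<theta>, h). indicator A (c, \<theta>, h) * (ennreal (peak_density 1 \<theta> h c) * ennreal (gap_moment j q \<theta> h c)) \<partial>lborel)"
      by (rule nn_integral_gap_moment[OF q j' iA])
    also have "\<dots> = (\<integral>\<^sup>+x. law x * g x * indicator A x \<partial>lborel)"
      by (intro nn_integral_cong) (auto simp: g_def mult_ac split_beta')
    finally show "(\<integral>\<^sup>+x. law x * k x * indicator A x \<partial>lborel) = (\<integral>\<^sup>+x. law x * g x * indicator A x \<partial>lborel)" .
  qed
  have "(\<integral>\<^sup>+x. law x * k x \<partial>lborel) < \<infinity>"
    using test(2)[of UNIV] gap_integrable[OF q j] by simp
  moreover have "density lborel (\<lambda>x. law x * k x) = density lborel (\<lambda>x. law x * g x)"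
  proof (rule measure_eqI)
    fix A assume "A \<in> sets (density lborel (\<lambda>x. law x * k x))"
    then have A: "A \<in> sets borel" by simp
    show "emeasure (density lborel (\<lambda>x. law x * k x)) A = emeasure (density lborel (\<lambda>x. law x * g x)) A"
      using test(1)[OF A] lk lg A by (simp add: emeasure_density)
  qed simp
  ultimately have "AE x in lborel. law x * k x = law x * g x"
    using finite_density_unique[OF lk lg] by (auto simp: less_top)
  then show ?thesis
  proof eventually_elim
    case (elim x)
    have "law x \<noteq> \<infinity>" by (simp add: split_beta')
    then show ?case using elim by (auto simp: k_def g_def ennreal_mult_cancel_left)
  qed
qed

text \<open>Countably many rational times and two orders, so the exceptional null sets can be
  united.\<close>

lemma AE_conditional_moments:
  "AE x in lborel. 0 < law x \<longrightarrow> (AE f in \<kappa> x. \<forall>q\<in>\<rat> \<inter> {0..1}. f q \<le> snd (snd x)) \<and>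
     (\<integral>\<^sup>+f. sup_square f \<partial>\<kappa> x) < \<infinity> \<and>
     (\<forall>q\<in>\<rat> \<inter> {0<..<1}. \<forall>j\<in>{1, 2}. (\<integral>\<^sup>+f. ennreal ((snd (snd x) - f q) ^ j) \<partial>\<kappa> x)
        = ennreal (gap_moment j q (fst (snd x)) (snd (snd x)) (fst x)))"
proof -
  have "AE x in lborel. \<forall>q\<in>\<rat> \<inter> {0<..<1}. \<forall>j\<in>{1, 2}. 0 < law x \<longrightarrow> (\<integral>\<^sup>+f. ennreal ((snd (snd x) - f q) ^ j) \<partial>\<kappa> x)
        = ennreal (gap_moment j q (fst (snd x)) (snd (snd x)) (fst x))"
  proof (intro AE_ball_countable')
    show "countable (\<rat> \<inter> {0<..<1 :: real})" using countable_rat by blast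
  qed (use AE_gap_moment in auto)
  with AE_paths_le_max AE_sup_square_finite show ?thesis
    by eventually_elim auto
qed

end

theorem theorem4p3:
  fixes M :: "'a measure"
    and B :: "real \<Rightarrow> 'a \<Rightarrow> real"
    and \<kappa> :: "real \<times> real \<times> real \<Rightarrow> (real \<Rightarrow> real) measure"
  assumes "std_brownian_motion M B"
    and "regular_cond_distr M borel (end_argmax_max B) path_space (sample_path B) \<kappa>"
  shows "AE (c, \<theta>, h) in lborel.
    0 < \<theta> \<and> \<theta> < 1 \<and> h > max 0 c \<longrightarrow>
      (\<forall>t\<in>{0..1}. integrable (\<kappa> (c, \<theta>, h)) (\<lambda>f. f t) \<and> integrable (\<kappa> (c, \<theta>, h)) (\<lambda>f. (f t)\<^sup>2)) \<and>
      (\<forall>t\<in>{0..\<theta>}.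
         prob_space.expectation (\<kappa> (c, \<theta>, h)) (\<lambda>f. f t)
           = h - sqrt \<theta> * M1 (1 - t / \<theta>) (h / sqrt \<theta>) \<and>
         h - sqrt \<theta> * M1 (1 - t / \<theta>) (h / sqrt \<theta>) = pre_max_mean \<theta> h t) \<and>
      (\<forall>t\<in>{\<theta>..1}.
         prob_space.expectation (\<kappa> (c, \<theta>, h)) (\<lambda>f. f t)
           = h - sqrt (1 - \<theta>) * M1 ((t - \<theta>) / (1 - \<theta>)) ((h - c) / sqrt (1 - \<theta>))) \<and>
      (\<forall>t\<in>{0..\<theta>}.
         let s = 1 - t / \<theta> in
         prob_space.expectation (\<kappa> (c, \<theta>, h)) (\<lambda>f. (f t)\<^sup>2)
           = h\<^sup>2 - 2 * h * sqrt \<theta> * M1 s (h / sqrt \<theta>) + \<theta> * M2 s (h / sqrt \<theta>)) \<and>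
      (\<forall>t\<in>{0..\<theta>}.
         prob_space.variance (\<kappa> (c, \<theta>, h)) (\<lambda>f. f t) = \<theta> * Vr (1 - t / \<theta>) (h / sqrt \<theta>)) \<and>
      (\<forall>t\<in>{\<theta>..1}.
         prob_space.variance (\<kappa> (c, \<theta>, h)) (\<lambda>f. f t)
           = (1 - \<theta>) * Vr ((t - \<theta>) / (1 - \<theta>)) ((h - c) / sqrt (1 - \<theta>)))"
  using AE_conditional_moments[OF assms]
proof eventually_elim
  case (elim x)
  obtain c \<theta> h where x: "x = (c, \<theta>, h)" by (cases x)
  show ?case
  proof (cases "0 < \<theta> \<and> \<theta> < 1 \<and> h > max 0 c")
    case True
    then have \<theta>: "0 < \<theta>" "\<theta> < 1" and h: "0 < h" "c < h" by auto
    \<comment> \<open>The range in the theorem lies in the set where the density of the conditioning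
      triple is positive; this is why the conclusion holds almost everywhere for Lebesgue measure
      and not merely for the law of the triple.\<close>
    have l: "0 < (case (c, \<theta>, h) of (c, \<theta>, h) \<Rightarrow> ennreal (peak_density 1 \<theta> h c))"
      using \<theta> h by (simp add: peak_density_def passage_pos)
    note A = elim[unfolded x, THEN mp, OF l, unfolded fst_conv snd_conv]
    have e: "AE f in \<kappa> (c, \<theta>, h). \<forall>q\<in>\<rat> \<inter> {0..1}. f q \<le> h" "(\<integral>\<^sup>+f. sup_square f \<partial>\<kappa> (c, \<theta>, h)) < \<infinity>"
      "\<And>q j. q \<in> \<rat> \<Longrightarrow> 0 < q \<Longrightarrow> q < 1 \<Longrightarrow> j \<in> {1, 2} \<Longrightarrow>
        (\<integral>\<^sup>+f. ennreal ((h - f q) ^ j) \<partial>\<kappa> (c, \<theta>, h)) = ennreal (gap_moment j q \<theta> h c)"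
      using A by (blast, blast, meson IntI greaterThanLessThan_iff)
    note K = \<kappa>_prob_space[OF assms, of "(c, \<theta>, h)"] and sK = sets_\<kappa>[OF assms, of "(c, \<theta>, h)"]
    note m = moments_from_rational_times[OF K sK \<theta> h e]
    show ?thesis
      unfolding x prod.case by (rule impI, rule conditional_moments[OF K \<theta> h]) (use m in blast)+
  next
    case False
    show ?thesis
      unfolding x prod.case by (rule impI, erule notE[OF False])
  qed
qed

end
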